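(* Let $n\ge 2$ and let $$\mathbf{Y}(\widetilde{B}_n)=\{x\in\mathbb{C}^n \mid x_i\pm x_j\notin\mathbb{Z}\ \text{for all } i\neq j,\ x_k\notin\mathbb{Z}\ \text{for all } k\}.$$ Let $W$ be the affine Weyl group of type $\widetilde{B}_n$, acting on $\mathbb{C}^n$ by complexified affine reflections, and let $\mathbf{X}(\widetilde{B}_n)=\mathbf{Y}(\widetilde{B}_n)/W$. Then $\mathbf{Y}(\widetilde{B}_n)$ and $\mathbf{X}(\widetilde{B}_n)$ are both $K(\pi,1)$ spaces.
   Context: The real affine reflection arrangement of type $\widetilde{B}_n$ in $\mathbb{R}^n$ consists of the hyperplanes $\{x_k=a\}$ for $1\le k\le n$, $a\in\mathbb{Z}$, and $\{x_i=\pm x_j+a\}$ for $1\le i<j\le n$, $a\in\mathbb{Z}$. The affine Weyl group $W$ of type $\widetilde{B}_n$ is the group generated by the orthogonal reflections in these hyperplanes; it is the semidirect product of the group $B_n$ of signed permutations of coordinates with the lattice of integer vectors whose coordinate sum is even. $\mathbf{Y}(\widetilde{B}_n)$ is the complement in $\mathbb{C}^n$ of the complexifications of these hyperplanes, and $W$ acts freely on it. *)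

theory Defs
  imports "HOL-Analysis.Analysis"
begin

text \<open>Aspherical (K(pi,1)) spaces: path-connected spaces all of whose higher homotopy
  groups vanish, i.e. every continuous map from a k-sphere (k >= 2) is (freely)
  null-homotopic.  For a path-connected space, vanishing of pi_k is equivalent to
  every map S^k -> X being homotopic to a constant map.\<close>
definition K_pi_1 :: "'a topology \<Rightarrow> bool" where
  "K_pi_1 X \<longleftrightarrow> path_connected_space X \<and>
     (\<forall>k\<ge>2. \<forall>f. continuous_map (nsphere k) X f \<longrightarrow>
        (\<exists>c\<in>topspace X. homotopic_with (\<lambda>_. True) (nsphere k) X f (\<lambda>_. c)))"

definition Y_Bn :: "(complex ^ 'n) set" where
  "Y_Bn = {x. (\<forall>i j. i \<noteq> j \<longrightarrow> x$i + x$j \<notin> \<int> \<and> x$i - x$j \<notin> \<int>) \<and> (\<forall>k. x$k \<notin> \<int>)}"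

definition W_Bn :: "((complex ^ 'n) \<Rightarrow> (complex ^ 'n)) set" where
  "W_Bn = {(\<lambda>x. \<chi> i. of_int (e i) * x $ (p i) + of_int (t i)) | p e t.
             p permutes (UNIV :: 'n set) \<and> (\<forall>i. e i = 1 \<or> e i = -1) \<and> even (\<Sum>i\<in>UNIV. t i)}"

definition W_orbit :: "complex ^ 'n \<Rightarrow> (complex ^ 'n) set" where
  "W_orbit x = (\<lambda>w. w x) ` W_Bn"

definition X_Bn :: "(complex ^ 'n) set topology" where
  "X_Bn = topology (\<lambda>U. U \<subseteq> W_orbit ` Y_Bn \<and>
                        openin (top_of_set Y_Bn) {x \<in> Y_Bn. W_orbit x \<in> U})"

end

theory Submission
  imports Defs "HOL-Complex_Analysis.Riemann_Mapping"
begin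

text \<open>
  Via \<open>y = (1 + z) / (1 - z)\<close> with \<open>z = exp (2 \<pi> \<i> x)\<close>, the space \<open>Y\<close> covers
  \<open>{y. y i \<noteq> 1, y i \<noteq> -1, y i \<noteq> y j, y i \<noteq> - y j}\<close>. Put \<open>y 0 = 1\<close>. As in Brieskorn's treatment of type D,
  the differences \<open>(y i)\<^sup>2 - (y 0)\<^sup>2\<close> form a configuration of distinct points \<open>z i\<close> of the plane (with \<open>z 0 = 0\<close>), and
  \<open>y\<close> is recovered from a point \<open>p\<close> of the plane together with square roots of the \<open>p - z i\<close>. Homotopies of the configuration lift:
  \<open>p\<close> is dragged along with the points \<open>z i\<close>, and the roots change by a factor close to 1. The same lifting,
  with \<open>p\<close> kept away from all \<open>z i\<close>, deals with the configurations themselves (Fadell and Neuwirth).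

  What remains are the fibers, curves \<open>(u b)\<^sup>2 = p - b\<close> (\<open>b\<close> in a finite set) with some branch points removed.
  That maps from spheres into them are null-homotopic follows from an extremal form of Koebe's construction of the uniformization. Lift the map to
  a bounded domain over which the curve is uniformized except at some marked points of the unit disc. A square root branched at a marked point
  decreases the derivative of the uniformizing map at 0 by a definite factor, and spheres have no nontrivial
  double coverings, so the map lifts further. By the Schwarz lemma these derivatives are bounded from below, while by the Schwarz-Pick lemma all
  lifts stay in one compact part of the disc. Hence for an almost minimal derivative the lift lies in a disc without marked points,
  where it can be contracted.

  The affine Weyl group acts on \<open>Y\<close> as a group of deck transformations, so maps from spheres into the quotient lift to \<open>Y\<close>.
\<close>

section \<open>Coverings and spheres\<close>

text \<open>The coordinate \<open>y\<close> is chosen because the inversion of \<open>z\<close>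
  becomes \<open>y -> -y\<close>, while the missing points 0 and infinity of the
  \<open>z\<close>-line become the walls \<open>y = 1\<close> and \<open>y = -1\<close>. The
  coordinates \<open>y i\<close> may vanish, since \<open>x i\<close> may be a half-integer. So the
  fibers are genuinely branched over the plane, and the points \<open>z i\<close> are of two kinds,
  removed points and branch points. This shapes the argument. A map into a fiber has to be handled
  together with its roots, as its projection to the plane forgets signs near a branch point; discs
  around branch points have to be tested in the coordinate of the root; and a sign has to be carried
  across the zeros of a root, for which double coverings are encoded by vectors with an additional
  real entry. No limit of uniformizing maps is formed: one almost minimal stage is enough, because
  only the compact image of the lift matters. Half-integers are also what the parity condition in
  \<open>W\<close> is about: a sign change of one coordinate followed by an odd translation of it
  has fixed points in \<open>Y\<close>.\<close>

definition evenly_covered :: "'a topology \<Rightarrow> 'b topology \<Rightarrow> ('a \<Rightarrow> 'b) \<Rightarrow> 'b set \<Rightarrow> bool" where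
  "evenly_covered Y Q p U \<longleftrightarrow> openin Q U \<and>
     (\<exists>\<V>. \<Union>\<V> = {y \<in> topspace Y. p y \<in> U} \<and> pairwise disjnt \<V> \<and>
        (\<forall>V\<in>\<V>. openin Y V \<and> (\<exists>s. homeomorphic_maps (subtopology Y V) (subtopology Q U) p s)))"

text \<open>Formulated for abstract topologies and not for sets, because the base
  \<open>X_Bn\<close> is a topology on a set of orbits. An empty family of sheets is allowed, so
  surjectivity is not built in.\<close>

definition covering_map_top :: "'a topology \<Rightarrow> 'b topology \<Rightarrow> ('a \<Rightarrow> 'b) \<Rightarrow> bool" where
  "covering_map_top Y Q p \<longleftrightarrow> continuous_map Y Q p \<and>
     (\<forall>q\<in>topspace Q. \<exists>U. q \<in> U \<and> evenly_covered Y Q p U)"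

lemma evenly_coveredE:
  assumes "evenly_covered Y Q p U"
  obtains \<V> where "openin Q U" "\<Union>\<V> = {y \<in> topspace Y. p y \<in> U}" "pairwise disjnt \<V>"
    "\<forall>V\<in>\<V>. openin Y V" "\<forall>V\<in>\<V>. \<exists>s. homeomorphic_maps (subtopology Y V) (subtopology Q U) p s"
proof -
  from assms have U: "openin Q U" and "\<exists>\<V>. \<Union>\<V> = {y \<in> topspace Y. p y \<in> U} \<and> pairwise disjnt \<V> \<and>
        (\<forall>V\<in>\<V>. openin Y V \<and> (\<exists>s. homeomorphic_maps (subtopology Y V) (subtopology Q U) p s))"
    unfolding evenly_covered_def by (rule conjunct1, rule conjunct2)
  from this(2) obtain \<V> where "\<Union>\<V> = {y \<in> topspace Y. p y \<in> U} \<and> pairwise disjnt \<V> \<and>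
        (\<forall>V\<in>\<V>. openin Y V \<and> (\<exists>s. homeomorphic_maps (subtopology Y V) (subtopology Q U) p s))"
    by (rule exE)
  then show thesis using that[of \<V>] U by simp
qed

text \<open>The set where two lifts agree is open and closed: near a point their values stay in
  fixed sheets \<open>V1\<close> and \<open>V2\<close> over the same \<open>U\<close>. Distinct
  sheets are disjoint, and on a common sheet the projection is injective.\<close>

lemma covering_map_top_lift_unique:
  assumes cov: "covering_map_top Y Q p"
    and C: "connected_space C"
    and g: "continuous_map C Y g" and h: "continuous_map C Y h"
    and gh: "\<And>x. x \<in> topspace C \<Longrightarrow> p (g x) = p (h x)"
    and a: "a \<in> topspace C" "g a = h a" and x: "x \<in> topspace C"
  shows "g x = h x"
proof -
  have loc: "\<exists>T. openin C T \<and> y \<in> T \<and> (\<forall>z\<in>T. (g z = h z) = (g y = h y))" if y: "y \<in> topspace C" for y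
  proof -
    have gy: "g y \<in> topspace Y" "h y \<in> topspace Y"
      using g h y by (auto simp: continuous_map_def)
    have pc: "continuous_map Y Q p" using cov by (simp add: covering_map_top_def)
    then have "p (g y) \<in> topspace Q" using gy by (auto simp: continuous_map_def)
    then obtain U where U: "p (g y) \<in> U" and ev: "evenly_covered Y Q p U"
      using cov unfolding covering_map_top_def by blast
    obtain \<V> where oU: "openin Q U" and V: "\<Union>\<V> = {y \<in> topspace Y. p y \<in> U}" "pairwise disjnt \<V>"
       "\<forall>V\<in>\<V>. openin Y V" "\<forall>V\<in>\<V>. \<exists>s. homeomorphic_maps (subtopology Y V) (subtopology Q U) p s"
      using ev by (rule evenly_coveredE)
    obtain V1 where V1: "V1 \<in> \<V>" "g y \<in> V1" using V(1) U gy by blast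
    have "p (h y) \<in> U" using gh[OF y] U by simp
    then obtain V2 where V2: "V2 \<in> \<V>" "h y \<in> V2" using V(1) gy by blast
    define T where "T = {z \<in> topspace C. g z \<in> V1} \<inter> {z \<in> topspace C. h z \<in> V2}"
    have "openin C T" unfolding T_def
      using V(3)[rule_format, OF V1(1)] V(3)[rule_format, OF V2(1)] g h by (intro openin_Int) (auto simp: continuous_map_def)
    moreover have "y \<in> T" using y V1 V2 by (simp add: T_def)
    moreover have "(g z = h z) = (V1 = V2)" if z: "z \<in> T" for z
    proof
      assume "g z = h z"
      then show "V1 = V2" using V(2) V1 V2 z by (auto simp: pairwise_def disjnt_def T_def)
    next
      assume "V1 = V2"
      moreover obtain s where s: "homeomorphic_maps (subtopology Y V1) (subtopology Q U) p s"
        using V(4)[rule_format, OF V1(1)] by auto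
      moreover have "g z \<in> topspace (subtopology Y V1)" "h z \<in> topspace (subtopology Y V2)"
        using z g h by (auto simp: T_def continuous_map_def)
      ultimately show "g z = h z"
        using gh z unfolding homeomorphic_maps_def T_def by (metis (no_types, lifting) IntD1 mem_Collect_eq)
    qed
    ultimately show ?thesis by blast
  qed
  have opn: "openin C {x \<in> topspace C. (g x = h x) = b}" for b
  proof (subst openin_subopen, intro ballI)
    fix y assume y: "y \<in> {x \<in> topspace C. (g x = h x) = b}"
    then obtain T where T: "openin C T" "y \<in> T" "\<forall>z\<in>T. (g z = h z) = (g y = h y)" using loc by blast
    have "T \<subseteq> {x \<in> topspace C. (g x = h x) = b}" using T(3) y openin_subset[OF T(1)] by auto
    then show "\<exists>T. openin C T \<and> y \<in> T \<and> T \<subseteq> {x \<in> topspace C. (g x = h x) = b}" using T by blast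
  qed
  have "openin C {x \<in> topspace C. g x = h x}" using opn[of True] by simp
  moreover have "openin C {x \<in> topspace C. g x \<noteq> h x}" using opn[of False] by simp
  moreover have "topspace C \<subseteq> {x \<in> topspace C. g x = h x} \<union> {x \<in> topspace C. g x \<noteq> h x}"
    "{x \<in> topspace C. g x = h x} \<inter> {x \<in> topspace C. g x \<noteq> h x} = {}"
    "{x \<in> topspace C. g x = h x} \<noteq> {}" using a by auto
  ultimately have "\<not> {x \<in> topspace C. g x \<noteq> h x} \<noteq> {}"
    using C unfolding connected_space_def by (intro notI) (erule notE, intro exI conjI)
  then show ?thesis using x by blast
qed

text \<open>The time interval is so short that whole cylinders over small balls are mapped into
  evenly covered sets, where \<open>H\<close> is lifted by the inverse on the sheet containing the
  starting value. Two such local lifts are compared only along segments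
  \<open>{a..b} \<times> {y}\<close>, which are connected; hence \<open>Z\<close> may be any metric
  space.\<close>

lemma covering_lift_short:
  fixes Z :: "'z::metric_space set" and H :: "real \<times> 'z \<Rightarrow> 'q"
  assumes cov: "covering_map_top Y Q p"
    and H: "continuous_map (top_of_set ({a..b} \<times> Z)) Q H" and ab: "a \<le> b"
    and f: "continuous_map (top_of_set Z) Y f"
    and fH: "\<And>z. z \<in> Z \<Longrightarrow> p (f z) = H (a, z)"
    and d: "0 < d"
    and ev: "\<And>z. z \<in> Z \<Longrightarrow> \<exists>U. evenly_covered Y Q p U \<and> H ` ({a..b} \<times> (Z \<inter> ball z d)) \<subseteq> U"
  obtains G where "continuous_map (top_of_set ({a..b} \<times> Z)) Y G"
    "\<And>z. z \<in> Z \<Longrightarrow> G (a, z) = f z"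
    "\<And>w. w \<in> {a..b} \<times> Z \<Longrightarrow> p (G w) = H w"
proof -
  have "\<exists>V s. openin Y V \<and> f z \<in> V \<and> (\<forall>x\<in>{a..b}\<times>(Z \<inter> ball z d). s (H x) \<in> V \<and> p (s (H x)) = H x) \<and> (\<forall>v\<in>V. s (p v) = v)
     \<and> continuous_map (top_of_set ({a..b}\<times>(Z \<inter> ball z d))) Y (\<lambda>x. s (H x))" if z: "z \<in> Z" for z
  proof -
    obtain U where evU: "evenly_covered Y Q p U" and U2: "H ` ({a..b} \<times> (Z \<inter> ball z d)) \<subseteq> U"
      using ev[OF z] by blast
    obtain \<V> where U: "openin Q U" "\<Union>\<V> = {y \<in> topspace Y. p y \<in> U}" "pairwise disjnt \<V>" and
       V: "\<forall>V\<in>\<V>. openin Y V" "\<forall>V\<in>\<V>. \<exists>s. homeomorphic_maps (subtopology Y V) (subtopology Q U) p s"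
      using evU by (rule evenly_coveredE)
    have "H (a, z) \<in> U" using U2 z ab d by (auto simp: image_subset_iff)
    moreover have "f z \<in> topspace Y" using f z by (auto simp: continuous_map_def)
    ultimately have "f z \<in> \<Union>\<V>" unfolding U(2) using fH[OF z] by auto
    then obtain V where V1: "V \<in> \<V>" "f z \<in> V" by blast
    obtain s where s: "homeomorphic_maps (subtopology Y V) (subtopology Q U) p s"
      using V(2)[rule_format, OF V1(1)] by blast
    have VY: "V \<subseteq> topspace Y" by (rule openin_subset[OF V(1)[rule_format, OF V1(1)]])
    have UQ: "U \<subseteq> topspace Q" by (rule openin_subset[OF U(1)])
    have sc: "continuous_map (subtopology Q U) (subtopology Y V) s" using s by (simp add: homeomorphic_maps_def)
    have s1: "\<And>u. u \<in> U \<Longrightarrow> s u \<in> V \<and> p (s u) = u" "\<And>v. v \<in> V \<Longrightarrow> s (p v) = v"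
      using s UQ VY by (auto simp: homeomorphic_maps_def continuous_map_def)
    have HcU: "continuous_map (top_of_set ({a..b}\<times>(Z \<inter> ball z d))) (subtopology Q U) H"
    proof -
      have "continuous_map (top_of_set ({a..b}\<times>(Z \<inter> ball z d))) Q H"
        by (rule continuous_map_from_subtopology_mono[OF H]) auto
      then show ?thesis using U2 by (auto simp: continuous_map_in_subtopology)
    qed
    have "continuous_map (top_of_set ({a..b}\<times>(Z \<inter> ball z d))) Y (\<lambda>x. s (H x))"
      using continuous_map_compose[OF HcU continuous_map_into_fulltopology[OF sc]] by (simp add: o_def)
    then show ?thesis
      using V(1)[rule_format, OF V1(1)] V1(2) s1 U2 by (intro exI[of _ V] exI[of _ s]) (auto simp: image_subset_iff)
  qed
  then obtain V s where Vs: "\<And>z. z \<in> Z \<Longrightarrow> openin Y (V z) \<and> f z \<in> V z \<and> (\<forall>x\<in>{a..b}\<times>(Z \<inter> ball z d). s z (H x) \<in> V z \<and> p (s z (H x)) = H x) \<and> (\<forall>v\<in>V z. s z (p v) = v)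
     \<and> continuous_map (top_of_set ({a..b}\<times>(Z \<inter> ball z d))) Y (\<lambda>x. s z (H x))"
    by metis
  define G where "G = (\<lambda>w. s (snd w) (H w))"
  have Gz: "G (a, z) = f z" if "z \<in> Z" for z
    using Vs[OF that] fH[OF that] by (metis G_def snd_conv)
  have Gp: "p (G w) = H w" if "w \<in> {a..b} \<times> Z" for w
    using that Vs[of "snd w"] d by (auto simp: G_def)
  have eq: "G (t, y) = s z (H (t, y))" if z: "z \<in> Z" and y: "y \<in> Z" "y \<in> ball z d" "f y \<in> V z" and t: "t \<in> {a..b}" for z y t
  proof -
    have c: "continuous_map (top_of_set {a..b}) Y (\<lambda>t. s z' (H (t, y)))" if z': "z' \<in> Z" "y \<in> ball z' d" for z'
    proof -
      have "continuous_map (top_of_set {a..b}) (top_of_set ({a..b}\<times>(Z \<inter> ball z' d))) (\<lambda>t. (t, y))"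
        using z' y by (auto intro!: continuous_intros)
      from continuous_map_compose[OF this, of Y "\<lambda>x. s z' (H x)"] Vs[OF z'(1)]
      show ?thesis by (simp add: o_def)
    qed
    have "s y (H (t,y)) = s z (H (t,y))"
    proof (rule covering_map_top_lift_unique[OF cov, where a=a])
      show "connected_space (top_of_set {a..b})" by (simp add: connected_space_subtopology)
      show "continuous_map (top_of_set {a..b}) Y (\<lambda>t. s y (H (t, y)))" using c y d by simp
      show "continuous_map (top_of_set {a..b}) Y (\<lambda>t. s z (H (t, y)))" using c z y d by simp
      show "p (s y (H (x, y))) = p (s z (H (x, y)))" if "x \<in> topspace (top_of_set {a..b})" for x
        using that Vs[of y] Vs[of z] y z d by auto
      show "s y (H (a, y)) = s z (H (a, y))"
        using Vs[of y] Vs[of z] y z fH[of y] by metis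
    qed (use t ab in auto)
    then show ?thesis by (simp add: G_def)
  qed
  have "continuous_map (top_of_set ({a..b} \<times> Z)) Y G"
  proof (rule pasting_lemma)
    \<comment> \<open>Over the full ball the starting map \<open>f\<close> may pass to another
      sheet; the formula with the inverse on \<open>V z\<close> is right only where
      \<open>f y \<in> V z\<close>.\<close>
    show "openin (top_of_set ({a..b} \<times> Z)) ({a..b} \<times> {y \<in> Z. y \<in> ball z d \<and> f y \<in> V z})" if "z \<in> Z" for z
    proof -
      have "openin (top_of_set Z) {y \<in> topspace (top_of_set Z). f y \<in> V z}"
        using f Vs[OF that] by (auto simp: continuous_map_def)
      moreover have "openin (top_of_set Z) (Z \<inter> ball z d)" by auto
      ultimately have "openin (top_of_set Z) (Z \<inter> ball z d \<inter> {y \<in> topspace (top_of_set Z). f y \<in> V z})"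
        by (rule openin_Int[rotated])
      moreover have "(Z \<inter> ball z d \<inter> {y \<in> topspace (top_of_set Z). f y \<in> V z}) = {y \<in> Z. y \<in> ball z d \<and> f y \<in> V z}" by auto
      ultimately show ?thesis by (auto intro!: openin_Times)
    qed
    show "continuous_map (subtopology (top_of_set ({a..b} \<times> Z)) ({a..b} \<times> {y \<in> Z. y \<in> ball z d \<and> f y \<in> V z})) Y (\<lambda>x. s z (H x))" if "z \<in> Z" for z
    proof -
      have "subtopology (top_of_set ({a..b} \<times> Z)) ({a..b} \<times> {y \<in> Z. y \<in> ball z d \<and> f y \<in> V z}) = 
          top_of_set ({a..b} \<times> {y \<in> Z. y \<in> ball z d \<and> f y \<in> V z})"
        by (auto simp: subtopology_subtopology intro!: arg_cong[of _ _ "subtopology euclidean"])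
      moreover have "continuous_map (top_of_set ({a..b}\<times>(Z \<inter> ball z d))) Y (\<lambda>x. s z (H x))" using Vs[OF that] by blast
      then have "continuous_map (top_of_set ({a..b} \<times> {y \<in> Z. y \<in> ball z d \<and> f y \<in> V z})) Y (\<lambda>x. s z (H x))"
        by (rule continuous_map_from_subtopology_mono) auto
      ultimately show ?thesis by simp
    qed
    show "s i (H x) = s j (H x)" if "i \<in> Z" "j \<in> Z" 
      "x \<in> topspace (top_of_set ({a..b} \<times> Z)) \<inter> ({a..b} \<times> {y \<in> Z. y \<in> ball i d \<and> f y \<in> V i}) \<inter> ({a..b} \<times> {y \<in> Z. y \<in> ball j d \<and> f y \<in> V j})" for i j x
      using eq[of i "snd x" "fst x"] eq[of j "snd x" "fst x"] that by auto
    show "\<exists>j. j \<in> Z \<and> x \<in> {a..b} \<times> {y \<in> Z. y \<in> ball j d \<and> f y \<in> V j} \<and> G x = s j (H x)" if "x \<in> topspace (top_of_set ({a..b} \<times> Z))" for x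
      using that d Vs by (intro exI[of _ "snd x"]) (auto simp: G_def)
  qed
  from that[OF this Gz Gp] show ?thesis .
qed

text \<open>A Lebesgue number of the cover by preimages of evenly covered sets allows one and the
  same step length for all of \<open>Z\<close>; short lifts are then concatenated in time.\<close>

proposition covering_map_top_lift_homotopy:
  fixes Z :: "'z::metric_space set" and H :: "real \<times> 'z \<Rightarrow> 'q"
  assumes cov: "covering_map_top Y Q p" and Z: "compact Z"
    and H: "continuous_map (top_of_set ({0..1} \<times> Z)) Q H"
    and f: "continuous_map (top_of_set Z) Y f"
    and fH: "\<And>z. z \<in> Z \<Longrightarrow> p (f z) = H (0, z)"
  obtains G where "continuous_map (top_of_set ({0..1} \<times> Z)) Y G"
    "\<And>z. z \<in> Z \<Longrightarrow> G (0, z) = f z"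
    "\<And>w. w \<in> {0..1} \<times> Z \<Longrightarrow> p (G w) = H w"
proof -
  define \<C> where "\<C> = {T. open T \<and> (\<exists>U. evenly_covered Y Q p U \<and> H ` (T \<inter> ({0..1} \<times> Z)) \<subseteq> U)}"
  have cover: "{0..1} \<times> Z \<subseteq> \<Union>\<C>"
  proof
    fix w :: "real \<times> 'z" assume w: "w \<in> {0..1} \<times> Z"
    then have "H w \<in> topspace Q" using H by (auto simp: continuous_map_def)
    then obtain U where U: "evenly_covered Y Q p U" "H w \<in> U" using cov unfolding covering_map_top_def by blast
    have "openin (top_of_set ({0..1} \<times> Z)) {w \<in> topspace (top_of_set ({0..1} \<times> Z)). H w \<in> U}"
      using H U by (auto simp: continuous_map_def evenly_covered_def)
    then obtain T where T: "open T" "{w \<in> {0..1} \<times> Z. H w \<in> U} = ({0..1} \<times> Z) \<inter> T"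
      by (auto simp: openin_open)
    then have "T \<in> \<C>" using U by (auto simp: \<C>_def)
    moreover have "w \<in> T" using T w U by blast
    ultimately show "w \<in> \<Union>\<C>" by blast
  qed
  have comp: "compact ({0..1::real} \<times> Z)" by (intro compact_Times Z) simp
  \<comment> \<open>Makes the cover a nonempty family even for empty \<open>Z\<close>, as the lemma
    on Lebesgue numbers demands.\<close>
  have emp: "{} \<in> \<C>"
    unfolding \<C>_def evenly_covered_def by (auto intro!: exI[of _ "{}"])
  obtain \<delta> where \<delta>: "0 < \<delta>" "\<And>T. \<lbrakk>T \<subseteq> {0..1} \<times> Z; diameter T < \<delta>\<rbrakk> \<Longrightarrow> \<exists>B \<in> \<C>. T \<subseteq> B"
    using Lebesgue_number_lemma[OF comp _ cover] emp by (metis (no_types, lifting) \<C>_def empty_iff mem_Collect_eq)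
  \<comment> \<open>A time step contributes at most \<delta>/8 and a ball of radius \<delta>/8 at
    most \<delta>/4 to the diameter of a cylinder, which therefore stays below \<delta>/2.\<close>
  obtain N where N: "N > 0" "1 / real N < \<delta> / 8"
    using \<delta>(1) reals_Archimedean[of "\<delta>/8"] by (metis half_gt_zero inverse_eq_divide of_nat_0_less_iff zero_less_Suc zero_less_divide_iff zero_less_numeral)
  have small: "\<exists>U. evenly_covered Y Q p U \<and> H ` ({a..b} \<times> (Z \<inter> ball z (\<delta>/8))) \<subseteq> U" 
    if ab: "0 \<le> a" "a \<le> b" "b \<le> 1" "b - a \<le> 1 / N" and z: "z \<in> Z" for a b z
  proof -
    let ?T = "{a..b} \<times> (Z \<inter> ball z (\<delta>/8))"
    have "diameter ?T \<le> \<delta> / 2"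
    proof -
      have "dist x y \<le> \<delta> / 2" if xy: "x \<in> ?T" "y \<in> ?T" for x y
      proof -
      have "dist (fst x) (fst y) \<le> b - a" using xy ab by (auto simp: dist_real_def)
      then have "dist (fst x) (fst y) \<le> \<delta>/8" using ab N(2) by linarith
      moreover have "dist (snd x) (snd y) \<le> \<delta>/8 + \<delta>/8" 
        using xy dist_triangle3[of "snd x" "snd y" z] by (auto)
      moreover have "dist x y \<le> dist (fst x) (fst y) + dist (snd x) (snd y)"
        by (metis dist_prod_def sqrt_sum_squares_le_sum zero_le_dist)
      ultimately show "dist x y \<le> \<delta> / 2" using \<delta>(1) by linarith
      qed
      moreover have "?T \<noteq> {}" using z ab \<delta>(1) by auto
      ultimately have "(SUP (x,y)\<in>?T \<times> ?T. dist x y) \<le> \<delta>/2" by (intro cSUP_least) auto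
      then show ?thesis using \<open>?T \<noteq> {}\<close> unfolding diameter_def by simp
    qed
    moreover have sub: "?T \<subseteq> {0..1} \<times> Z" using ab by auto
    ultimately obtain B where B: "B \<in> \<C>" "?T \<subseteq> B" using \<delta>(2)[of ?T] \<delta>(1) by (auto simp: subset_iff)
    then show ?thesis using sub unfolding \<C>_def by blast
  qed
  have "\<exists>G. continuous_map (top_of_set ({0..real j/N} \<times> Z)) Y G \<and> (\<forall>z\<in>Z. G (0,z) = f z) \<and>
         (\<forall>w\<in>{0..real j/N} \<times> Z. p (G w) = H w)" if "j \<le> N" for j
    using that
  proof (induction j)
    case 0
    have "continuous_map (top_of_set ({0..real 0/N} \<times> Z)) (top_of_set Z) snd"
      by (auto intro!: continuous_intros)
    from continuous_map_compose[OF this f] show ?case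
      using fH by (intro exI[of _ "f \<circ> snd"]) (auto simp: o_def)
  next
    case (Suc j)
    then obtain G where G: "continuous_map (top_of_set ({0..real j/N} \<times> Z)) Y G" "\<And>z. z\<in>Z \<Longrightarrow> G (0,z) = f z"
         "\<And>w. w\<in>{0..real j/N} \<times> Z \<Longrightarrow> p (G w) = H w" by auto
    let ?a = "real j/N" and ?b = "real (Suc j)/N"
    have j0: "0 \<le> t" if "?a \<le> t" for t using that by (rule order_trans[rotated]) simp
    have a: "0 \<le> ?a" "?a \<le> ?b" "?b \<le> 1" "?b - ?a \<le> 1/N"
      using N Suc.prems by (auto simp: divide_simps)
    have Hab: "continuous_map (top_of_set ({?a..?b} \<times> Z)) Q H"
      by (rule continuous_map_from_subtopology_mono[OF H]) (use a(3) j0 in \<open>auto intro: order_trans\<close>)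
    have "continuous_map (top_of_set Z) (top_of_set ({0..?a} \<times> Z)) (\<lambda>z. (?a, z))"
      using a by (auto intro!: continuous_intros)
    from continuous_map_compose[OF this G(1)] have fa: "continuous_map (top_of_set Z) Y (\<lambda>z. G (?a, z))" by (simp add: o_def)
    obtain G' where G': "continuous_map (top_of_set ({?a..?b} \<times> Z)) Y G'"
       "\<And>z. z \<in> Z \<Longrightarrow> G' (?a, z) = G (?a, z)" "\<And>w. w \<in> {?a..?b} \<times> Z \<Longrightarrow> p (G' w) = H w"
    proof (rule covering_lift_short[OF cov Hab a(2) fa, of "\<delta>/8"])
      show "p (G (?a, z)) = H (?a, z)" if "z \<in> Z" for z using G(3) that a by auto
      show "0 < \<delta>/8" using \<delta> by simp
      show "\<exists>U. evenly_covered Y Q p U \<and> H ` ({?a..?b} \<times> (Z \<inter> ball z (\<delta> / 8))) \<subseteq> U"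
        if "z \<in> Z" for z
        using small[OF a that] .
    qed blast
    define K where "K = (\<lambda>w. if fst w \<le> ?a then G w else G' w)"
    have c1: "continuous_map (top_of_set ({0..?b} \<times> Z)) Y K"
      unfolding K_def
    proof (rule continuous_map_cases_le)
      show "continuous_map (top_of_set ({0..?b} \<times> Z)) euclideanreal fst" 
       "continuous_map (top_of_set ({0..?b} \<times> Z)) euclideanreal (\<lambda>x. ?a)" by (auto intro!: continuous_intros)
      show "continuous_map (subtopology (top_of_set ({0..?b} \<times> Z)) {x \<in> topspace (top_of_set ({0..?b} \<times> Z)). fst x \<le> ?a}) Y G"
        using continuous_map_from_subtopology_mono[OF G(1)]  by (simp add: subtopology_subtopology subset_iff)
      show "continuous_map (subtopology (top_of_set ({0..?b} \<times> Z)) {x \<in> topspace (top_of_set ({0..?b} \<times> Z)). ?a \<le> fst x}) Y G'"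
        using continuous_map_from_subtopology_mono[OF G'(1)]  by (simp add: subtopology_subtopology subset_iff)
      show "G x = G' x" if "x \<in> topspace (top_of_set ({0..?b} \<times> Z))" "fst x = ?a" for x
        using G'(2)[of "snd x"] that by (auto)
    qed
    show ?case
    proof (intro exI[of _ K] conjI ballI)
      show "K (0,z) = f z" if "z \<in> Z" for z using G(2) that a by (simp add: K_def)
      show "p (K w) = H w" if "w \<in> {0..?b} \<times> Z" for w using G(3)[of w] G'(3)[of w] that by (auto simp: K_def)
    qed (fact c1)
  qed
  from this[of N] N(1) show ?thesis using that by auto
qed


section \<open>Spheres as iterated suspensions, and lifting of maps from spheres\<close>

definition sph :: "nat \<Rightarrow> (nat \<Rightarrow> real) set" where
  "sph k = {x. (\<Sum>i\<le>k. (x i)\<^sup>2) = 1 \<and> (\<forall>i>k. x i = 0)}"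

lemma nsphere_eq_sph: "nsphere k = top_of_set (sph k)"
  by (simp add: nsphere sph_def euclidean_product_topology)

text \<open>The suspension parametrization of the next sphere: \<open>fst w\<close> runs along a
  meridian from the north pole (0) to the south pole (1), and \<open>snd w\<close> selects the
  meridian. It makes inductions on the dimension possible and turns a map from a sphere into a
  homotopy.\<close>

definition meridian :: "nat \<Rightarrow> real \<times> (nat \<Rightarrow> real) \<Rightarrow> nat \<Rightarrow> real" where
  "meridian k w = (\<lambda>i. if i = Suc k then cos (pi * fst w) else sin (pi * fst w) * snd w i)"

definition north :: "nat \<Rightarrow> nat \<Rightarrow> real" where
  "north k = (\<lambda>i. if i = k then 1 else 0)"

lemma north_in_sph: "north k \<in> sph k"
  by (simp add: north_def sph_def if_distrib[of "\<lambda>x. x\<^sup>2"] cong: if_cong)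

lemma meridian_0: "meridian k (0, z) = north (Suc k)"
  by (auto simp: meridian_def north_def)

lemma continuous_on_meridian: "continuous_on A (meridian k)"
  unfolding meridian_def
proof (intro continuous_on_coordinatewise_then_product)
  fix i
  have "continuous_on A (\<lambda>w. snd w i)"
    by (rule continuous_on_product_then_coordinatewise) (intro continuous_intros)
  then show "continuous_on A (\<lambda>w. if i = Suc k then cos (pi * fst w) else sin (pi * fst w) * snd w i)"
    by (cases "i = Suc k") (auto intro!: continuous_intros)
qed

lemma meridian_in_sph:
  assumes "snd w \<in> sph k"
  shows "meridian k w \<in> sph (Suc k)"
proof -
  have "(\<Sum>i\<le>Suc k. (meridian k w i)\<^sup>2) = (sin (pi * fst w))\<^sup>2 * (\<Sum>i\<le>k. (snd w i)\<^sup>2) + (cos (pi * fst w))\<^sup>2"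
    by (simp add: meridian_def power_mult_distrib sum_distrib_left)
  then show ?thesis using assms by (auto simp: sph_def meridian_def)
qed

lemma meridian_image: "meridian k ` ({0..1} \<times> sph k) = sph (Suc k)"
proof
  show "meridian k ` ({0..1} \<times> sph k) \<subseteq> sph (Suc k)"
    using meridian_in_sph by auto
  show "sph (Suc k) \<subseteq> meridian k ` ({0..1} \<times> sph k)"
  proof
    fix x assume x: "x \<in> sph (Suc k)"
    define c where "c = x (Suc k)"
    have sum1: "(\<Sum>i\<le>k. (x i)\<^sup>2) + c\<^sup>2 = 1" using x by (simp add: sph_def c_def)
    moreover have "0 \<le> (\<Sum>i\<le>k. (x i)\<^sup>2)" by (simp add: sum_nonneg)
    ultimately have c2: "c\<^sup>2 \<le> 1" by linarith
    then have c: "-1 \<le> c" "c \<le> 1" using abs_square_le_1[of c] by auto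
    define t where "t = arccos c / pi"
    have t: "0 \<le> t" "t \<le> 1" using c arccos_lbound arccos_ubound by (auto simp: t_def divide_simps)
    have pt: "pi * t = arccos c" by (simp add: t_def)
    define r where "r = sqrt (1 - c\<^sup>2)"
    have sr: "sin (pi * t) = r" "cos (pi * t) = c" using c by (simp_all add: pt sin_arccos r_def)
    have r2: "r\<^sup>2 = (\<Sum>i\<le>k. (x i)\<^sup>2)" using sum1 c2 by (simp add: r_def)
    \<comment> \<open>At a pole all meridians meet, so any point of the smaller sphere serves;
      \<open>north k\<close> is an arbitrary choice.\<close>
    define z where "z = (if r = 0 then north k else (\<lambda>i. if i \<le> k then x i / r else 0))"
    have z: "z \<in> sph k"
    proof (cases "r = 0")
      case True
      then show ?thesis by (simp add: z_def north_in_sph)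
    next
      case False
      then have "(\<Sum>i\<le>k. (z i)\<^sup>2) = (\<Sum>i\<le>k. (x i)\<^sup>2) / r\<^sup>2" by (simp add: z_def power_divide sum_divide_distrib)
      then show ?thesis using False r2 unfolding sph_def by (cases "(\<Sum>i\<le>k. (x i)\<^sup>2) = 0") (simp_all add: z_def)
    qed
    have "x i = meridian k (t, z) i" for i
    proof -
      consider "i \<le> k" | "i = Suc k" | "i > Suc k" by linarith
      then show ?thesis
      proof cases
        case 1
        show ?thesis
        proof (cases "r = 0")
          case True
          then have "(\<Sum>i\<le>k. (x i)\<^sup>2) = 0" using r2 by simp
          then have "x i = 0" using 1 by (simp add: sum_nonneg_eq_0_iff)
          then show ?thesis using 1 True by (simp add: meridian_def sr)
        next
          case False
          then show ?thesis using 1 by (simp add: meridian_def sr z_def)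
        qed
      next
        case 2
        then show ?thesis by (simp add: meridian_def sr c_def)
      next
        case 3
        then show ?thesis using x z by (simp add: meridian_def sph_def)
      qed
    qed
    then have "x = meridian k (t, z)" by (rule ext)
    then show "x \<in> meridian k ` ({0..1} \<times> sph k)" using t z by (auto intro!: image_eqI)
  qed
qed

lemma meridian_eqD:
  assumes "meridian k (s, y) = meridian k (t, z)" "s \<in> {0..1}" "t \<in> {0..1}" "y \<in> sph k" "z \<in> sph k"
  shows "s = t \<and> (y = z \<or> t = 0 \<or> t = 1)"
proof -
  have "cos (pi * s) = cos (pi * t)" using fun_cong[OF assms(1), of "Suc k"] by (simp add: meridian_def)
  then have st: "s = t" using cos_inj_pi[of "pi * s" "pi * t"] assms(2,3) by (auto simp: mult_left_le)
  moreover have "y = z" if "t \<noteq> 0" "t \<noteq> 1"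
  proof
    fix i
    have "sin (pi * t) > 0" using that assms(3) by (intro sin_gt_zero) auto
    then show "y i = z i"
      using fun_cong[OF assms(1), of i] st assms(4,5) by (cases "i = Suc k") (auto simp: meridian_def sph_def)
  qed
  ultimately show ?thesis by blast
qed

lemma finite_sph_0: "finite (sph 0)"
proof -
  have "sph 0 \<subseteq> {north 0, \<lambda>i. - north 0 i}"
  proof
    fix x assume x: "x \<in> sph 0"
    then have "x 0 = 1 \<or> x 0 = - 1" "\<forall>i>0. x i = 0" by (auto simp: sph_def power2_eq_1_iff)
    then have "x = north 0 \<or> x = (\<lambda>i. - north 0 i)" by (auto simp: north_def fun_eq_iff)
    then show "x \<in> {north 0, \<lambda>i. - north 0 i}" by auto
  qed
  then show ?thesis by (rule finite_subset) simp
qed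

text \<open>The ambient space is an infinite product, where bounded closed sets need not be compact;
  compactness is inherited instead from the cylinder over the previous sphere.\<close>

lemma compact_sph: "compact (sph k)"
proof (induction k)
  case 0
  show ?case by (rule finite_imp_compact[OF finite_sph_0])
next
  case (Suc k)
  then have "compact ({0..1::real} \<times> sph k)" by (intro compact_Times compact_Icc)
  then show ?case using compact_continuous_image[OF continuous_on_meridian, of _ k] meridian_image by metis
qed

lemma quotient_map_meridian:
  "quotient_map (top_of_set ({0..1::real} \<times> sph k)) (top_of_set (sph (Suc k))) (meridian k)"
proof (rule continuous_imp_quotient_map)
  show "continuous_map (top_of_set ({0..1::real} \<times> sph k)) (top_of_set (sph (Suc k))) (meridian k)"
    using continuous_on_meridian meridian_in_sph by auto
  show "compact_space (top_of_set ({0..1::real} \<times> sph k))"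
    by (intro compact_space_subtopology) (simp add: compact_Times compact_sph)
  show "Hausdorff_space (top_of_set (sph (Suc k)))" by (simp add: Hausdorff_space_subtopology)
  show "meridian k ` topspace (top_of_set ({0..1::real} \<times> sph k)) = topspace (top_of_set (sph (Suc k)))"
    by (simp add: meridian_image)
qed

text \<open>Local connectedness does not pass to subspaces, but it passes to products of two spaces
  and to quotient images, hence through suspensions, starting with the discrete space
  \<open>sph 0\<close>.\<close>

lemma locally_connected_sph: "locally_connected_space (top_of_set (sph k))"
proof (induction k)
  case 0
  have "top_of_set (sph 0) = discrete_topology (sph 0)"
    using subtopology_eq_discrete_topology_finite[OF t1_space_euclidean _ finite_sph_0] by simp
  then show ?case by (simp add: locally_connected_space_discrete_topology)
next
  case (Suc k)
  have "locally_connected_space (top_of_set {0..1::real})"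
    by (rule locally_path_connected_imp_locally_connected_space) (rule locally_path_connected_real_interval)
  then have "locally_connected_space (prod_topology (top_of_set {0..1::real}) (top_of_set (sph k)))"
    using Suc by (simp only: locally_connected_space_prod_topology) simp
  then show ?case
    unfolding prod_topology_subtopology_eu by (rule locally_connected_space_quotient_map_image[OF _ quotient_map_meridian])
qed

lemma connected_sph: "connected (sph (Suc k))"
proof -
  have "connected_component (sph (Suc k)) (north (Suc k)) x" if x: "x \<in> sph (Suc k)" for x
  proof -
    obtain w where "x = meridian k w" "w \<in> {0..1} \<times> sph k"
      using x unfolding meridian_image[of k, symmetric] by (rule imageE)
    then obtain t z where tz: "x = meridian k (t, z)" "t \<in> {0..1}" "z \<in> sph k" by (cases w) simp
    have "connected (meridian k ` ({0..1} \<times> {z}))"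
      by (intro connected_continuous_image[OF continuous_on_meridian] connected_Times) auto
    moreover have "meridian k ` ({0..1} \<times> {z}) \<subseteq> sph (Suc k)" using tz meridian_in_sph by auto
    moreover have "north (Suc k) \<in> meridian k ` ({0..1} \<times> {z})" using meridian_0[of k z] by (force simp: image_iff)
    moreover have "x \<in> meridian k ` ({0..1} \<times> {z})" using tz by auto
    ultimately show ?thesis unfolding connected_component_def by blast
  qed
  then show ?thesis
    by (meson connected_component_sym connected_component_trans connected_iff_connected_component)
qed

text \<open>Composed with \<open>meridian\<close>, the map is a homotopy that starts at a constant
  and is lifted as such. The lift descends to the sphere if it is constant over each pole. At the
  north pole this holds by construction, at the south pole by connectedness of the equator; the
  latter is where \<open>k \<ge> 2\<close> enters. Continuity after descending comes from the
  quotient map.\<close>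

proposition covering_lift_sphere:
  assumes cov: "covering_map_top Y Q p" and k: "k \<ge> 2"
    and f: "continuous_map (top_of_set (sph k)) Q f" and y0: "y0 \<in> topspace Y" "p y0 = f (north k)"
  obtains g where "continuous_map (top_of_set (sph k)) Y g" "\<And>x. x \<in> sph k \<Longrightarrow> p (g x) = f x"
proof -
  obtain j where j: "k = Suc (Suc j)" using k by (metis Suc_le_D numeral_2_eq_2 Suc_le_mono)
  define m where "m = Suc j"
  have km: "k = Suc m" by (simp add: j m_def)
  have q: "quotient_map (top_of_set ({0..1} \<times> sph m)) (top_of_set (sph k)) (meridian m)"
    using quotient_map_meridian km by simp
  have H: "continuous_map (top_of_set ({0..1} \<times> sph m)) Q (f \<circ> meridian m)"
    using continuous_map_compose[OF quotient_imp_continuous_map[OF q] f] .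
  have c0: "continuous_map (top_of_set (sph m)) Y (\<lambda>_. y0)" using y0 by simp
  obtain G where G: "continuous_map (top_of_set ({0..1} \<times> sph m)) Y G"
    "\<And>z. z \<in> sph m \<Longrightarrow> G (0, z) = y0"
    "\<And>w. w \<in> {0..1} \<times> sph m \<Longrightarrow> p (G w) = (f \<circ> meridian m) w"
    by (rule covering_map_top_lift_homotopy[OF cov compact_sph H c0]) (auto simp: meridian_0 y0 km)
  have south: "meridian m (1, z) = meridian m (1, z')" for z z' by (intro ext) (simp add: meridian_def)
  \<comment> \<open>The end values all lie over the image of the south pole, so they form a lift of
    a constant map on the connected sphere \<open>sph m\<close>, where
    \<open>m \<ge> 1\<close>.\<close>
  have end_const: "G (1, z) = G (1, z')" if z: "z \<in> sph m" "z' \<in> sph m" for z z'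
  proof (rule covering_map_top_lift_unique[OF cov, where C = "top_of_set (sph m)" and a = z' and g = "\<lambda>z. G (1,z)" and h = "\<lambda>_. G (1,z')"])
    show "connected_space (top_of_set (sph m))" using connected_sph by (simp add: connected_space_subtopology m_def)
    have "continuous_map (top_of_set (sph m)) (top_of_set ({0..1::real} \<times> sph m)) (\<lambda>z. (1, z))"
      by (auto intro!: continuous_intros)
    from continuous_map_compose[OF this G(1)] show "continuous_map (top_of_set (sph m)) Y (\<lambda>z. G (1,z))" by (simp add: o_def)
    show "continuous_map (top_of_set (sph m)) Y (\<lambda>_. G (1,z'))"
      using G(1) z by (auto simp: continuous_map_def Pi_iff)
    show "p (G (1, x)) = p (G (1, z'))" if "x \<in> topspace (top_of_set (sph m))" for x
      using G(3)[of "(1,x)"] G(3)[of "(1,z')"] that z south[of x z'] by simp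
  qed (use z in auto)
  define g where "g x = G (SOME w. w \<in> {0..1} \<times> sph m \<and> meridian m w = x)" for x
  have gG: "g (meridian m w) = G w" if w: "w \<in> {0..1} \<times> sph m" for w
  proof -
    define w' where "w' = (SOME w'. w' \<in> {0..1} \<times> sph m \<and> meridian m w' = meridian m w)"
    have w': "w' \<in> {0..1} \<times> sph m \<and> meridian m w' = meridian m w"
      unfolding w'_def by (rule someI[of _ w]) (use w in auto)
    obtain s y t z where e: "w' = (s,y)" "w = (t,z)" by (cases w, cases w')
    have "s = t \<and> (y = z \<or> t = 0 \<or> t = 1)" using meridian_eqD[of m s y t z] w w' e by auto
    then have "G w' = G w" using e w w' G(2) end_const by auto
    then show ?thesis by (simp add: g_def w'_def)
  qed
  have "continuous_map (top_of_set ({0..1} \<times> sph m)) Y (g \<circ> meridian m)"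
    by (rule continuous_map_eq[OF G(1)]) (simp add: gG)
  then have "continuous_map (top_of_set (sph k)) Y g" by (rule continuous_compose_quotient_map[OF q])
  moreover have "p (g x) = f x" if x: "x \<in> sph k" for x
  proof -
    have "x \<in> meridian m ` ({0..1} \<times> sph m)" using x meridian_image[of m] km by simp
    then obtain w where "w \<in> {0..1} \<times> sph m" "x = meridian m w" by blast
    then show ?thesis using gG G(3) by simp
  qed
  ultimately show ?thesis by (rule that)
qed

text \<open>Triviality of double coverings, given as families \<open>{e, -e}\<close> of antipodal nonzero vectors.\<close>

definition sign_selection :: "'a::metric_space set \<Rightarrow> bool" where
  "sign_selection S \<longleftrightarrow> (\<forall>P :: 'a \<Rightarrow> (complex \<times> real) set.
     (\<forall>x\<in>S. \<exists>d>0. \<exists>e. continuous_on (S \<inter> ball x d) e \<and> (\<forall>y\<in>S \<inter> ball x d. P y = {e y, - e y} \<and> e y \<noteq> 0)) \<longrightarrow>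
     (\<exists>e. continuous_on S e \<and> (\<forall>x\<in>S. e x \<in> P x)))"

text \<open>The pairs \<open>(x, v)\<close> with \<open>v \<in> P x\<close> form a double covering
  of the sphere, with the graphs of \<open>e\<close> and \<open>- e\<close> as local sheets. A lift
  of the identity map is a section of it.\<close>

lemma sign_selection_sph:
  assumes k: "k \<ge> 2"
  shows "sign_selection (sph k)"
  unfolding sign_selection_def
proof (intro allI impI)
  fix P :: "(nat \<Rightarrow> real) \<Rightarrow> (complex \<times> real) set"
  assume loc: "\<forall>x\<in>sph k. \<exists>d>0. \<exists>e. continuous_on (sph k \<inter> ball x d) e \<and> (\<forall>y\<in>sph k \<inter> ball x d. P y = {e y, - e y} \<and> e y \<noteq> 0)"
  define E where "E = Sigma (sph k) P"
  have cov: "covering_map_top (top_of_set E) (top_of_set (sph k)) fst"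
    unfolding covering_map_top_def
  proof (intro conjI ballI)
    show "continuous_map (top_of_set E) (top_of_set (sph k)) fst" by (auto simp: E_def intro!: continuous_on_fst continuous_on_id)
    fix x assume "x \<in> topspace (top_of_set (sph k))"
    then have x: "x \<in> sph k" by simp
    then obtain d e where d: "d > 0" and e: "continuous_on (sph k \<inter> ball x d) e"
      and Pe: "\<And>y. y \<in> sph k \<inter> ball x d \<Longrightarrow> P y = {e y, - e y} \<and> e y \<noteq> 0" using loc by meson
    define U where "U = sph k \<inter> ball x d"
    define V where "V e' = (\<lambda>y. (y, e' y)) ` U" for e' :: "(nat \<Rightarrow> real) \<Rightarrow> complex \<times> real"
    have VV: "openin (top_of_set E) (V e') \<and> (\<exists>s. homeomorphic_maps (subtopology (top_of_set E) (V e')) (subtopology (top_of_set (sph k)) U) fst s)"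
      if e': "continuous_on U e'" "\<And>y. y \<in> U \<Longrightarrow> P y = {e' y, - e' y} \<and> e' y \<noteq> 0" for e'
    proof
      let ?E' = "E \<inter> (fst -` ball x d)"
      have "openin (top_of_set E) ?E'"
        by (rule continuous_openin_preimage_gen) (auto intro!: continuous_on_fst continuous_on_id)
      moreover have E'U: "fst w \<in> U" if "w \<in> ?E'" for w using that by (auto simp: E_def U_def)
      have ce: "continuous_on ?E' (\<lambda>w. e' (fst w))"
        by (rule continuous_on_compose2[OF e'(1)]) (use E'U in \<open>auto intro!: continuous_on_fst continuous_on_id\<close>)
      \<comment> \<open>Of the two points \<open>e'\<close> and \<open>- e'\<close> only the first
        is closer to \<open>e'\<close> than \<open>norm e'\<close>, so a strict inequality singles
        out one sheet as an open set.\<close>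
      have "openin (top_of_set ?E') (?E' \<inter> (\<lambda>w. norm (e' (fst w)) - dist (snd w) (e' (fst w))) -` {0<..})"
        by (rule continuous_openin_preimage_gen) (auto intro!: continuous_intros ce)
      ultimately have "openin (top_of_set E) (?E' \<inter> (\<lambda>w. norm (e' (fst w)) - dist (snd w) (e' (fst w))) -` {0<..})"
        by (rule openin_trans[rotated])
      moreover have "?E' \<inter> (\<lambda>w. norm (e' (fst w)) - dist (snd w) (e' (fst w))) -` {0<..} = V e'"
      proof (intro equalityI subsetI)
        fix w assume w: "w \<in> ?E' \<inter> (\<lambda>w. norm (e' (fst w)) - dist (snd w) (e' (fst w))) -` {0<..}"
        then have wU: "fst w \<in> U" using E'U by blast
        then have "snd w = e' (fst w) \<or> snd w = - e' (fst w)" using w e'(2)[OF wU] mem_Sigma_iff[of "fst w" "snd w" "sph k" P] unfolding E_def by simp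
        moreover have "snd w \<noteq> - e' (fst w)"
        proof
          assume "snd w = - e' (fst w)"
          then have "dist (snd w) (e' (fst w)) = norm (- (2 *\<^sub>R e' (fst w)))" by (simp add: dist_norm scaleR_2)
          then have "dist (snd w) (e' (fst w)) = 2 * norm (e' (fst w))" by simp
          then show False using w norm_ge_zero[of "e' (fst w)"] by auto
        qed
        ultimately have "snd w = e' (fst w)" by blast
        then have "w = (\<lambda>y. (y, e' y)) (fst w)" by (cases w) simp
        then show "w \<in> V e'" using wU unfolding V_def by (rule image_eqI)
      next
        fix w assume "w \<in> V e'"
        then obtain y where y: "y \<in> U" "w = (y, e' y)" by (auto simp: V_def)
        then show "w \<in> ?E' \<inter> (\<lambda>w. norm (e' (fst w)) - dist (snd w) (e' (fst w))) -` {0<..}"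
          using e'(2)[OF y(1)] by (auto simp: E_def U_def)
      qed
      ultimately show "openin (top_of_set E) (V e')" by simp
      have "homeomorphic_maps (top_of_set (V e')) (top_of_set U) fst (\<lambda>y. (y, e' y))"
        unfolding homeomorphic_maps_def using e'(1)
        by (auto simp: V_def intro!: continuous_on_Pair continuous_on_fst continuous_on_id)
      moreover have "V e' \<subseteq> E" using e'(2) by (auto simp: V_def E_def U_def)
      moreover have "U \<subseteq> sph k" by (auto simp: U_def)
      ultimately show "\<exists>s. homeomorphic_maps (subtopology (top_of_set E) (V e')) (subtopology (top_of_set (sph k)) U) fst s"
        by (metis inf.absorb_iff2 subtopology_subtopology)
    qed
    have "openin (top_of_set (sph k)) U" unfolding U_def by auto
    moreover have "\<Union>{V e, V (\<lambda>y. - e y)} = {y \<in> topspace (top_of_set E). fst y \<in> U}"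
      using Pe by (auto simp: V_def E_def U_def)
    moreover have "V e \<inter> V (\<lambda>y. - e y) = {}"
    proof -
      have "e y \<noteq> - e y" if "y \<in> U" for y
      proof
        assume "e y = - e y"
        then have "e y + e y = 0" by (metis add.left_inverse)
        then have "2 *\<^sub>R e y = 0" by (simp add: scaleR_2)
        then show False using Pe that by (auto simp: U_def)
      qed
      then have "- e y \<noteq> e y" if "y \<in> U" for y using that by metis
      then show ?thesis by (auto simp: V_def)
    qed
    then have "pairwise disjnt {V e, V (\<lambda>y. - e y)}" by (auto simp: pairwise_def disjnt_def)
    moreover have "\<forall>W\<in>{V e, V (\<lambda>y. - e y)}. openin (top_of_set E) W \<and> (\<exists>s. homeomorphic_maps (subtopology (top_of_set E) W) (subtopology (top_of_set (sph k)) U) fst s)"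
    proof -
      have "continuous_on U e" using e by (simp add: U_def)
      moreover have "continuous_on U (\<lambda>y. - e y)" using e by (simp add: U_def continuous_on_minus)
      moreover have "P y = {e y, - e y} \<and> e y \<noteq> 0" "P y = {- e y, - (- e y)} \<and> - e y \<noteq> 0" if "y \<in> U" for y
        using Pe that by (auto simp: U_def)
      ultimately show ?thesis using VV[of e] VV[of "\<lambda>y. - e y"] by simp
    qed
    ultimately have "evenly_covered (top_of_set E) (top_of_set (sph k)) fst U"
      unfolding evenly_covered_def by (intro conjI exI[of _ "{V e, V (\<lambda>y. - e y)}"])
    then show "\<exists>U. x \<in> U \<and> evenly_covered (top_of_set E) (top_of_set (sph k)) fst U"
      using x d by (intro exI[of _ U]) (auto simp: U_def)
  qed
  obtain v where "v \<in> P (north k)" using loc north_in_sph by (metis IntI centre_in_ball insertI1)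
  then have y0: "(north k, v) \<in> topspace (top_of_set E)" using north_in_sph by (simp add: E_def)
  obtain g where g: "continuous_map (top_of_set (sph k)) (top_of_set E) g" "\<And>x. x \<in> sph k \<Longrightarrow> fst (g x) = x"
    by (rule covering_lift_sphere[OF cov k, of "\<lambda>x. x" "(north k, v)"]) (use y0 in auto)
  show "\<exists>e. continuous_on (sph k) e \<and> (\<forall>x\<in>sph k. e x \<in> P x)"
  proof (intro exI[of _ "\<lambda>x. snd (g x)"] conjI ballI)
    show "continuous_on (sph k) (\<lambda>x. snd (g x))" using g(1) by (auto intro!: continuous_intros)
    show "snd (g x) \<in> P x" if "x \<in> sph k" for x
      using g that by (auto simp: E_def continuous_map_def Pi_iff) (metis SigmaD2 prod.collapse)
  qed
qed

section \<open>Holomorphic maps of the unit disc\<close>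

text \<open>The automorphism \<open>(z - w) / (1 - cnj w * z)\<close> of the disc; it sends
  \<open>w\<close> to 0 and its inverse is \<open>mob (- w)\<close>.\<close>

abbreviation mob :: "complex \<Rightarrow> complex \<Rightarrow> complex" where
  "mob \<equiv> Moebius_function 0"

abbreviation disc :: "complex set" where
  "disc \<equiv> ball 0 1"

lemma mob_denominator_nonzero:
  assumes "norm w < 1" "norm z < 1"
  shows "1 - cnj w * z \<noteq> 0"
proof
  assume "1 - cnj w * z = 0"
  then have "norm w * norm z = 1" by (metis complex_mod_cnj eq_iff_diff_eq_0 norm_mult norm_one)
  moreover have "norm w * norm z < 1 * 1" by (rule mult_strict_mono) (use assms in auto)
  ultimately show False by simp
qed

lemma norm_mob_less_1: "norm w < 1 \<Longrightarrow> norm z < 1 \<Longrightarrow> norm (mob w z) < 1"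
  by (rule Moebius_function_norm_lt_1)

lemma mob_image_disc: "norm w < 1 \<Longrightarrow> mob w ` disc \<subseteq> disc"
  by (rule image_subsetI) (simp add: norm_mob_less_1)

lemma mob_minus_mob: "norm w < 1 \<Longrightarrow> norm z < 1 \<Longrightarrow> mob (- w) (mob w z) = z"
  by (rule Moebius_function_compose) auto

lemma mob_mob_minus: "norm w < 1 \<Longrightarrow> norm z < 1 \<Longrightarrow> mob w (mob (- w) z) = z"
  by (rule Moebius_function_compose) auto

lemma mob_eq_0_iff: "norm w < 1 \<Longrightarrow> norm z < 1 \<Longrightarrow> mob w z = 0 \<longleftrightarrow> z = w"
  using mob_denominator_nonzero[of w z] by (simp add: Moebius_function_simple)

lemma holomorphic_mob: "norm w < 1 \<Longrightarrow> mob w holomorphic_on disc"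
  by (rule Moebius_function_holomorphic)

lemma holomorphic_mob_comp:
  assumes "f holomorphic_on S" "f ` S \<subseteq> disc" "norm w < 1"
  shows "(\<lambda>z. mob w (f z)) holomorphic_on S"
  using holomorphic_on_compose_gen[OF assms(1) holomorphic_mob[OF assms(3)]] assms(2) by (simp add: o_def image_subset_iff)

lemma continuous_on_mob_comp:
  assumes "continuous_on S f" "f ` S \<subseteq> disc" "norm w < 1"
  shows "continuous_on S (\<lambda>z. mob w (f z))"
  using continuous_on_compose2[OF holomorphic_on_imp_continuous_on[OF holomorphic_mob[OF assms(3)]] assms(1)] assms(2) by simp

lemma mob_has_field_derivative:
  assumes "norm w < 1" "norm z < 1"
  shows "(mob w has_field_derivative of_real (1 - (norm w)\<^sup>2) / (1 - cnj w * z)\<^sup>2) (at z)"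
proof -
  have nz: "1 - cnj w * z \<noteq> 0" by (rule mob_denominator_nonzero[OF assms])
  have w2: "w * cnj w = (norm w)\<^sup>2" using complex_norm_square[of w] by simp
  have "((\<lambda>z. (z - w) / (1 - cnj w * z)) has_field_derivative (1 * (1 - cnj w * z) - (z - w) * (- cnj w)) / ((1 - cnj w * z) * (1 - cnj w * z))) (at z)"
    using nz by (auto intro!: derivative_eq_intros)
  moreover have "1 * (1 - cnj w * z) - (z - w) * (- cnj w) = of_real (1 - (norm w)\<^sup>2)"
    using w2 by (simp add: algebra_simps)
  ultimately show ?thesis
    unfolding Moebius_function_simple[abs_def] power2_eq_square by (simp only:)
qed

lemma norm_mob_square:
  assumes "norm w < 1" "norm z < 1"
  shows "1 - (norm (mob w z))\<^sup>2 = (1 - (norm w)\<^sup>2) * (1 - (norm z)\<^sup>2) / (norm (1 - cnj w * z))\<^sup>2"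
proof -
  have nz: "norm (1 - cnj w * z) \<noteq> 0" using mob_denominator_nonzero[OF assms] by simp
  have "(norm (1 - cnj w * z))\<^sup>2 - (norm (z - w))\<^sup>2 = (1 - (norm w)\<^sup>2) * (1 - (norm z)\<^sup>2)"
    unfolding cmod_power2 by (simp add: power2_eq_square algebra_simps)
  then show ?thesis using nz
    by (simp add: Moebius_function_simple norm_divide power_divide divide_simps)
qed

text \<open>The denominator in \<open>norm_mob_square\<close> is at most 4. The estimate says that
  the pseudo-hyperbolic distance of two points stays away from 1 as long as both stay away from the
  unit circle.\<close>

lemma norm_mob_square_le:
  assumes "norm w < 1" "norm z < 1"
  shows "(norm (mob w z))\<^sup>2 \<le> 1 - (1 - (norm w)\<^sup>2) * (1 - (norm z)\<^sup>2) / 4"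
proof -
  have "norm (cnj w * z) \<le> 1" unfolding norm_mult using assms by (simp add: mult_le_one)
  then have "norm (1 - cnj w * z) \<le> 2" using norm_triangle_ineq4[of 1 "cnj w * z"] by simp
  then have "(norm (1 - cnj w * z))\<^sup>2 \<le> 2\<^sup>2" by (intro power_mono) auto
  moreover have "(norm (1 - cnj w * z))\<^sup>2 > 0" using mob_denominator_nonzero[OF assms] by simp
  moreover have "0 \<le> (1 - (norm w)\<^sup>2) * (1 - (norm z)\<^sup>2)"
    using assms by (intro mult_nonneg_nonneg) (auto simp: abs_square_le_1 power_le_one)
  ultimately have "(1 - (norm w)\<^sup>2) * (1 - (norm z)\<^sup>2) / 4 \<le> (1 - (norm w)\<^sup>2) * (1 - (norm z)\<^sup>2) / (norm (1 - cnj w * z))\<^sup>2"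
    by (intro divide_left_mono) auto
  then show ?thesis using norm_mob_square[OF assms] by linarith
qed

lemma Schwarz_Pick:
  assumes f: "f holomorphic_on disc" "f ` disc \<subseteq> disc" and z: "norm z < 1" "norm w < 1"
  shows "norm (mob (f w) (f z)) \<le> norm (mob w z)"
proof -
  have fn: "norm (f x) < 1" if "norm x < 1" for x using f(2) that by (auto simp: image_subset_iff)
  define g where "g = (\<lambda>x. mob (f w) (f (mob (- w) x)))"
  have im: "mob (- w) ` disc \<subseteq> disc" using mob_image_disc[of "- w"] z(2) by simp
  have "(f \<circ> mob (- w)) holomorphic_on disc"
    by (rule holomorphic_on_compose_gen[OF holomorphic_mob f(1)]) (use z im in auto)
  then have "g holomorphic_on disc" unfolding g_def
    by (intro holomorphic_mob_comp) (use im f fn z in \<open>auto simp: o_def image_subset_iff\<close>)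
  moreover have "g 0 = 0" unfolding g_def using z by (simp add: Moebius_function_of_zero Moebius_function_eq_zero)
  moreover have "norm (g x) < 1" if "norm x < 1" for x
    unfolding g_def by (intro norm_mob_less_1 fn) (use that z in auto)
  ultimately have "norm (g (mob w z)) \<le> norm (mob w z)"
    using Schwarz_Lemma(1)[of g "mob w z"] norm_mob_less_1 z by auto
  then show ?thesis using z by (simp add: g_def mob_minus_mob)
qed

text \<open>By Schwarz-Pick the values of \<open>f\<close> at two points of the half disc have
  bounded pseudo-hyperbolic distance, so if one of them is away from the circle, so is the other.
  What matters is that \<sigma>' depends on \<sigma> alone and not on \<open>f\<close>.\<close>

lemma holomorphic_disc_bound:
  assumes "\<sigma> < 1"
  obtains \<sigma>' where "\<sigma>' < 1" "\<And>f z w. \<lbrakk>f holomorphic_on disc; f ` disc \<subseteq> disc; norm z \<le> 1/2; norm w \<le> 1/2; norm (f w) \<le> \<sigma>\<rbrakk>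
      \<Longrightarrow> norm (f z) \<le> \<sigma>'"
proof -
  define s where "s = max 0 \<sigma>"
  have s: "0 \<le> s" "s < 1" "\<sigma> \<le> s" using assms by (auto simp: s_def)
  \<comment> \<open>On the half disc \<open>1 - norm^2\<close> is at least 3/4, so
    \<open>norm_mob_square_le\<close> gives (9/16)/4 = 9/64 for \<open>u = mob (f w) (f z)\<close>.
    A second application, to \<open>f z = mob (- f w) u\<close>, contributes the other factor and
    the final division by 4.\<close>
  define d where "d = (1 - s\<^sup>2) * (9/64) / 4"
  have "s\<^sup>2 < 1" using s by (simp add: power_less_one_iff)
  then have d: "0 < d" by (simp add: d_def)
  have "norm (f z) \<le> sqrt (1 - d)" if f: "f holomorphic_on disc" "f ` disc \<subseteq> disc" and zw: "norm z \<le> 1/2" "norm w \<le> 1/2" "norm (f w) \<le> \<sigma>" for f z w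
  proof -
    have fn: "norm (f x) < 1" if "norm x < 1" for x using f(2) that by (auto simp: image_subset_iff)
    have n1: "norm z < 1" "norm w < 1" using zw by auto
    have q: "(norm x)\<^sup>2 \<le> 1/4" if "norm x \<le> 1/2" for x :: complex using power_mono[OF that, of 2] by (simp add: power_divide)
    define u where "u = mob (f w) (f z)"
    have u1: "norm u < 1" unfolding u_def using fn n1 by (intro norm_mob_less_1) auto
    have "norm u \<le> norm (mob w z)" unfolding u_def by (rule Schwarz_Pick[OF f n1])
    then have "(norm u)\<^sup>2 \<le> (norm (mob w z))\<^sup>2" by (intro power_mono) auto
    also have "\<dots> \<le> 1 - (1 - (norm w)\<^sup>2) * (1 - (norm z)\<^sup>2) / 4" by (rule norm_mob_square_le) (use n1 in auto)
    also have "\<dots> \<le> 1 - (3/4) * (3/4) / 4"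
    proof -
      have "(3/4) * (3/4) \<le> (1 - (norm w)\<^sup>2) * (1 - (norm z)\<^sup>2)" using q[OF zw(1)] q[OF zw(2)] by (intro mult_mono) linarith+
      then show ?thesis by simp
    qed
    finally have u2: "9/64 \<le> 1 - (norm u)\<^sup>2" by simp
    have "(norm (f w))\<^sup>2 \<le> s\<^sup>2" using zw(3) s by (intro power_mono) auto
    then have "(1 - s\<^sup>2) * (9/64) \<le> (1 - (norm (f w))\<^sup>2) * (1 - (norm u)\<^sup>2)"
      using u2 \<open>s\<^sup>2 < 1\<close> by (intro mult_mono) auto
    moreover have "f z = mob (- f w) u" unfolding u_def using fn n1 by (simp add: mob_minus_mob)
    then have "(norm (f z))\<^sup>2 \<le> 1 - (1 - (norm (- f w))\<^sup>2) * (1 - (norm u)\<^sup>2) / 4"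
      using norm_mob_square_le[of "- f w" u] fn n1 u1 by simp
    ultimately have "(norm (f z))\<^sup>2 \<le> 1 - d" unfolding d_def by (simp add: field_simps)
    then show ?thesis by (rule real_le_rsqrt)
  qed
  moreover have "sqrt (1 - d) < 1" using d by simp
  ultimately show ?thesis using that by blast
qed

section \<open>Square roots of holomorphic and continuous functions, and the Koebe map\<close>

lemma holomorphic_factor_linear:
  assumes "f holomorphic_on U" "open U" "a \<in> U" "f a = 0"
  obtains m where "m holomorphic_on U" "\<And>w. w \<in> U \<Longrightarrow> f w = (w - a) * m w" "m a = deriv f a"
proof (rule that)
  show "(\<lambda>z. if z = a then deriv f a else (f z - f a) / (z - a)) holomorphic_on U"
    by (rule pole_lemma_open[OF assms(1,2)])
  show "f w = (w - a) * (if w = a then deriv f a else (f w - f a) / (w - a))" if "w \<in> U" for w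
    using assms(4) by simp
qed simp

lemma holomorphic_sqrt_ball:
  assumes "f holomorphic_on ball c r" "\<And>z. z \<in> ball c r \<Longrightarrow> f z \<noteq> (0::complex)"
  obtains g where "g holomorphic_on ball c r" "\<And>z. z \<in> ball c r \<Longrightarrow> (g z)\<^sup>2 = f z"
proof -
  have "simply_connected (ball c r)" by (simp add: convex_imp_simply_connected)
  then show ?thesis
    using simply_connected_eq_holomorphic_sqrt[of "ball c r"] assms that by (metis open_ball)
qed

text \<open>Double zeros are divided out one at a time until a zero-free function remains, which has
  a root on a ball. The hypothesis is a factorization on the whole ball and not a statement about
  orders of zeros, so the work lies in showing that it survives the division by
  \<open>(w - a)\<^sup>2\<close>.\<close>

lemma holomorphic_sqrt_double_zeros:
  assumes "finite Z" "f holomorphic_on ball c r" "{z \<in> ball c r. f z = 0} = Z"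
    "\<forall>z\<in>Z. \<exists>m. m holomorphic_on ball c r \<and> m z \<noteq> 0 \<and> (\<forall>w\<in>ball c r. f w = (w - z)\<^sup>2 * m w)"
  shows "\<exists>g. g holomorphic_on ball c r \<and> (\<forall>z\<in>ball c r. (g z)\<^sup>2 = (f z :: complex))"
  using assms
proof (induction Z arbitrary: f rule: finite_induct)
  case empty
  then show ?case using holomorphic_sqrt_ball[of f c r] by (metis (mono_tags, lifting) empty_Collect_eq)
next
  case (insert a Z)
  let ?B = "ball c r"
  have a: "a \<in> ?B" "f a = 0" using insert.prems(2) by auto
  obtain m where m: "m holomorphic_on ?B" "m a \<noteq> 0" "\<And>w. w \<in> ?B \<Longrightarrow> f w = (w - a)\<^sup>2 * m w"
    using insert.prems(3) by blast
  have Z: "{z \<in> ?B. m z = 0} = Z"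
  proof
    show "{z \<in> ?B. m z = 0} \<subseteq> Z"
    proof
      fix z assume z: "z \<in> {z \<in> ?B. m z = 0}"
      then have "f z = 0" using m(3) by simp
      then have "z \<in> insert a Z" using insert.prems(2) z by blast
      then show "z \<in> Z" using z m(2) by auto
    qed
    show "Z \<subseteq> {z \<in> ?B. m z = 0}"
    proof
      fix z assume z: "z \<in> Z"
      then have "z \<in> ?B" "f z = 0" "z \<noteq> a" using insert.prems(2) insert.hyps(2) by auto
      then show "z \<in> {z \<in> ?B. m z = 0}" using m(3)[of z] by simp
    qed
  qed
  have "\<exists>n. n holomorphic_on ?B \<and> n z \<noteq> 0 \<and> (\<forall>w\<in>?B. m w = (w - z)\<^sup>2 * n w)" if z: "z \<in> Z" for z
  proof -
    obtain n where n: "n holomorphic_on ?B" "n z \<noteq> 0" "\<And>w. w \<in> ?B \<Longrightarrow> f w = (w - z)\<^sup>2 * n w"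
      using insert.prems(3) z by blast
    define d where "d = z - a"
    have d: "d \<noteq> 0" using z insert.hyps(2) by (auto simp: d_def)
    \<comment> \<open>a Bezout relation between the coprime polynomials \<open>(w - a)\<^sup>2\<close> and \<open>(w - z)\<^sup>2\<close>\<close>
    define A where "A w = (3 * d - 2 * (w - a)) / d ^ 3" for w
    define B where "B w = (d + 2 * (w - a)) / d ^ 3" for w
    have AB: "A w * (w - a)\<^sup>2 + B w * (w - z)\<^sup>2 = 1" for w
    proof -
      define x where "x = w - a"
      have wz: "w - z = x - d" by (simp add: x_def d_def)
      have "(3 * d - 2 * x) * x\<^sup>2 + (d + 2 * x) * (x - d)\<^sup>2 = d ^ 3" by algebra
      then have "((3 * d - 2 * x) * x\<^sup>2 + (d + 2 * x) * (x - d)\<^sup>2) / d ^ 3 = 1" using d by simp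
      then show ?thesis unfolding A_def B_def wz x_def[symmetric]
        by (simp only: times_divide_eq_left add_divide_distrib[symmetric])
    qed
    define n' where "n' w = A w * n w + B w * m w" for w
    have "n' holomorphic_on ?B"
      unfolding n'_def A_def B_def by (intro holomorphic_intros n(1) m(1)) (use d in auto)
    moreover have "m w = (w - z)\<^sup>2 * n' w" if w: "w \<in> ?B" for w
    proof -
      have e: "(w - a)\<^sup>2 * m w = (w - z)\<^sup>2 * n w" using m(3)[OF w] n(3)[OF w] by simp
      have "m w = (A w * (w - a)\<^sup>2 + B w * (w - z)\<^sup>2) * m w" by (simp add: AB)
      also have "\<dots> = A w * ((w - a)\<^sup>2 * m w) + B w * (w - z)\<^sup>2 * m w" by (simp add: algebra_simps)
      also have "\<dots> = (w - z)\<^sup>2 * n' w" unfolding e n'_def by (simp add: algebra_simps)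
      finally show ?thesis .
    qed
    moreover have "n' z \<noteq> 0"
    proof -
      have "m z = 0" using z Z by blast
      moreover have "A z \<noteq> 0" using AB[of z] by auto
      ultimately show ?thesis using n(2) by (simp add: n'_def)
    qed
    ultimately show ?thesis by blast
  qed
  then obtain g where g: "g holomorphic_on ?B" "\<forall>z\<in>?B. (g z)\<^sup>2 = m z"
    using insert.IH[OF m(1) Z] by blast
  have "(\<lambda>z. (z - a) * g z) holomorphic_on ?B" by (intro holomorphic_intros g(1))
  moreover have "\<forall>z\<in>?B. ((z - a) * g z)\<^sup>2 = f z" using g(2) m(3) by (simp add: power_mult_distrib)
  ultimately show ?case by blast
qed

text \<open>Near \<open>x\<close> the quotient \<open>g y / g x\<close> lies in the right
  half-plane, where the principal root is continuous.\<close>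

lemma continuous_local_sqrt:
  fixes g :: "'a::metric_space \<Rightarrow> complex"
  assumes g: "continuous_on S g" and x: "x \<in> S" "g x \<noteq> 0"
  obtains d s where "d > 0" "continuous_on (S \<inter> ball x d) s" "\<And>y. y \<in> S \<inter> ball x d \<Longrightarrow> (s y)\<^sup>2 = g y \<and> g y \<noteq> 0"
proof -
  obtain d where d: "d > 0" "\<And>y. y \<in> S \<Longrightarrow> dist y x < d \<Longrightarrow> dist (g y) (g x) < norm (g x)"
    using g x unfolding continuous_on_iff by (metis zero_less_norm_iff)
  define s where "s y = csqrt (g y / g x) * csqrt (g x)" for y
  have re: "Re (g y / g x) > 0" if "y \<in> S \<inter> ball x d" for y
  proof -
    have "norm (g y - g x) < norm (g x)" using d(2)[of y] that by (simp add: dist_norm dist_commute)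
    then have "norm ((g y - g x) / g x) < 1" using x(2) by (simp add: norm_divide)
    then have "norm (g y / g x - 1) < 1" using x(2) by (simp add: diff_divide_distrib)
    then have "\<bar>Re (g y / g x - 1)\<bar> < 1" using abs_Re_le_cmod order_le_less_trans by blast
    then show ?thesis by simp
  qed
  have "continuous_on (S \<inter> ball x d) (\<lambda>y. g y / g x)"
    using g x(2) by (intro continuous_intros) (auto intro: continuous_on_subset)
  moreover have "(\<lambda>y. g y / g x) ` (S \<inter> ball x d) \<subseteq> - \<real>\<^sub>\<le>\<^sub>0"
    using re by (auto simp: complex_nonpos_Reals_iff less_le_not_le)
  ultimately have "continuous_on (S \<inter> ball x d) (\<lambda>y. csqrt (g y / g x))"
    by (rule continuous_on_compose2[OF continuous_on_csqrt])
  then have "continuous_on (S \<inter> ball x d) s" unfolding s_def by (intro continuous_intros)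
  moreover have "(s y)\<^sup>2 = g y \<and> g y \<noteq> 0" if "y \<in> S \<inter> ball x d" for y
    using re[OF that] x(2) by (auto simp: s_def power_mult_distrib)
  ultimately show ?thesis using that d(1) by blast
qed

text \<open>The double covering of the disc by the disc that is branched exactly over
  \<open>a\<close> and fixes 0: the squaring map between two automorphisms. The inner one moves 0 to
  a root of \<open>- a\<close>, the outer one moves \<open>- a\<close> back to 0 and the branch
  value 0 to \<open>a\<close>.\<close>

definition koebe_map :: "complex \<Rightarrow> complex \<Rightarrow> complex" where
  "koebe_map a z = mob (- a) ((mob (- csqrt (- a)) z)\<^sup>2)"

lemma norm_csqrt_less_1:
  assumes "norm a < 1" shows "norm (csqrt a) < 1"
proof -
  have "(norm (csqrt a))\<^sup>2 = norm a" by (metis norm_power power2_csqrt)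
  then show ?thesis using assms power_less_one_iff by (metis norm_ge_zero power2_less_imp_less one_power2 zero_le_one)
qed

lemma koebe_map:
  assumes a: "norm a < 1"
  shows "koebe_map a holomorphic_on disc" "koebe_map a ` disc \<subseteq> disc" "koebe_map a 0 = 0"
    "norm (deriv (koebe_map a) 0) = 2 * sqrt (norm a) / (1 + norm a)"
proof -
  define c where "c = csqrt (- a)"
  have c: "norm c < 1" "c\<^sup>2 = - a" using norm_csqrt_less_1[of "- a"] a by (auto simp: c_def)
  have cn: "(norm c)\<^sup>2 = norm a" by (metis c(2) norm_minus_cancel norm_power)
  have m1: "norm (mob (- c) z) < 1" if "norm z < 1" for z using that c by (intro norm_mob_less_1) auto
  then have m2: "norm ((mob (- c) z)\<^sup>2) < 1" if "norm z < 1" for z using that by (simp add: norm_power power_less_one_iff)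
  have kd: "koebe_map a = (\<lambda>z. mob (- a) ((mob (- c) z)\<^sup>2))" by (simp add: koebe_map_def[abs_def] c_def)
  show "koebe_map a holomorphic_on disc"
    unfolding kd
  proof (rule holomorphic_mob_comp)
    show "(\<lambda>z. (mob (- c) z)\<^sup>2) holomorphic_on disc"
      by (rule holomorphic_on_power, rule holomorphic_mob) (use c in simp)
    show "(\<lambda>z. (mob (- c) z)\<^sup>2) ` disc \<subseteq> disc" by (rule image_subsetI) (simp add: m2)
    show "norm (- a) < 1" using a by simp
  qed
  show "koebe_map a ` disc \<subseteq> disc"
    unfolding kd by (rule image_subsetI) (simp add: m2 a norm_mob_less_1)
  have mc0: "mob (- c) 0 = c" by (simp add: Moebius_function_of_zero)
  show "koebe_map a 0 = 0" unfolding kd mc0 c(2) by (simp add: Moebius_function_eq_zero)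
  have d1: "(mob (- c) has_field_derivative (1 - (norm c)\<^sup>2)) (at 0)"
    using mob_has_field_derivative[of "- c" 0] c by simp
  have an: "1 - (norm a)\<^sup>2 > 0" using a by (simp add: power_less_one_iff)
  have caa: "cnj a * a = (norm a)\<^sup>2" using complex_norm_square[of a] by (simp add: mult.commute)
  have d2: "(mob (- a) has_field_derivative (1 / (1 - (norm a)\<^sup>2))) (at (- a))"
  proof -
    have "complex_of_real (1 - (norm a)\<^sup>2) / (complex_of_real (1 - (norm a)\<^sup>2))\<^sup>2 = complex_of_real (1 / (1 - (norm a)\<^sup>2))"
      using an by (simp only: power2_eq_square of_real_divide[symmetric] of_real_mult[symmetric]) simp
    then show ?thesis using mob_has_field_derivative[of "- a" "- a"] a caa by simp
  qed
  have "((\<lambda>z. (mob (- c) z)\<^sup>2) has_field_derivative (2 * c * (1 - (norm c)\<^sup>2))) (at 0)"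
    using d1 mc0 by (auto intro!: derivative_eq_intros)
  moreover have "(mob (- a) has_field_derivative (1 / (1 - (norm a)\<^sup>2))) (at ((mob (- c) 0)\<^sup>2))"
    using d2 by (simp add: mc0 c)
  ultimately have "(koebe_map a has_field_derivative (1 / (1 - (norm a)\<^sup>2) * (2 * c * (1 - (norm c)\<^sup>2)))) (at 0)"
    unfolding kd by (rule DERIV_chain2[rotated])
  then have "deriv (koebe_map a) 0 = complex_of_real (1 / (1 - (norm a)\<^sup>2)) * (2 * c * complex_of_real (1 - (norm c)\<^sup>2))"
    by (simp add: DERIV_imp_deriv)
  then have "norm (deriv (koebe_map a) 0) = \<bar>1 / (1 - (norm a)\<^sup>2)\<bar> * (2 * norm c * \<bar>1 - (norm c)\<^sup>2\<bar>)"
    by (simp only: norm_mult norm_of_real norm_numeral)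
  also have "\<dots> = 2 * norm c * ((1 - norm a) / (1 - (norm a)\<^sup>2))"
    using an a by (simp add: cn)
  also have "(1 - norm a) / (1 - (norm a)\<^sup>2) = 1 / (1 + norm a)"
  proof -
    have "1 - (norm a)\<^sup>2 = (1 - norm a) * (1 + norm a)" by (simp add: power2_eq_square algebra_simps)
    moreover have "1 - norm a \<noteq> 0" "1 + norm a \<noteq> 0" using a norm_ge_zero[of a] by linarith+
    ultimately show ?thesis by simp
  qed
  also have "norm c = sqrt (norm a)" using cn by (metis norm_ge_zero real_sqrt_unique)
  finally show "norm (deriv (koebe_map a) 0) = 2 * sqrt (norm a) / (1 + norm a)" by simp
qed

text \<open>With \<open>s = norm a\<close> the loss is
  \<open>1 - 2 * sqrt s / (1 + s) = (1 - sqrt s)\<^sup>2 / (1 + s)\<close>. It is bounded from below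
  as long as \<open>a\<close> stays in a compact part of the disc, which makes a step at such a
  point a definite gain.\<close>

lemma koebe_map_deriv_bound:
  assumes "norm a \<le> \<rho>" "\<rho> < 1"
  shows "norm (deriv (koebe_map a) 0) \<le> 1 - (1 - sqrt \<rho>)\<^sup>2 / 2"
proof -
  let ?s = "norm a"
  have s: "0 \<le> ?s" "?s < 1" using assms by auto
  have "1 - 2 * sqrt ?s / (1 + ?s) = (1 - sqrt ?s)\<^sup>2 / (1 + ?s)"
  proof -
    have "1 + ?s \<noteq> 0" using s by linarith
    then have "(1 + ?s) / (1 + ?s) = 1" by (rule divide_self)
    moreover have "(1 + ?s - 2 * sqrt ?s) / (1 + ?s) = (1 + ?s) / (1 + ?s) - 2 * sqrt ?s / (1 + ?s)"
      by (rule diff_divide_distrib)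
    moreover have "1 + ?s - 2 * sqrt ?s = (1 - sqrt ?s)\<^sup>2" by (simp add: power2_diff)
    ultimately show ?thesis by simp
  qed
  moreover have "(1 - sqrt \<rho>)\<^sup>2 \<le> (1 - sqrt ?s)\<^sup>2"
    using assms s by (intro power_mono) auto
  then have "(1 - sqrt \<rho>)\<^sup>2 / 2 \<le> (1 - sqrt ?s)\<^sup>2 / (1 + ?s)"
    using frac_le[of "(1 - sqrt ?s)\<^sup>2" "(1 - sqrt \<rho>)\<^sup>2" "1 + ?s" 2] s by (simp add: add_pos_nonneg)
  moreover have "norm (deriv (koebe_map a) 0) = 2 * sqrt ?s / (1 + ?s)"
    by (rule koebe_map(4)) (use s in auto)
  ultimately show ?thesis by linarith
qed

section \<open>Koebe's construction over branched curves\<close>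

lemma holomorphic_puncture_eq:
  fixes f g :: "complex \<Rightarrow> complex"
  assumes "continuous_on (ball a r) f" "continuous_on (ball a r) g" "r > 0"
    and eq: "\<And>z. z \<in> ball a r \<Longrightarrow> z \<noteq> a \<Longrightarrow> f z = g z"
  shows "f a = g a"
proof -
  have a: "a \<in> ball a r" using assms by simp
  have f: "(f \<longlongrightarrow> f a) (at a)" and g: "(g \<longlongrightarrow> g a) (at a)"
    using assms(1,2) a continuous_on_eq_continuous_at[OF open_ball] by (metis isCont_def)+
  have "eventually (\<lambda>z. z \<in> ball a r \<and> z \<noteq> a) (at a)"
    using eventually_at_in_open[of "ball a r" a] a by (auto elim: eventually_mono)
  then have "eventually (\<lambda>z. f z = g z) (at a)" by (rule eventually_mono) (use eq in auto)
  then have "(g \<longlongrightarrow> f a) (at a)" using f by (rule Lim_transform_eventually[rotated])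
  then show ?thesis using g tendsto_unique[OF at_neq_bot] by blast
qed

text \<open>The quotient \<open>f z / (c * z)\<close> takes only the values 1 and -1 on the
  punctured ball, which is connected.\<close>

lemma holomorphic_square_monomial:
  assumes f: "f holomorphic_on ball 0 r" and r: "r > 0" and c: "c \<noteq> (0::complex)"
    and eq: "\<And>z. z \<in> ball 0 r \<Longrightarrow> (f z)\<^sup>2 = c\<^sup>2 * z\<^sup>2"
  obtains s :: real where "s = 1 \<or> s = -1" "\<And>z. z \<in> ball 0 r \<Longrightarrow> f z = of_real s * c * z"
proof -
  have f0: "f 0 = 0" using eq[of 0] r by simp
  let ?g = "\<lambda>z. f z / (c * z)"
  have two: "?g z = 1 \<or> ?g z = - 1" if "z \<in> ball 0 r - {0}" for z
  proof -
    have "(f z)\<^sup>2 = (c * z)\<^sup>2" using eq that by (simp add: power_mult_distrib)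
    then have "f z = c * z \<or> f z = - (c * z)" by (simp add: power2_eq_iff)
    then show ?thesis using that c by auto
  qed
  have "?g constant_on (ball 0 r - {0})"
  proof (rule continuous_finite_range_constant)
    show "connected (ball (0::complex) r - {0})" by (rule connected_punctured_ball) simp
    show "continuous_on (ball 0 r - {0}) ?g"
      using holomorphic_on_imp_continuous_on[OF f] c by (intro continuous_intros) (auto intro: continuous_on_subset)
    have "?g ` (ball 0 r - {0}) \<subseteq> {1, -1}" using two by blast
    then show "finite (?g ` (ball 0 r - {0}))" by (rule finite_subset) simp
  qed
  then obtain d where d: "\<And>z. z \<in> ball 0 r - {0} \<Longrightarrow> ?g z = d" unfolding constant_on_def by blast
  have "of_real (r/2) \<in> ball 0 r - {0::complex}" using r by simp
  then have "d = 1 \<or> d = -1" using two d by metis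
  then obtain s :: real where s: "s = 1 \<or> s = -1" "d = of_real s"
    by (metis of_real_1 of_real_minus)
  have "f z = of_real s * c * z" if "z \<in> ball 0 r" for z
  proof (cases "z = 0")
    case False
    then show ?thesis using d[of z] that c s(2) by (simp add: divide_simps mult.assoc)
  qed (simp add: f0)
  with s show ?thesis using that by blast
qed

text \<open>A map from \<open>S\<close> to the curve is given by its projection \<tau> and the roots
  \<open>u b\<close>. The points of \<open>P\<close> are removed, so their roots never vanish. Discs
  of radius \<eta>^2 about the points of \<open>A\<close> are disjoint and lie in the ball of radius
  \<open>R\<close>, in which everything takes place. The base point \<open>x0\<close> lies over no
  point of \<open>A\<close>, and the disc of radius \<open>r0\<close> about its image serves for a
  lower bound on derivatives.\<close>

locale koebe =
  fixes S :: "'a::metric_space set" and A P :: "complex set" and \<tau> :: "'a \<Rightarrow> complex"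
    and u :: "complex \<Rightarrow> 'a \<Rightarrow> complex" and x0 :: 'a and \<eta> R r0 :: real
  assumes compact_S: "compact S" and connected_S: "connected S"
    and lc_S: "locally_connected_space (top_of_set S)" and sgn_S: "sign_selection S"
    and finA: "finite A" and PA: "P \<subseteq> A"
    and cont_\<tau>: "continuous_on S \<tau>" and cont_u: "\<And>b. b \<in> A \<Longrightarrow> continuous_on S (u b)"
    and usq: "\<And>b x. b \<in> A \<Longrightarrow> x \<in> S \<Longrightarrow> (u b x)\<^sup>2 = \<tau> x - b"
    and unz: "\<And>b x. b \<in> P \<Longrightarrow> x \<in> S \<Longrightarrow> u b x \<noteq> 0"
    and x0: "x0 \<in> S" "\<tau> x0 \<notin> A"
    and eta: "\<eta> > 0" and sep: "\<And>b b'. b \<in> A \<Longrightarrow> b' \<in> A \<Longrightarrow> b \<noteq> b' \<Longrightarrow> 2 * \<eta>\<^sup>2 \<le> dist b b'"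
    and R: "R > 0" and im\<tau>: "\<And>x. x \<in> S \<Longrightarrow> dist (\<tau> x0) (\<tau> x) < R"
    and imb: "\<And>b. b \<in> A \<Longrightarrow> dist (\<tau> x0) b + \<eta>\<^sup>2 < R"
    and r0: "r0 > 0" "ball (\<tau> x0) r0 \<inter> A = {}" "r0 \<le> R"
begin

definition B where "B = A - P"

text \<open>In terms of \<tau>: its value is closer than \<eta>^2/4 to a branch point. The factor
  1/2 leaves room, so that such points correspond to the inner half of the uniformizing
  disc.\<close>

definition N where "N = {x \<in> S. \<exists>b\<in>B. norm (u b x) < \<eta> / 2}"

definition \<beta> where "\<beta> x = (SOME b. b \<in> B \<and> norm (u b x) < \<eta> / 2)"

text \<open>The coordinate of \<open>x\<close> in the uniformizing disc at the branch point
  \<open>\<beta> x\<close>, so that \<open>sq (\<beta> x) (lam x) = \<tau> x\<close>. Unlike \<tau>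
  it remembers the sign of the root.\<close>

definition lam where "lam x = u (\<beta> x) x / of_real \<eta>"

definition sq :: "complex \<Rightarrow> complex \<Rightarrow> complex" where "sq b z = b + of_real (\<eta>\<^sup>2) * z\<^sup>2"

text \<open>
  The points of \<open>B\<close> are orbifold points of order 2 of the plane, those of \<open>P\<close> are punctures; the test maps are
  uniformizing discs, and \<open>legit h\<close> says that \<open>h\<close> is an orbifold covering as far as they can tell. In a state, \<open>t\<close>
  lifts \<open>\<tau>\<close> through \<open>h\<close>. Near a branch point this does not determine a lift of \<open>(\<tau>, u)\<close> (the sign is lost
  where \<open>\<tau>\<close> is locally constant), so \<open>k x\<close> records the lift of the uniformizing disc that is used at \<open>x\<close>.
\<close>

definition test :: "(complex \<Rightarrow> complex) \<Rightarrow> bool" where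
  "test g \<longleftrightarrow> (\<exists>c r. r > 0 \<and> ball c r \<subseteq> ball (\<tau> x0) R \<and> ball c r \<inter> A = {} \<and> g = (\<lambda>z. c + of_real r * z))
     \<or> (\<exists>b\<in>B. g = sq b)"

definition lifts :: "(complex \<Rightarrow> complex) \<Rightarrow> (complex \<Rightarrow> complex) \<Rightarrow> (complex \<Rightarrow> complex) \<Rightarrow> bool" where
  "lifts h g k \<longleftrightarrow> k holomorphic_on disc \<and> k ` disc \<subseteq> disc \<and> (\<forall>z\<in>disc. h (k z) = g z)"

definition legit :: "(complex \<Rightarrow> complex) \<Rightarrow> bool" where
  "legit h \<longleftrightarrow> h holomorphic_on disc \<and> h ` disc \<subseteq> ball (\<tau> x0) R \<and> h 0 = \<tau> x0 \<and>
     (\<forall>g w z. test g \<longrightarrow> w \<in> disc \<longrightarrow> z \<in> disc \<longrightarrow> h z = g w \<longrightarrow> (\<exists>k. lifts h g k \<and> k w = z))"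

definition state where
  "state h t k \<longleftrightarrow> legit h \<and> continuous_on S t \<and> t ` S \<subseteq> disc \<and> t x0 = 0 \<and> (\<forall>x\<in>S. h (t x) = \<tau> x) \<and>
     (\<forall>x\<in>N. lifts h (sq (\<beta> x)) (k x) \<and> t x = k x (lam x)) \<and>
     (\<forall>x\<in>N. \<exists>d>0. \<forall>y\<in>N. dist x y < d \<longrightarrow> k y = k x)"

text \<open>The places where \<open>h\<close> is not yet as wanted on the curve: over a removed
  point there should be no preimage at all, and over a branch point \<open>h\<close> should be
  branched itself. A preimage of a branch point with \<open>deriv h a = 0\<close> needs no further
  root.\<close>

definition marked :: "(complex \<Rightarrow> complex) \<Rightarrow> complex \<Rightarrow> bool" where
  "marked h a \<longleftrightarrow> h a \<in> P \<or> h a \<in> B \<and> deriv h a \<noteq> 0"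

section \<open>Test discs and elementary properties of legitimate maps\<close>

lemma BA: "B \<subseteq> A" and finB: "finite B"
  using finA by (auto simp: B_def)

lemma beta_eq:
  assumes "x \<in> S" "b \<in> B" "norm (u b x) < \<eta> / 2"
  shows "\<beta> x = b"
proof (rule ccontr)
  assume ne: "\<beta> x \<noteq> b"
  have b': "\<beta> x \<in> B" "norm (u (\<beta> x) x) < \<eta> / 2"
    using someI[of "\<lambda>b. b \<in> B \<and> norm (u b x) < \<eta> / 2" b] assms(2,3) unfolding \<beta>_def by auto
  have q: "norm (\<tau> x - c) < \<eta>\<^sup>2 / 4" if "c \<in> B" "norm (u c x) < \<eta> / 2" for c
  proof -
    have "norm (\<tau> x - c) = (norm (u c x))\<^sup>2" using usq[of c x] that assms BA by (metis norm_power subsetD)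
    also have "\<dots> < (\<eta> / 2)\<^sup>2" using that(2) by (intro power_strict_mono) auto
    finally show ?thesis by (simp add: power_divide)
  qed
  have "dist (\<beta> x) b \<le> norm (\<tau> x - \<beta> x) + norm (\<tau> x - b)"
    using dist_triangle3[of "\<beta> x" b "\<tau> x"] by (simp add: dist_norm)
  also have "\<dots> < 2 * \<eta>\<^sup>2" using q[OF b'] q[OF assms(2,3)] zero_le_power2[of \<eta>] by linarith
  finally show False using sep[of "\<beta> x" b] ne b' assms BA by auto
qed

lemma N_beta:
  assumes "x \<in> N"
  shows "x \<in> S" "\<beta> x \<in> B" "norm (u (\<beta> x) x) < \<eta> / 2" "norm (lam x) < 1/2" "sq (\<beta> x) (lam x) = \<tau> x"
proof -
  obtain b where b: "x \<in> S" "b \<in> B" "norm (u b x) < \<eta> / 2" using assms by (auto simp: N_def)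
  then have "\<beta> x = b" by (rule beta_eq)
  with b show 1: "x \<in> S" "\<beta> x \<in> B" "norm (u (\<beta> x) x) < \<eta> / 2" by auto
  then show "norm (lam x) < 1/2" using eta by (simp add: lam_def norm_divide divide_simps)
  show "sq (\<beta> x) (lam x) = \<tau> x"
    using usq[of "\<beta> x" x] 1 BA eta by (auto simp: sq_def lam_def power_divide)
qed

lemma NI: "x \<in> S \<Longrightarrow> b \<in> B \<Longrightarrow> norm (u b x) < \<eta> / 2 \<Longrightarrow> x \<in> N"
  by (auto simp: N_def)

lemma N_nbhd:
  assumes "x \<in> N"
  obtains d where "d > 0" "\<And>y. y \<in> S \<Longrightarrow> dist x y < d \<Longrightarrow> y \<in> N \<and> \<beta> y = \<beta> x"
proof -
  let ?b = "\<beta> x"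
  note x = N_beta[OF assms]
  have "continuous_on S (\<lambda>y. norm (u ?b y))" using cont_u[of ?b] x BA by (intro continuous_intros) auto
  then obtain d where d: "d > 0" "\<And>y. y \<in> S \<Longrightarrow> dist y x < d \<Longrightarrow> dist (norm (u ?b y)) (norm (u ?b x)) < \<eta> / 2 - norm (u ?b x)"
    using x(1,3) unfolding continuous_on_iff by (metis diff_gt_0_iff_gt)
  have "y \<in> N \<and> \<beta> y = \<beta> x" if "y \<in> S" "dist x y < d" for y
  proof -
    have "norm (u ?b y) < \<eta> / 2" using d(2)[of y] that by (simp add: dist_commute dist_real_def)
    then show ?thesis using beta_eq NI that x by blast
  qed
  with d(1) show ?thesis using that by blast
qed

lemma sq_in_ball:
  assumes "b \<in> B" "z \<in> disc" shows "sq b z \<in> ball (\<tau> x0) R"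
proof -
  have "norm (of_real (\<eta>\<^sup>2) * z\<^sup>2) \<le> \<eta>\<^sup>2"
    using assms(2) by (simp add: norm_mult norm_power mult_left_le power_le_one)
  moreover have "dist (\<tau> x0) (sq b z) \<le> dist (\<tau> x0) b + norm (of_real (\<eta>\<^sup>2) * z\<^sup>2)"
    using dist_triangle[of "\<tau> x0" "sq b z" b] by (simp add: sq_def dist_norm)
  ultimately show ?thesis using imb[of b] assms(1) BA by auto
qed

lemma sq_notin:
  assumes "b \<in> B" "z \<in> disc" "z \<noteq> 0" shows "sq b z \<notin> A"
proof
  assume s: "sq b z \<in> A"
  have nz: "of_real (\<eta>\<^sup>2) * z\<^sup>2 \<noteq> 0" using eta assms by simp
  then have "b \<noteq> sq b z" by (simp add: sq_def)
  then have "2 * \<eta>\<^sup>2 \<le> dist b (sq b z)" using sep s assms BA by blast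
  also have "\<dots> = norm (of_real (\<eta>\<^sup>2) * z\<^sup>2)" by (simp add: sq_def dist_norm)
  also have "\<dots> \<le> \<eta>\<^sup>2" using assms(2) by (simp add: norm_mult norm_power mult_left_le power_le_one)
  finally show False using eta by simp
qed

lemma test_sq: "b \<in> B \<Longrightarrow> test (sq b)"
  by (auto simp: test_def)

lemma test_linear: "r > 0 \<Longrightarrow> ball c r \<subseteq> ball (\<tau> x0) R \<Longrightarrow> ball c r \<inter> A = {} \<Longrightarrow> test (\<lambda>z. c + of_real r * z)"
  unfolding test_def by blast

lemma test_props:
  assumes "test g" shows "g holomorphic_on disc" "g ` disc \<subseteq> ball (\<tau> x0) R"
proof -
  consider c r where "r > 0" "ball c r \<subseteq> ball (\<tau> x0) R" "g = (\<lambda>z. c + of_real r * z)" | b where "b \<in> B" "g = sq b"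
    using assms by (auto simp: test_def)
  then have "g holomorphic_on disc \<and> g ` disc \<subseteq> ball (\<tau> x0) R"
  proof cases
    case 1
    have "c + of_real r * z \<in> ball c r" if "norm z < 1" for z
      using that 1(1) by (simp add: dist_norm norm_mult)
    then show ?thesis using 1 by (auto intro!: holomorphic_intros)
  next
    case 2
    have "sq b holomorphic_on disc" unfolding sq_def by (intro holomorphic_intros)
    then show ?thesis using 2 sq_in_ball by auto
  qed
  then show "g holomorphic_on disc" "g ` disc \<subseteq> ball (\<tau> x0) R" by auto
qed

lemma lifts_deriv:
  assumes h: "h holomorphic_on disc" and k: "lifts h g k" and w: "w \<in> disc"
  shows "deriv g w = deriv h (k w) * deriv k w"
proof -
  have kw: "k w \<in> disc" using k w unfolding lifts_def by blast
  have "(h has_field_derivative deriv h (k w)) (at (k w))"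
    using h kw by (metis holomorphic_derivI open_ball)
  moreover have "(k has_field_derivative deriv k w) (at w)"
    using k w by (metis lifts_def holomorphic_derivI open_ball)
  ultimately have "((\<lambda>x. h (k x)) has_field_derivative deriv h (k w) * deriv k w) (at w)"
    by (rule DERIV_chain2)
  then have "(g has_field_derivative deriv h (k w) * deriv k w) (at w)"
    by (rule has_field_derivative_transform_within_open[where S = disc]) (use k w in \<open>auto simp: lifts_def\<close>)
  then show ?thesis by (rule DERIV_imp_deriv)
qed

lemma legit_lift:
  assumes "legit h" "test g" "w \<in> disc" "z \<in> disc" "h z = g w"
  obtains k where "lifts h g k" "k w = z"
  using assms unfolding legit_def by blast

lemma deriv_linear: "deriv (\<lambda>z. c + of_real r * z) w = (of_real r :: complex)"
  by (rule DERIV_imp_deriv) (auto intro!: derivative_eq_intros)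

text \<open>The test disc of radius \<open>r0\<close> about \<open>\<tau> x0\<close> lifts to a
  self-map \<open>k\<close> of the disc fixing 0. The chain rule gives
  \<open>r0 = norm (deriv h 0) * norm (deriv k 0)\<close>, and the last factor is at most 1 by the
  Schwarz lemma. This keeps the infimum of the derivatives positive.\<close>

lemma legit_deriv_0:
  assumes h: "legit h" shows "r0 \<le> norm (deriv h 0)"
proof -
  have t: "test (\<lambda>z. \<tau> x0 + of_real r0 * z)" using r0 by (intro test_linear) auto
  obtain k where k: "lifts h (\<lambda>z. \<tau> x0 + of_real r0 * z) k" "k 0 = 0"
    by (rule legit_lift[OF h t, of 0 0]) (use h in \<open>auto simp: legit_def\<close>)
  have "of_real r0 = deriv h 0 * deriv k 0"
    using lifts_deriv[OF _ k(1), of 0] h k(2) unfolding deriv_linear by (auto simp: legit_def)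
  then have "r0 = norm (deriv h 0) * norm (deriv k 0)" using r0(1) by (metis abs_of_pos norm_mult norm_of_real)
  moreover have "norm (deriv k 0) \<le> 1"
    by (rule Schwarz_Lemma(2)[of k 0]) (use k in \<open>auto simp: lifts_def image_subset_iff\<close>)
  ultimately show ?thesis by (simp add: mult_left_le)
qed

text \<open>A small linear test disc about \<open>h z\<close> lifts through \<open>z\<close>, and
  its nonzero derivative is a product with \<open>deriv h z\<close> as a factor.\<close>

lemma legit_deriv_nonzero:
  assumes h: "legit h" and z: "z \<in> disc" "h z \<notin> A" shows "deriv h z \<noteq> 0"
proof -
  have "h z \<in> ball (\<tau> x0) R - A" using h z unfolding legit_def by blast
  moreover have "open (ball (\<tau> x0) R - A)" using finA by (intro open_Diff finite_imp_closed) auto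
  ultimately obtain r where r: "r > 0" "ball (h z) r \<subseteq> ball (\<tau> x0) R - A" by (meson open_contains_ball)
  then have t: "test (\<lambda>w. h z + of_real r * w)" by (intro test_linear) auto
  obtain k where k: "lifts h (\<lambda>w. h z + of_real r * w) k" "k 0 = z"
    by (rule legit_lift[OF h t, of 0 z]) (use z in auto)
  have "of_real r = deriv h z * deriv k 0"
    using lifts_deriv[OF _ k(1), of 0] h k(2) unfolding deriv_linear by (auto simp: legit_def)
  then show ?thesis using r(1) by auto
qed

text \<open>The trivial stage: the affine parametrization of the ball of radius \<open>R\<close>.
  Test discs and the image of \<tau> lie in this ball, so all lifts are obtained by applying the
  global inverse \<open>j\<close>.\<close>

lemma initial_state: "\<exists>h t k. state h t k"
proof -
  define h where "h z = \<tau> x0 + of_real R * z" for z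
  define j where "j w = (w - \<tau> x0) / of_real R" for w
  have hj: "h (j w) = w" for w using R by (simp add: h_def j_def)
  have jh: "j (h w) = w" for w using R by (simp add: h_def j_def)
  have jd: "j w \<in> disc" if "w \<in> ball (\<tau> x0) R" for w
    using that R by (simp add: j_def norm_divide dist_norm norm_minus_commute divide_simps)
  have jhol: "(\<lambda>z. j (g z)) holomorphic_on disc" if "g holomorphic_on disc" for g
    unfolding j_def using R by (intro holomorphic_intros that) auto
  have lj: "lifts h g (\<lambda>z. j (g z))" if "test g" for g
    unfolding lifts_def using test_props[OF that] jhol jd hj by auto
  have leg: "legit h"
    unfolding legit_def
  proof (intro conjI allI impI)
    show "h holomorphic_on disc" unfolding h_def by (intro holomorphic_intros)
    show "h ` disc \<subseteq> ball (\<tau> x0) R" using R by (auto simp: h_def dist_norm norm_mult)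
    show "h 0 = \<tau> x0" by (simp add: h_def)
    fix g w z assume "test g" "w \<in> disc" "z \<in> disc" "h z = g w"
    then show "\<exists>k. lifts h g k \<and> k w = z" using lj[of g] jh by (metis (no_types, lifting))
  qed
  have "state h (\<lambda>x. j (\<tau> x)) (\<lambda>x z. j (sq (\<beta> x) z))"
    unfolding state_def
  proof (intro conjI ballI)
    show "legit h" by (rule leg)
    show "continuous_on S (\<lambda>x. j (\<tau> x))" unfolding j_def using cont_\<tau> R by (intro continuous_intros) auto
    show "(\<lambda>x. j (\<tau> x)) ` S \<subseteq> disc" using im\<tau> jd by auto
    show "j (\<tau> x0) = 0" by (simp add: j_def)
    show "h (j (\<tau> x)) = \<tau> x" for x by (rule hj)
    fix x assume x: "x \<in> N"
    show "lifts h (sq (\<beta> x)) (\<lambda>z. j (sq (\<beta> x) z))" using lj test_sq N_beta[OF x] by blast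
    show "j (\<tau> x) = j (sq (\<beta> x) (lam x))" using N_beta[OF x] by simp
    obtain d where "d > 0" "\<And>y. y \<in> S \<Longrightarrow> dist x y < d \<Longrightarrow> y \<in> N \<and> \<beta> y = \<beta> x" by (rule N_nbhd[OF x]) blast
    then show "\<exists>d>0. \<forall>y\<in>N. dist x y < d \<longrightarrow> (\<lambda>z. j (sq (\<beta> y) z)) = (\<lambda>z. j (sq (\<beta> x) z))"
      using N_beta(1) by (intro exI[of _ d]) auto
  qed
  then show ?thesis by blast
qed

text \<open>A lift \<open>k\<close> of a test disc can be lifted further through the double covering
  branched over \<open>a\<close> if \<open>mob a\<close> of it has a root. If \<open>k\<close>
  misses \<open>a\<close>, there are no zeros. Otherwise the test disc is a uniformizing disc with
  \<open>k 0 = a\<close>; its map to the plane is branched at 0 while \<open>h\<close> is unbranched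
  at \<open>a\<close>, so \<open>k - a\<close> has its only zero at 0, of order exactly 2.\<close>

lemma marked_root:
  assumes h: "legit h" and a: "a \<in> disc" "marked h a" and g: "test g" and k: "lifts h g k"
  shows "\<exists>r. r holomorphic_on disc \<and> (\<forall>z\<in>disc. (r z)\<^sup>2 = mob a (k z) \<and> norm (r z) < 1)"
proof -
  have na: "norm a < 1" using a by simp
  have kd: "k holomorphic_on disc" "\<And>z. z \<in> disc \<Longrightarrow> norm (k z) < 1" "\<And>z. z \<in> disc \<Longrightarrow> h (k z) = g z"
    using k by (auto simp: lifts_def image_subset_iff)
  define f where "f z = mob a (k z)" for z
  have fhol: "f holomorphic_on disc"
    unfolding f_def by (rule holomorphic_mob_comp) (use kd na in auto)
  have f0: "f z = 0 \<longleftrightarrow> k z = a" if "z \<in> disc" for z using that kd na by (simp add: f_def mob_eq_0_iff)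
  have fn: "norm (f z) < 1" if "z \<in> disc" for z using that kd na by (simp add: f_def norm_mob_less_1)
  have haA: "h a \<in> A" using a(2) PA BA by (auto simp: marked_def)
  have "\<exists>r. r holomorphic_on disc \<and> (\<forall>z\<in>disc. (r z)\<^sup>2 = f z)"
  proof (cases "\<exists>z\<in>disc. k z = a")
    case False
    then have "\<And>z. z \<in> disc \<Longrightarrow> f z \<noteq> 0" using f0 by blast
    then show ?thesis using holomorphic_sqrt_ball[OF fhol] by metis
  next
    case True
    then obtain z1 where z1: "z1 \<in> disc" "k z1 = a" by blast
    then have gz: "g z1 = h a" using kd(3)[OF z1(1)] by simp
    have "\<not> (\<exists>c r. r > 0 \<and> ball c r \<subseteq> ball (\<tau> x0) R \<and> ball c r \<inter> A = {} \<and> g = (\<lambda>z. c + of_real r * z))"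
    proof
      assume "\<exists>c r. r > 0 \<and> ball c r \<subseteq> ball (\<tau> x0) R \<and> ball c r \<inter> A = {} \<and> g = (\<lambda>z. c + of_real r * z)"
      then obtain c r where cr: "r > 0" "ball c r \<inter> A = {}" "g = (\<lambda>z. c + of_real r * z)" by blast
      then have "g z1 \<in> ball c r" using z1(1) by (simp add: dist_norm norm_mult)
      then show False using gz haA cr(2) by auto
    qed
    then obtain b where b: "b \<in> B" "g = sq b" using g by (auto simp: test_def)
    have "z1 = 0" using sq_notin[of b z1] b gz haA z1 by auto
    then have hab: "h a = b" and k0: "k 0 = a" using gz b z1 by (auto simp: sq_def)
    have dh: "deriv h a \<noteq> 0" using a(2) hab b by (auto simp: marked_def B_def)
    have only0: "f z = 0 \<longleftrightarrow> z = 0" if z: "z \<in> disc" for z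
    proof
      assume "f z = 0"
      then have "sq b z \<in> A" using f0[OF z] kd(3)[OF z] b haA by simp
      then show "z = 0" using sq_notin b z by blast
    qed (use f0[of 0] k0 in auto)
    have hhol: "h holomorphic_on disc" using h by (simp add: legit_def)
    have "deriv (sq b) 0 = 0"
      unfolding sq_def by (rule DERIV_imp_deriv) (auto intro!: derivative_eq_intros)
    then have dk: "deriv k 0 = 0" using lifts_deriv[OF hhol k, of 0] dh k0 b by auto
    obtain n where n: "n holomorphic_on disc" "\<And>w. w \<in> disc \<Longrightarrow> k w - a = (w - 0) * n w" "n 0 = deriv (\<lambda>w. k w - a) 0"
      by (rule holomorphic_factor_linear[of "\<lambda>w. k w - a" disc 0]) (use kd(1) k0 in \<open>auto intro!: holomorphic_intros\<close>)
    have "((\<lambda>w. k w - a) has_field_derivative 0) (at 0)"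
      using holomorphic_derivI[OF kd(1) open_ball, of 0] dk by (auto intro!: derivative_eq_intros)
    then have "n 0 = 0" using n(3) by (simp add: DERIV_imp_deriv)
    then obtain m where m: "m holomorphic_on disc" "\<And>w. w \<in> disc \<Longrightarrow> n w = (w - 0) * m w"
      using holomorphic_factor_linear[OF n(1) open_ball, of 0] by (metis centre_in_ball zero_less_one)
    have km: "k w - a = w\<^sup>2 * m w" if "w \<in> disc" for w using n(2)[OF that] m(2)[OF that] by (simp add: power2_eq_square)
    obtain q where q: "q holomorphic_on disc" "\<And>w. w \<in> disc \<Longrightarrow> h w - b = (w - a) * q w"
      by (rule holomorphic_factor_linear[of "\<lambda>w. h w - b" disc a]) (use hhol hab a in \<open>auto intro!: holomorphic_intros\<close>)
    \<comment> \<open>Comparing \<open>h (k z) - b\<close> with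
      \<open>of_real (\<eta>\<^sup>2) * z\<^sup>2\<close> away from 0 and passing to the limit shows
      that the cofactor \<open>m\<close> of \<open>w\<^sup>2\<close> has no zero, not even at
      0.\<close>
    have mq: "m w * q (k w) = of_real (\<eta>\<^sup>2)" if w: "w \<in> disc" for w
    proof -
      have ne: "m z * q (k z) = of_real (\<eta>\<^sup>2)" if z: "z \<in> disc" "z \<noteq> 0" for z
      proof -
        have "of_real (\<eta>\<^sup>2) * z\<^sup>2 = h (k z) - b" using kd(3)[OF z(1)] b by (simp add: sq_def)
        also have "\<dots> = z\<^sup>2 * m z * q (k z)" using q(2)[of "k z"] kd(2)[OF z(1)] km[OF z(1)] by simp
        finally show ?thesis using z(2) by (simp add: mult.commute mult.left_commute)
      qed
      have "(q \<circ> k) holomorphic_on disc" by (rule holomorphic_on_compose_gen[OF kd(1) q(1)]) (use kd(2) in auto)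
      then have "(\<lambda>z. m z * q (k z)) holomorphic_on disc" using m(1) by (auto simp: o_def intro: holomorphic_intros)
      then have "m 0 * q (k 0) = of_real (\<eta>\<^sup>2)"
        by (intro holomorphic_puncture_eq[of 0 1 "\<lambda>z. m z * q (k z)"] holomorphic_on_imp_continuous_on) (auto simp: ne)
      then show ?thesis using ne[OF w] by (cases "w = 0") auto
    qed
    \<comment> \<open>The zero-free quotient of \<open>mob a (k z)\<close> by
      \<open>z\<^sup>2\<close>; with a root \<open>v\<close> of it, \<open>z * v z\<close> is the
      root sought.\<close>
    define l where "l z = m z / (1 - cnj a * k z)" for z
    have dn: "1 - cnj a * k z \<noteq> 0" if "z \<in> disc" for z using mob_denominator_nonzero[OF na kd(2)[OF that]] .
    have "l holomorphic_on disc" unfolding l_def by (intro holomorphic_intros m(1) kd(1) dn)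
    moreover have "l z \<noteq> 0" if "z \<in> disc" for z using mq[OF that] dn[OF that] eta by (auto simp: l_def)
    ultimately obtain v where v: "v holomorphic_on disc" "\<And>z. z \<in> disc \<Longrightarrow> (v z)\<^sup>2 = l z"
      using holomorphic_sqrt_ball by blast
    have "(\<lambda>z. z * v z) holomorphic_on disc" by (intro holomorphic_intros v(1))
    moreover have "(z * v z)\<^sup>2 = f z" if "z \<in> disc" for z
      using v(2)[OF that] km[OF that] by (simp add: power_mult_distrib f_def l_def Moebius_function_simple)
    ultimately show ?thesis by blast
  qed
  then obtain r where r: "r holomorphic_on disc" "\<And>z. z \<in> disc \<Longrightarrow> (r z)\<^sup>2 = f z" by blast
  moreover have "norm (r z) < 1" if "z \<in> disc" for z
  proof -
    have "(norm (r z))\<^sup>2 < 1\<^sup>2" using fn[OF that] r(2)[OF that] by (metis norm_power one_power2)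
    then show ?thesis by (rule power2_less_imp_less) simp
  qed
  ultimately show ?thesis by (auto simp: f_def)
qed

lemma koebe_map_mob:
  assumes "norm a < 1" "norm y < 1"
  shows "koebe_map a (mob (csqrt (- a)) y) = mob (- a) (y\<^sup>2)"
  using assms norm_csqrt_less_1[of "- a"] by (simp add: koebe_map_def mob_minus_mob)

end

section \<open>The Koebe step: passing to a double covering of the disc\<close>

context koebe
begin

text \<open>A lift through \<open>h\<close> is lifted further by taking a root of its image under
  \<open>mob a\<close> and moving it back by \<open>mob (csqrt (- a))\<close>. The two roots
  correspond to the two points over a given one, and the sign \<open>s\<close> selects the one that
  starts at \<open>z\<close>.\<close>

lemma koebe_legit:
  assumes h: "legit h" and a: "a \<in> disc" "marked h a"
  shows "legit (h \<circ> koebe_map a)"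
proof -
  have na: "norm a < 1" using a by simp
  let ?\<kappa> = "koebe_map a" and ?c = "csqrt (- a)"
  have nc: "norm ?c < 1" using norm_csqrt_less_1[of "- a"] na by simp
  note K = koebe_map[OF na]
  have h': "h holomorphic_on disc" "h ` disc \<subseteq> ball (\<tau> x0) R" "h 0 = \<tau> x0" using h unfolding legit_def by auto
  show ?thesis
    unfolding legit_def
  proof (intro conjI allI impI)
    show "(h \<circ> ?\<kappa>) holomorphic_on disc" by (rule holomorphic_on_compose_gen[OF K(1) h'(1) K(2)])
    show "(h \<circ> ?\<kappa>) ` disc \<subseteq> ball (\<tau> x0) R" using h'(2) K(2) unfolding image_comp[symmetric] by blast
    show "(h \<circ> ?\<kappa>) 0 = \<tau> x0" using K(3) h'(3) by simp
    fix g w z assume g: "test g" and w: "w \<in> disc" and z: "z \<in> disc" and e: "(h \<circ> ?\<kappa>) z = g w"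
    have kz: "?\<kappa> z \<in> disc" using K(2) z by blast
    obtain k where k: "lifts h g k" "k w = ?\<kappa> z" by (rule legit_lift[OF h g w kz]) (use e in auto)
    obtain r where r: "r holomorphic_on disc" "\<And>z. z \<in> disc \<Longrightarrow> (r z)\<^sup>2 = mob a (k z)" "\<And>z. z \<in> disc \<Longrightarrow> norm (r z) < 1"
      using marked_root[OF h a g k(1)] by blast
    have mz: "norm (mob (- ?c) z) < 1" using nc z by (intro norm_mob_less_1) auto
    have "(r w)\<^sup>2 = (mob (- ?c) z)\<^sup>2"
      unfolding r(2)[OF w] k(2) koebe_map_def
      by (rule mob_mob_minus[OF na]) (use mz in \<open>simp add: norm_power power_less_one_iff\<close>)
    then obtain s :: complex where s: "s = 1 \<or> s = -1" "s * r w = mob (- ?c) z"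
      by (metis mult_1 mult_minus1 power2_eq_iff)
    have s2: "s\<^sup>2 = 1" and ns: "norm s = 1" using s(1) by auto
    define k' where "k' x = mob ?c (s * r x)" for x
    have nr: "norm (s * r x) < 1" if "x \<in> disc" for x using r(3)[OF that] by (simp add: norm_mult ns)
    have "lifts (h \<circ> ?\<kappa>) g k'"
      unfolding lifts_def
    proof (intro conjI ballI)
      show "k' holomorphic_on disc"
        unfolding k'_def by (rule holomorphic_mob_comp) (use r(1) nr nc in \<open>auto intro!: holomorphic_intros\<close>)
      show "k' ` disc \<subseteq> disc"
        using norm_mob_less_1[OF nc nr] by (auto simp: k'_def)
      fix x :: complex assume x: "x \<in> disc"
      have "?\<kappa> (k' x) = mob (- a) ((s * r x)\<^sup>2)" unfolding k'_def by (rule koebe_map_mob[OF na nr[OF x]])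
      also have "\<dots> = mob (- a) (mob a (k x))" using r(2)[OF x] by (simp add: power_mult_distrib s2)
      also have "\<dots> = k x" using k(1) x by (intro mob_minus_mob na) (auto simp: lifts_def image_subset_iff)
      finally show "(h \<circ> ?\<kappa>) (k' x) = g x" using k(1) x by (simp add: lifts_def)
    qed
    moreover have "k' w = z" unfolding k'_def s(2) using nc z by (intro mob_mob_minus) auto
    ultimately show "\<exists>k. lifts (h \<circ> ?\<kappa>) g k \<and> k w = z" by blast
  qed
qed

text \<open>A continuous weight that is positive exactly on \<open>N\<close>. It attaches a sign to
  points of \<open>N\<close> in such a way that the sign fades out at the boundary.\<close>

definition cut where "cut x = (\<Sum>b\<in>B. max 0 (\<eta> / 2 - norm (u b x)))"

lemma cut: "continuous_on S cut" "cut x \<ge> 0" "x \<in> S \<Longrightarrow> cut x > 0 \<longleftrightarrow> x \<in> N"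
proof -
  show "continuous_on S cut" unfolding cut_def using cont_u BA by (intro continuous_intros) auto
  show "cut x \<ge> 0" unfolding cut_def by (intro sum_nonneg) auto
  show "cut x > 0 \<longleftrightarrow> x \<in> N" if "x \<in> S"
  proof -
    have "cut x = 0 \<longleftrightarrow> (\<forall>b\<in>B. max 0 (\<eta> / 2 - norm (u b x)) = 0)"
      unfolding cut_def using finB by (intro sum_nonneg_eq_0_iff) auto
    then have "cut x = 0 \<longleftrightarrow> x \<notin> N" using that by (force simp: N_def max_def)
    then show ?thesis using \<open>cut x \<ge> 0\<close> by linarith
  qed
qed

text \<open>The lift \<open>t\<close> has to be followed by a root of \<open>mob a (t x)\<close>,
  which may vanish on \<open>N\<close>. There the root of the holomorphic map
  \<open>mob a (k x z)\<close> is used instead; it has exactly two signs even where its value at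
  \<open>lam x\<close> is 0. Both kinds of data form one family of antipodal nonzero vectors, from
  which \<open>sign_selection\<close> selects continuously. The selected signs also determine the
  new \<open>k'\<close>.\<close>

lemma koebe_state:
  assumes st: "state h t k" and a: "a \<in> disc" "marked h a"
  shows "\<exists>t' k'. state (h \<circ> koebe_map a) t' k'"
proof -
  have na: "norm a < 1" using a by simp
  let ?\<kappa> = "koebe_map a" and ?c = "csqrt (- a)"
  have nc: "norm ?c < 1" using norm_csqrt_less_1[of "- a"] na by simp
  have h: "legit h" and ct: "continuous_on S t" and tim: "\<And>x. x \<in> S \<Longrightarrow> norm (t x) < 1"
    and t0: "t x0 = 0" and ht: "\<And>x. x \<in> S \<Longrightarrow> h (t x) = \<tau> x"
    and kl: "\<And>x. x \<in> N \<Longrightarrow> lifts h (sq (\<beta> x)) (k x)" "\<And>x. x \<in> N \<Longrightarrow> t x = k x (lam x)"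
    and kc: "\<And>x. x \<in> N \<Longrightarrow> \<exists>d>0. \<forall>y\<in>N. dist x y < d \<longrightarrow> k y = k x"
    using st unfolding state_def by (auto simp: image_subset_iff)
  \<comment> \<open>The root is a function of the holomorphic map only and not of \<open>x\<close>.
    Points with equal \<open>k\<close> thus use the same root, which makes \<open>r\<close>
    continuous near each point of \<open>N\<close>.\<close>
  define Rt where "Rt f = (SOME r. r holomorphic_on disc \<and> (\<forall>z\<in>disc. (r z)\<^sup>2 = mob a (f z) \<and> norm (r z) < 1))" for f :: "complex \<Rightarrow> complex"
  have Rt: "Rt (k x) holomorphic_on disc" "\<And>z. z \<in> disc \<Longrightarrow> (Rt (k x) z)\<^sup>2 = mob a (k x z)" "\<And>z. z \<in> disc \<Longrightarrow> norm (Rt (k x) z) < 1"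
    if x: "x \<in> N" for x
  proof -
    have "\<exists>r. r holomorphic_on disc \<and> (\<forall>z\<in>disc. (r z)\<^sup>2 = mob a (k x z) \<and> norm (r z) < 1)"
      by (rule marked_root[OF h a test_sq kl(1)[OF x]]) (use N_beta[OF x] in auto)
    from someI_ex[OF this]
    show "Rt (k x) holomorphic_on disc" "\<And>z. z \<in> disc \<Longrightarrow> (Rt (k x) z)\<^sup>2 = mob a (k x z)" "\<And>z. z \<in> disc \<Longrightarrow> norm (Rt (k x) z) < 1"
      unfolding Rt_def by blast+
  qed
  have lamd: "lam x \<in> disc" if "x \<in> N" for x using N_beta(4)[OF that] by simp
  have Rtl: "(Rt (k x) (lam x))\<^sup>2 = mob a (t x)" if "x \<in> N" for x
    using Rt(2)[OF that lamd[OF that]] kl(2)[OF that] by simp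
  define r where "r x = Rt (k x) (lam x)" for x
  have r2: "(r x)\<^sup>2 = mob a (t x)" if "x \<in> N" for x using Rtl[OF that] by (simp add: r_def)
  have loc: "\<exists>d>0. (\<forall>y\<in>S \<inter> ball x d. y \<in> N \<and> k y = k x) \<and> continuous_on (S \<inter> ball x d) r" if x: "x \<in> N" for x
  proof -
    obtain d1 where d1: "d1 > 0" "\<And>y. y \<in> S \<Longrightarrow> dist x y < d1 \<Longrightarrow> y \<in> N \<and> \<beta> y = \<beta> x" by (rule N_nbhd[OF x]) blast
    obtain d2 where d2: "d2 > 0" "\<And>y. y \<in> N \<Longrightarrow> dist x y < d2 \<Longrightarrow> k y = k x" using kc[OF x] by blast
    define d where "d = min d1 d2"
    have d: "d > 0" "\<And>y. y \<in> S \<inter> ball x d \<Longrightarrow> y \<in> N \<and> k y = k x \<and> \<beta> y = \<beta> x" using d1 d2 by (auto simp: d_def)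
    have "continuous_on (S \<inter> ball x d) (\<lambda>y. Rt (k x) (u (\<beta> x) y / of_real \<eta>))"
    proof (rule continuous_on_compose2[OF holomorphic_on_imp_continuous_on[OF Rt(1)[OF x]]])
      have "continuous_on S (u (\<beta> x))" using cont_u N_beta(2)[OF x] BA by blast
      then show "continuous_on (S \<inter> ball x d) (\<lambda>y. u (\<beta> x) y / of_real \<eta>)"
        using eta by (intro continuous_intros) (auto intro: continuous_on_subset)
      show "(\<lambda>y. u (\<beta> x) y / of_real \<eta>) ` (S \<inter> ball x d) \<subseteq> disc"
        using d(2) lamd unfolding lam_def by (metis (no_types, lifting) image_subsetI)
    qed
    then have "continuous_on (S \<inter> ball x d) r"
      by (rule continuous_on_eq) (use d(2) in \<open>auto simp: r_def lam_def\<close>)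
    then show ?thesis using d by blast
  qed
  define Q where "Q x = {(w, v). w\<^sup>2 = mob a (t x) \<and>
      (if x \<in> N then (\<exists>s. (s = 1 \<or> s = -1) \<and> w = of_real s * r x \<and> v = s * cut x) else v = 0)}" for x
  \<comment> \<open>The second component keeps the sign where the root in the first one may vanish.\<close>
  have QN: "Q x = {(r x, cut x), - (r x, cut x)}" if "x \<in> N" for x
    using r2[OF that] that by (auto simp: Q_def)
  have "\<exists>d>0. \<exists>e. continuous_on (S \<inter> ball x d) e \<and> (\<forall>y\<in>S \<inter> ball x d. Q y = {e y, - e y} \<and> e y \<noteq> 0)" if x: "x \<in> S" for x
  proof (cases "x \<in> N")
    case True
    obtain d where d: "d > 0" "\<forall>y\<in>S \<inter> ball x d. y \<in> N \<and> k y = k x" "continuous_on (S \<inter> ball x d) r"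
      using loc[OF True] by blast
    have "continuous_on (S \<inter> ball x d) (\<lambda>y. (r y, cut y))"
      using d(3) continuous_on_subset[OF cut(1), of "S \<inter> ball x d"] by (intro continuous_intros) auto
    moreover have "Q y = {(r y, cut y), - (r y, cut y)} \<and> (r y, cut y) \<noteq> 0" if "y \<in> S \<inter> ball x d" for y
      using QN d(2) cut(3)[of y] that by (auto simp: zero_prod_def)
    ultimately show ?thesis using d(1) by (intro exI[of _ d] conjI exI[of _ "\<lambda>y. (r y, cut y)"] ballI) blast+
  next
    case False
    \<comment> \<open>A zero means \<open>t x = a\<close>, hence \<open>\<tau> x \<in> A\<close>
      with vanishing root at \<open>x\<close>. For a removed point this is impossible, for a branch
      point it places \<open>x\<close> in \<open>N\<close>.\<close>
    have nz: "mob a (t x) \<noteq> 0"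
    proof
      assume "mob a (t x) = 0"
      then have "t x = a" using mob_eq_0_iff[OF na tim[OF x]] by simp
      then have ha: "h a = \<tau> x" using ht[OF x] by simp
      then have "\<tau> x \<in> A" using a(2) PA BA by (auto simp: marked_def)
      then have "u (\<tau> x) x = 0" using usq[of "\<tau> x" x] x by simp
      moreover have "\<tau> x \<in> P \<or> \<tau> x \<in> B" using a(2) ha by (auto simp: marked_def)
      ultimately show False using unz[of "\<tau> x" x] x False NI[of x "\<tau> x"] eta by auto
    qed
    have cm: "continuous_on S (\<lambda>x. mob a (t x))" by (rule continuous_on_mob_comp[OF ct]) (use tim na in auto)
    obtain d s where d: "d > 0" "continuous_on (S \<inter> ball x d) s" 
      and s: "\<And>y. y \<in> S \<inter> ball x d \<Longrightarrow> (s y)\<^sup>2 = mob a (t y) \<and> mob a (t y) \<noteq> 0"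
      by (rule continuous_local_sqrt[OF cm x nz]) blast
    define T where "T = S \<inter> ball x d"
    \<comment> \<open>On \<open>N\<close> the quotient \<open>s y / r y\<close> is the sign of the
      local root \<open>s\<close> against the reference root \<open>r\<close>; it enters with the
      weight \<open>cut\<close>.\<close>
    define v where "v y = (if y \<in> N then cut y * Re (s y / r y) else 0)" for y
    have sr: "r y \<noteq> 0 \<and> (s y / r y = 1 \<or> s y / r y = -1)" if "y \<in> T" "y \<in> N" for y
    proof -
      have "(s y)\<^sup>2 = (r y)\<^sup>2" "r y \<noteq> 0" using s[of y] r2[of y] that by (auto simp: T_def)
      then show ?thesis by (auto simp: power2_eq_iff)
    qed
    have vle: "\<bar>v y\<bar> \<le> cut y" if "y \<in> T" for y
      using sr[OF that] cut(2)[of y] by (auto simp: v_def abs_mult)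
    have cT: "continuous_on T cut" using cut(1) by (rule continuous_on_subset) (auto simp: T_def)
    have cv: "continuous_on T v"
      unfolding continuous_on_eq_continuous_within
    proof
      fix y assume y: "y \<in> T"
      then have yS: "y \<in> S" by (simp add: T_def)
      show "continuous (at y within T) v"
      proof (cases "y \<in> N")
        case True
        obtain d' where d': "d' > 0" "\<forall>z\<in>S \<inter> ball y d'. z \<in> N \<and> k z = k y" "continuous_on (S \<inter> ball y d') r"
          using loc[OF True] by blast
        let ?T' = "T \<inter> ball y d'"
        have "continuous_on ?T' (\<lambda>z. cut z * Re (s z / r z))"
        proof (intro continuous_intros)
          show "continuous_on ?T' cut" using cT by (rule continuous_on_subset) auto
          show "continuous_on ?T' s" using d(2) by (rule continuous_on_subset) (auto simp: T_def)
          show "continuous_on ?T' r" using d'(3) by (rule continuous_on_subset) (auto simp: T_def)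
          show "\<forall>z\<in>?T'. r z \<noteq> 0" using sr d'(2) by (auto simp: T_def)
        qed
        then have "continuous_on ?T' v"
          by (rule continuous_on_eq) (use d'(2) in \<open>auto simp: v_def T_def\<close>)
        then have "continuous (at y within ?T') v" using y d'(1) by (auto simp: continuous_on_eq_continuous_within)
        moreover have "at y within ?T' = at y within T" by (rule at_within_nhd[of _ "ball y d'"]) (use d'(1) in auto)
        ultimately show ?thesis by simp
      next
        case False
        \<comment> \<open>Approaching a point outside \<open>N\<close>, the sign of \<open>s\<close>
          against \<open>r\<close> may oscillate, but the weight tends to 0.\<close>
        then have c0: "cut y = 0" using cut(2)[of y] cut(3)[OF yS] by linarith
        have "(cut \<longlongrightarrow> 0) (at y within T)" using cT y c0 by (auto simp: continuous_on_def)
        moreover have "eventually (\<lambda>z. norm (v z) \<le> cut z) (at y within T)"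
          unfolding eventually_at_filter by (rule always_eventually) (use vle in auto)
        ultimately have "(v \<longlongrightarrow> 0) (at y within T)" by (rule Lim_null_comparison[rotated])
        then show ?thesis using False by (simp add: continuous_within v_def)
      qed
    qed
    have "continuous_on T (\<lambda>y. (s y, v y))" using cv d(2) by (auto simp: T_def intro!: continuous_intros)
    moreover have "Q y = {(s y, v y), - (s y, v y)} \<and> (s y, v y) \<noteq> 0" if y: "y \<in> T" for y
    proof
      have sy: "(s y)\<^sup>2 = mob a (t y)" "s y \<noteq> 0" using s[of y] y by (auto simp: T_def)
      then show "(s y, v y) \<noteq> 0" by (simp add: zero_prod_def)
      show "Q y = {(s y, v y), - (s y, v y)}"
      proof (cases "y \<in> N")
        case True
        consider "s y = r y" "v y = cut y" | "s y = - r y" "v y = - cut y"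
          using sr[OF y True] True by (auto simp: v_def divide_simps)
        then show ?thesis by cases (auto simp: QN[OF True])
      next
        case False
        then show ?thesis using sy by (auto simp: Q_def v_def power2_eq_iff[symmetric] sy(1)[symmetric]) (auto simp: power2_eq_iff)
      qed
    qed
    ultimately show ?thesis using d(1) unfolding T_def by (intro exI[of _ d] conjI exI[of _ "\<lambda>y. (s y, v y)"] ballI) blast+
  qed
  then have "\<exists>e. continuous_on S e \<and> (\<forall>x\<in>S. e x \<in> Q x)"
    by (intro sgn_S[unfolded sign_selection_def, THEN spec, THEN mp] ballI)
  then obtain e where e: "continuous_on S e" "\<And>x. x \<in> S \<Longrightarrow> e x \<in> Q x" by blast
  have "(fst (e x0))\<^sup>2 = mob a 0" using e(2)[OF x0(1)] t0 by (auto simp: Q_def)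
  then have "(fst (e x0))\<^sup>2 = ?c\<^sup>2" by (simp add: Moebius_function_of_zero)
  \<comment> \<open>The family \<open>Q\<close> is symmetric, so the whole selection may be negated.
    This arranges the value \<open>csqrt (- a)\<close> at \<open>x0\<close>, which the final
    automorphism sends to 0, as a state requires.\<close>
  then obtain s0 :: real where s0: "s0 = 1 \<or> s0 = -1" "of_real s0 * fst (e x0) = ?c"
    by (metis mult_1 mult_minus1 of_real_1 of_real_minus power2_eq_iff)
  define w where "w x = of_real s0 * fst (e x)" for x
  define v where "v x = s0 * snd (e x)" for x
  have cw: "continuous_on S w" and cv: "continuous_on S v"
    unfolding w_def v_def using e(1) by (auto intro!: continuous_intros)
  have wvQ: "(w x, v x) \<in> Q x" if "x \<in> S" for x
  proof -
    have "e x \<in> Q x" by (rule e(2)[OF that])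
    moreover have "- p \<in> Q x" if "p \<in> Q x" for p
    proof (cases "x \<in> N")
      case True
      then show ?thesis using that by (auto simp: QN)
    next
      case False
      then show ?thesis using that by (auto simp: Q_def)
    qed
    ultimately show ?thesis using s0(1) by (cases "e x") (auto simp: w_def v_def)
  qed
  have w2: "(w x)\<^sup>2 = mob a (t x)" if "x \<in> S" for x using wvQ[OF that] by (simp add: Q_def)
  have wn: "norm (w x) < 1" if "x \<in> S" for x
  proof -
    have "(norm (w x))\<^sup>2 < 1\<^sup>2" using w2[OF that] norm_mob_less_1[OF na tim[OF that]] by (metis norm_power one_power2)
    then show ?thesis by (rule power2_less_imp_less) simp
  qed
  \<comment> \<open>On \<open>N\<close> the selected second entry is \<open>cut x\<close> or its
    negative, so this is the selected sign. It is continuous with values 1 and -1, hence locally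
    constant, and so is \<open>k'\<close>.\<close>
  define s where "s x = v x / cut x" for x
  have sN: "(s x = 1 \<or> s x = -1) \<and> w x = of_real (s x) * r x" if "x \<in> N" for x
    using wvQ[OF N_beta(1)[OF that]] cut(3)[OF N_beta(1)[OF that]] that by (auto simp: QN s_def)
  define t' where "t' x = mob ?c (w x)" for x
  define k' where "k' x z = mob ?c (of_real (s x) * Rt (k x) z)" for x z
  have sRt: "norm (of_real (s x) * Rt (k x) z) < 1" if "x \<in> N" "z \<in> disc" for x z
    using sN[OF that(1)] Rt(3)[OF that] by (auto simp: norm_mult)
  have "state (h \<circ> ?\<kappa>) t' k'"
    unfolding state_def
  proof (intro conjI ballI)
    show "legit (h \<circ> ?\<kappa>)" by (rule koebe_legit[OF h a])
    show "continuous_on S t'" unfolding t'_def by (rule continuous_on_mob_comp[OF cw]) (use wn nc in auto)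
    show "t' ` S \<subseteq> disc" using norm_mob_less_1[OF nc wn] by (auto simp: t'_def)
    show "t' x0 = 0" by (simp add: t'_def w_def s0(2) Moebius_function_eq_zero)
    show "(h \<circ> ?\<kappa>) (t' x) = \<tau> x" if x: "x \<in> S" for x
      using koebe_map_mob[OF na wn[OF x]] w2[OF x] mob_minus_mob[OF na tim[OF x]] ht[OF x] by (simp add: t'_def)
    fix x assume x: "x \<in> N"
    show "lifts (h \<circ> ?\<kappa>) (sq (\<beta> x)) (k' x)"
      unfolding lifts_def
    proof (intro conjI ballI)
      show "k' x holomorphic_on disc"
        unfolding k'_def by (rule holomorphic_mob_comp) (use Rt(1)[OF x] sRt[OF x] nc in \<open>auto intro!: holomorphic_intros\<close>)
      show "k' x ` disc \<subseteq> disc" using norm_mob_less_1[OF nc sRt[OF x]] by (auto simp: k'_def)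
      fix z :: complex assume z: "z \<in> disc"
      have "?\<kappa> (k' x z) = mob (- a) ((of_real (s x) * Rt (k x) z)\<^sup>2)"
        unfolding k'_def by (rule koebe_map_mob[OF na sRt[OF x z]])
      also have "(of_real (s x) * Rt (k x) z)\<^sup>2 = mob a (k x z)" using sN[OF x] Rt(2)[OF x z] by (auto simp: power_mult_distrib)
      also have "mob (- a) \<dots> = k x z" using kl(1)[OF x] z by (intro mob_minus_mob na) (auto simp: lifts_def image_subset_iff)
      finally show "(h \<circ> ?\<kappa>) (k' x z) = sq (\<beta> x) z" using kl(1)[OF x] z by (simp add: lifts_def)
    qed
    show "t' x = k' x (lam x)" using sN[OF x] by (simp add: t'_def k'_def r_def)
    obtain d1 where d1: "d1 > 0" "\<forall>y\<in>N. dist x y < d1 \<longrightarrow> k y = k x" using kc[OF x] by blast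
    have "continuous_on N s"
      unfolding s_def using cv cut N_beta(1)
      by (intro continuous_intros) (auto intro: continuous_on_subset simp: less_le)
    then obtain d2 where d2: "d2 > 0" "\<forall>y\<in>N. dist y x < d2 \<longrightarrow> dist (s y) (s x) < 1"
      using x unfolding continuous_on_iff by (meson zero_less_one)
    have "k' y = k' x" if "y \<in> N" "dist x y < min d1 d2" for y
    proof -
      have "dist (s y) (s x) < 1" using d2 that by (auto simp: dist_commute)
      then have "s y = s x" using sN[OF that(1)] sN[OF x] by (auto simp: dist_real_def)
      moreover have "k y = k x" using d1 that by auto
      ultimately show ?thesis by (simp add: k'_def[abs_def])
    qed
    then show "\<exists>d>0. \<forall>y\<in>N. dist x y < d \<longrightarrow> k' y = k' x" using d1(1) d2(1) by (intro exI[of _ "min d1 d2"]) auto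
  qed
  then show ?thesis by blast
qed

section \<open>Bounds that are uniform over all states\<close>

lemma state_basics:
  assumes "state h t k"
  shows "legit h" "continuous_on S t" "\<And>x. x \<in> S \<Longrightarrow> t x \<in> disc" "t x0 = 0" "\<And>x. x \<in> S \<Longrightarrow> h (t x) = \<tau> x"
    "\<And>x. x \<in> N \<Longrightarrow> lifts h (sq (\<beta> x)) (k x)" "\<And>x. x \<in> N \<Longrightarrow> t x = k x (lam x)"
    "\<And>x. x \<in> N \<Longrightarrow> \<exists>d>0. \<forall>y\<in>N. dist x y < d \<longrightarrow> k y = k x"
    "h holomorphic_on disc"
  using assms unfolding state_def legit_def by blast+

lemma connected_nbhd:
  assumes "openin (top_of_set S) V" "x \<in> V"
  obtains O' where "openin (top_of_set S) O'" "connected O'" "x \<in> O'" "O' \<subseteq> V"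
proof -
  obtain U where U: "openin (top_of_set S) U" "connectedin (top_of_set S) U" "x \<in> U" "U \<subseteq> V"
    using lc_S assms unfolding locally_connected_space by meson
  then show ?thesis using that by (simp add: connectedin_subtopology)
qed

lemma connected_locally_constant:
  assumes "connected C" "x \<in> C" "y \<in> C"
    and "\<And>a. a \<in> C \<Longrightarrow> \<exists>d>0. \<forall>b\<in>C. dist a b < d \<longrightarrow> Q b = Q a" and "Q x"
  shows "Q y"
proof (rule connected_induction_simple[where P = Q, OF assms(1-3,5)])
  fix a assume "a \<in> C"
  then obtain d where d: "d > 0" "\<forall>b\<in>C. dist a b < d \<longrightarrow> Q b = Q a" using assms(4) by blast
  have "openin (top_of_set C) (C \<inter> ball a d)" "a \<in> C \<inter> ball a d" using \<open>a \<in> C\<close> d(1) by auto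
  moreover have "Q b = Q a" if "b \<in> C \<inter> ball a d" for b using d(2) that by simp
  ultimately show "\<exists>T. openin (top_of_set C) T \<and> a \<in> T \<and> (\<forall>x\<in>T. \<forall>y\<in>T. Q x \<longrightarrow> Q y)"
    by (intro exI[of _ "C \<inter> ball a d"]) blast
qed

text \<open>An inequality of Harnack type. The order of quantifiers is the point: \<open>V\<close>
  and \<sigma>' are fixed before the state. This works because \<open>l\<close> does not depend on
  the state, and the state enters only through a holomorphic self-map \<open>f\<close> of the disc,
  to which \<open>holomorphic_disc_bound\<close> applies.\<close>

lemma local_bound:
  assumes x1: "x1 \<in> S"
  shows "\<exists>V. openin (top_of_set S) V \<and> x1 \<in> V \<and>
     (\<forall>\<sigma><1. \<exists>\<sigma>'<1. \<forall>h t k. state h t k \<longrightarrow> (\<forall>x\<in>V. \<forall>y\<in>V. norm (t x) \<le> \<sigma> \<longrightarrow> norm (t y) \<le> \<sigma>'))"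
proof -
  \<comment> \<open>Near \<open>x1\<close> all states factor through one test disc, with \<open>l\<close> as coordinate.\<close>
  have "\<exists>V l. openin (top_of_set S) V \<and> x1 \<in> V \<and> (\<forall>x\<in>V. norm (l x :: complex) \<le> 1/2) \<and>
     (\<forall>h t k. state h t k \<longrightarrow> (\<forall>x\<in>V. \<exists>f. f holomorphic_on disc \<and> f ` disc \<subseteq> disc \<and> (\<forall>y\<in>V. t y = f (l y))))"
  proof (cases "x1 \<in> N")
    case True
    obtain d where d: "d > 0" "\<And>y. y \<in> S \<Longrightarrow> dist x1 y < d \<Longrightarrow> y \<in> N \<and> \<beta> y = \<beta> x1" by (rule N_nbhd[OF True]) blast
    have "openin (top_of_set S) (S \<inter> ball x1 d)" by auto
    then obtain V where V: "openin (top_of_set S) V" "connected V" "x1 \<in> V" "V \<subseteq> S \<inter> ball x1 d"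
      by (rule connected_nbhd[of _ x1]) (use d(1) x1 in auto)
    have VN: "y \<in> N" if "y \<in> V" for y using d(2)[of y] V(4) that by (auto simp: subset_iff)
    have "\<exists>f. f holomorphic_on disc \<and> f ` disc \<subseteq> disc \<and> (\<forall>y\<in>V. t y = f (lam y))" if st: "state h t k" and x: "x \<in> V" for h t k x
    proof (intro exI[of _ "k x"] conjI ballI)
      show "k x holomorphic_on disc" "k x ` disc \<subseteq> disc" using state_basics(6)[OF st VN[OF x]] by (auto simp: lifts_def)
      fix y assume y: "y \<in> V"
      have "k y = k x"
      proof (rule connected_locally_constant[OF V(2) x y, of "\<lambda>y. k y = k x"])
        fix a assume a: "a \<in> V"
        obtain d where "d > 0" "\<forall>y\<in>N. dist a y < d \<longrightarrow> k y = k a" using state_basics(8)[OF st VN[OF a]] by blast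
        then show "\<exists>d>0. \<forall>b\<in>V. dist a b < d \<longrightarrow> (k b = k x) = (k a = k x)" using VN by (intro exI[of _ d]) auto
      qed simp
      then show "t y = k x (lam y)" using state_basics(7)[OF st VN[OF y]] by simp
    qed
    then have "\<forall>h t k. state h t k \<longrightarrow> (\<forall>x\<in>V. \<exists>f. f holomorphic_on disc \<and> f ` disc \<subseteq> disc \<and> (\<forall>y\<in>V. t y = f (lam y)))"
      by (intro allI impI ballI)
    moreover have "\<forall>x\<in>V. norm (lam x) \<le> 1/2" using N_beta(4) VN by (meson less_imp_le)
    ultimately show ?thesis
      using V(1,3) by (intro exI[of _ V] exI[of _ lam] conjI)
  next
    case False
    have nA: "\<tau> x1 \<notin> A"
    proof
      assume A: "\<tau> x1 \<in> A"
      then have "u (\<tau> x1) x1 = 0" using usq[OF A x1] by simp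
      then show False using unz[of "\<tau> x1" x1] NI[OF x1, of "\<tau> x1"] A False x1 eta by (auto simp: B_def)
    qed
    have "open (ball (\<tau> x0) R - A)" using finA by (intro open_Diff finite_imp_closed) auto
    moreover have "\<tau> x1 \<in> ball (\<tau> x0) R - A" using nA im\<tau>[OF x1] by simp
    ultimately obtain r where r: "r > 0" "ball (\<tau> x1) r \<subseteq> ball (\<tau> x0) R - A" by (meson open_contains_ball)
    let ?g = "\<lambda>z. \<tau> x1 + of_real r * z"
    have tg: "test ?g" using r by (intro test_linear) auto
    let ?V0 = "S \<inter> \<tau> -` ball (\<tau> x1) (r / 2)"
    have "openin (top_of_set S) ?V0" by (rule continuous_openin_preimage_gen[OF cont_\<tau>]) auto
    then obtain V where V: "openin (top_of_set S) V" "connected V" "x1 \<in> V" "V \<subseteq> ?V0"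
      by (rule connected_nbhd[of _ x1]) (use r(1) x1 in auto)
    define l where "l x = (\<tau> x - \<tau> x1) / of_real r" for x
    have VS: "x \<in> S" if "x \<in> V" for x using V(4) that by blast
    have l: "norm (l x) \<le> 1/2" "?g (l x) = \<tau> x" if "x \<in> V" for x
    proof -
      have "dist (\<tau> x1) (\<tau> x) < r / 2" using V(4) that by auto
      then show "norm (l x) \<le> 1/2" using r(1) by (simp add: l_def norm_divide dist_norm norm_minus_commute divide_simps)
      show "?g (l x) = \<tau> x" using r(1) by (simp add: l_def)
    qed
    have ld: "l x \<in> disc" if "x \<in> V" for x using l(1)[OF that] by simp
    have \<tau>A: "\<tau> x \<notin> A" if "x \<in> V" for x
    proof -
      have "\<tau> x \<in> ball (\<tau> x1) r" using V(4) that r(1) by auto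
      then show ?thesis using r(2) by blast
    qed
    have cl: "continuous_on V l" unfolding l_def using r(1) VS by (intro continuous_intros continuous_on_subset[OF cont_\<tau>]) auto
    have "\<exists>f. f holomorphic_on disc \<and> f ` disc \<subseteq> disc \<and> (\<forall>y\<in>V. t y = f (l y))" if st: "state h t k" and x: "x \<in> V" for h t k x
    proof -
      note sb = state_basics[OF st]
      obtain f where f: "lifts h ?g f" "f (l x) = t x"
        by (rule legit_lift[OF sb(1) tg ld[OF x] sb(3)[OF VS[OF x]]]) (use sb(5)[OF VS[OF x]] l(2)[OF x] in auto)
      have fh: "f holomorphic_on disc" and fi: "f ` disc \<subseteq> disc" and hf: "\<And>z. z \<in> disc \<Longrightarrow> h (f z) = ?g z" using f(1) by (auto simp: lifts_def)
      have cfl: "continuous_on V (\<lambda>y. f (l y))"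
        by (rule continuous_on_compose2[OF holomorphic_on_imp_continuous_on[OF fh] cl]) (use ld in blast)
      have ctV: "continuous_on V t" using sb(2) by (rule continuous_on_subset) (use VS in auto)
      \<comment> \<open>Both sides lift \<tau> through \<open>h\<close> and agree at
        \<open>x\<close>. Agreement is an open condition since \<open>h\<close> is locally injective
        off the preimage of \<open>A\<close>, and disagreement is open by continuity.\<close>
      have "t y = f (l y)" if y: "y \<in> V" for y
      proof (rule connected_locally_constant[OF V(2) x y, of "\<lambda>y. t y = f (l y)"])
        fix a assume a: "a \<in> V"
        have ta: "t a \<in> disc" "h (t a) = \<tau> a" using sb(3,5) VS[OF a] by auto
        show "\<exists>d>0. \<forall>b\<in>V. dist a b < d \<longrightarrow> (t b = f (l b)) = (t a = f (l a))"
        proof (cases "t a = f (l a)")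
          case True
          have "deriv h (t a) \<noteq> 0" using legit_deriv_nonzero[OF sb(1) ta(1)] ta(2) \<tau>A[OF a] by simp
          then obtain r' where r': "r' > 0" "ball (t a) r' \<subseteq> disc" "inj_on h (ball (t a) r')"
            using has_complex_derivative_locally_injective[OF sb(9) ta(1) open_ball] by blast
          obtain d1 where d1: "d1 > 0" "\<forall>b\<in>V. dist b a < d1 \<longrightarrow> dist (t b) (t a) < r'"
            using ctV a r'(1) unfolding continuous_on_iff by meson
          obtain d2 where d2: "d2 > 0" "\<forall>b\<in>V. dist b a < d2 \<longrightarrow> dist (f (l b)) (f (l a)) < r'"
            using cfl a r'(1) unfolding continuous_on_iff by meson
          have "t b = f (l b)" if b: "b \<in> V" "dist a b < min d1 d2" for b
          proof (rule inj_onD[OF r'(3)])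
            show "h (t b) = h (f (l b))" using sb(5)[OF VS[OF b(1)]] hf[OF ld[OF b(1)]] l(2)[OF b(1)] by simp
            show "t b \<in> ball (t a) r'" using d1(2)[rule_format, OF b(1)] b(2) by (simp add: dist_commute)
            show "f (l b) \<in> ball (t a) r'" using d2(2)[rule_format, OF b(1)] b(2) True by (simp add: dist_commute)
          qed
          then show ?thesis using True d1(1) d2(1) by (intro exI[of _ "min d1 d2"]) auto
        next
          case False
          have "continuous_on V (\<lambda>y. t y - f (l y))" using ctV cfl by (intro continuous_intros)
          moreover have "t a - f (l a) \<noteq> 0" using False by simp
          ultimately obtain d where "d > 0" "\<forall>b\<in>V. dist b a < d \<longrightarrow> dist (t b - f (l b)) (t a - f (l a)) < norm (t a - f (l a))"
            using a unfolding continuous_on_iff by (metis zero_less_norm_iff)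
          then have d: "d > 0" "\<And>b. b \<in> V \<Longrightarrow> dist b a < d \<Longrightarrow> norm ((t b - f (l b)) - (t a - f (l a))) < norm (t a - f (l a))"
            by (auto simp: dist_norm)
          have "t b \<noteq> f (l b)" if "b \<in> V" "dist a b < d" for b
          proof
            assume "t b = f (l b)"
            then have "norm (t b - f (l b) - (t a - f (l a))) = norm (t a - f (l a))" by (simp add: norm_minus_commute)
            then show False using d(2)[of b] that by (simp add: dist_commute)
          qed
          then show ?thesis using False d(1) by (intro exI[of _ d]) simp
        qed
      qed (use f(2) in simp)
      then show ?thesis using fh fi by blast
    qed
    then have "\<forall>h t k. state h t k \<longrightarrow> (\<forall>x\<in>V. \<exists>f. f holomorphic_on disc \<and> f ` disc \<subseteq> disc \<and> (\<forall>y\<in>V. t y = f (l y)))"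
      by (intro allI impI ballI)
    moreover have "\<forall>x\<in>V. norm (l x) \<le> 1/2" using l(1) by blast
    ultimately show ?thesis
      using V(1,3) by (intro exI[of _ V] exI[of _ l] conjI)
  qed
  then obtain V l where V: "openin (top_of_set S) V" "x1 \<in> V" and l: "\<forall>x\<in>V. norm (l x :: complex) \<le> 1/2"
    and f: "\<forall>h t k. state h t k \<longrightarrow> (\<forall>x\<in>V. \<exists>f. f holomorphic_on disc \<and> f ` disc \<subseteq> disc \<and> (\<forall>y\<in>V. t y = f (l y)))"
    by (elim exE conjE) (rule that)
  have "\<exists>\<sigma>'<1. \<forall>h t k. state h t k \<longrightarrow> (\<forall>x\<in>V. \<forall>y\<in>V. norm (t x) \<le> \<sigma> \<longrightarrow> norm (t y) \<le> \<sigma>')" if \<sigma>: "\<sigma> < 1" for \<sigma>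
  proof -
    obtain \<sigma>' where s: "\<sigma>' < 1" "\<And>f z w. \<lbrakk>f holomorphic_on disc; f ` disc \<subseteq> disc; norm z \<le> 1/2; norm w \<le> 1/2; norm (f w) \<le> \<sigma>\<rbrakk>
      \<Longrightarrow> norm (f z) \<le> \<sigma>'" by (rule holomorphic_disc_bound[OF \<sigma>]) blast
    have "norm (t y) \<le> \<sigma>'" if st: "state h t k" and x: "x \<in> V" and y: "y \<in> V" and tx: "norm (t x) \<le> \<sigma>" for h t k x y
    proof -
      obtain g where g: "g holomorphic_on disc" "g ` disc \<subseteq> disc" "\<forall>y\<in>V. t y = g (l y)" using f[rule_format, OF st x] by (elim exE conjE) (rule that)
      show ?thesis using s(2)[OF g(1,2) l[rule_format, OF y] l[rule_format, OF x]] g(3) x y tx by simp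
    qed
    then show ?thesis using s(1) by blast
  qed
  then show ?thesis using V(1,2) by blast
qed

text \<open>All states have \<open>t x0 = 0\<close>. From there the property of being bounded away
  from the circle, uniformly over all states, spreads over the connected \<open>S\<close>, and
  compactness leaves finitely many constants. Since \<open>k x\<close> takes the value
  \<open>t x\<close> at \<open>lam x\<close>, one more application of
  \<open>holomorphic_disc_bound\<close> covers \<open>k x\<close> on the half disc.\<close>

lemma state_bound:
  obtains \<rho> where "\<rho> < 1" "\<And>h t k x. state h t k \<Longrightarrow> x \<in> S \<Longrightarrow> norm (t x) \<le> \<rho>"
    "\<And>h t k x z. state h t k \<Longrightarrow> x \<in> N \<Longrightarrow> norm z \<le> 1/2 \<Longrightarrow> norm (k x z) \<le> \<rho>"
proof -
  define G where "G x \<longleftrightarrow> (\<exists>\<sigma><1. \<forall>h t k. state h t k \<longrightarrow> norm (t x) \<le> \<sigma>)" for x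
  have G: "G x" if x: "x \<in> S" for x
  proof (rule connected_induction_simple[OF connected_S x0(1) x])
    show "G x0" unfolding G_def using state_basics(4) by (intro exI[of _ 0]) auto
    fix a assume a: "a \<in> S"
    obtain V where V: "openin (top_of_set S) V" "a \<in> V"
      and b: "\<forall>\<sigma><1. \<exists>\<sigma>'<1. \<forall>h t k. state h t k \<longrightarrow> (\<forall>x\<in>V. \<forall>y\<in>V. norm (t x) \<le> \<sigma> \<longrightarrow> norm (t y) \<le> \<sigma>')"
      using local_bound[OF a] by blast
    have "G y" if xy: "x \<in> V" "y \<in> V" "G x" for x y
    proof -
      obtain \<sigma> where s: "\<sigma> < 1" "\<forall>h t k. state h t k \<longrightarrow> norm (t x) \<le> \<sigma>" using xy(3) by (auto simp: G_def)
      obtain \<sigma>' where s': "\<sigma>' < 1" "\<forall>h t k. state h t k \<longrightarrow> (\<forall>x\<in>V. \<forall>y\<in>V. norm (t x) \<le> \<sigma> \<longrightarrow> norm (t y) \<le> \<sigma>')"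
        using b s(1) by blast
      show ?thesis unfolding G_def using s' s(2) xy by (intro exI[of _ \<sigma>']) blast
    qed
    then show "\<exists>T. openin (top_of_set S) T \<and> a \<in> T \<and> (\<forall>x\<in>T. \<forall>y\<in>T. G x \<longrightarrow> G y)" using V by blast
  qed
  have "\<exists>V \<sigma>. openin (top_of_set S) V \<and> x \<in> V \<and> \<sigma> < 1 \<and> (\<forall>h t k. state h t k \<longrightarrow> (\<forall>y\<in>V. norm (t y) \<le> \<sigma>))" if x: "x \<in> S" for x
  proof -
    obtain V where V: "openin (top_of_set S) V" "x \<in> V"
      and b: "\<forall>\<sigma><1. \<exists>\<sigma>'<1. \<forall>h t k. state h t k \<longrightarrow> (\<forall>x\<in>V. \<forall>y\<in>V. norm (t x) \<le> \<sigma> \<longrightarrow> norm (t y) \<le> \<sigma>')"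
      using local_bound[OF x] by blast
    obtain \<sigma> where s: "\<sigma> < 1" "\<forall>h t k. state h t k \<longrightarrow> norm (t x) \<le> \<sigma>" using G[OF x] by (auto simp: G_def)
    obtain \<sigma>' where s': "\<sigma>' < 1" "\<forall>h t k. state h t k \<longrightarrow> (\<forall>x\<in>V. \<forall>y\<in>V. norm (t x) \<le> \<sigma> \<longrightarrow> norm (t y) \<le> \<sigma>')"
      using b s(1) by blast
    show ?thesis using V s s' by (intro exI[of _ V] exI[of _ \<sigma>']) blast
  qed
  then obtain V \<sigma> where V: "\<And>x. x \<in> S \<Longrightarrow> openin (top_of_set S) (V x) \<and> x \<in> V x \<and> \<sigma> x < (1::real) \<and> (\<forall>h t k. state h t k \<longrightarrow> (\<forall>y\<in>V x. norm (t y) \<le> \<sigma> x))"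
    by metis
  have "(\<forall>c\<in>V ` S. openin (top_of_set S) c) \<and> S \<subseteq> \<Union>(V ` S)" using V by blast
  then have "\<exists>D\<subseteq>V ` S. finite D \<and> S \<subseteq> \<Union>D"
    by (rule compact_S[unfolded compact_eq_openin_cover, THEN spec, THEN mp])
  then obtain F where F: "F \<subseteq> S" "finite F" "S \<subseteq> (\<Union>x\<in>F. V x)" by (metis finite_subset_image)
  have Fne: "F \<noteq> {}" using F(3) x0(1) by auto
  define \<rho>0 where "\<rho>0 = Max (\<sigma> ` F)"
  have \<rho>0: "\<rho>0 < 1" unfolding \<rho>0_def using F Fne V by (subst Max_less_iff) auto
  have tb: "norm (t x) \<le> \<rho>0" if st: "state h t k" and x: "x \<in> S" for h t k x
  proof -
    obtain y where y: "y \<in> F" "x \<in> V y" using F(3) x by blast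
    then have "norm (t x) \<le> \<sigma> y" using V st F(1) by blast
    also have "\<dots> \<le> \<rho>0" unfolding \<rho>0_def using F(2) y(1) by (intro Max_ge) auto
    finally show ?thesis .
  qed
  obtain \<rho>1 where r1: "\<rho>1 < 1" "\<And>f z w. \<lbrakk>f holomorphic_on disc; f ` disc \<subseteq> disc; norm z \<le> 1/2; norm w \<le> 1/2; norm (f w) \<le> \<rho>0\<rbrakk>
      \<Longrightarrow> norm (f z) \<le> \<rho>1" by (rule holomorphic_disc_bound[OF \<rho>0]) blast
  show ?thesis
  proof (rule that[of "max \<rho>0 \<rho>1"])
    show "max \<rho>0 \<rho>1 < 1" using \<rho>0 r1 by simp
    show "norm (t x) \<le> max \<rho>0 \<rho>1" if "state h t k" "x \<in> S" for h t k x using tb[OF that] by simp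
    show "norm (k x z) \<le> max \<rho>0 \<rho>1" if st: "state h t k" and x: "x \<in> N" and z: "norm z \<le> 1/2" for h t k x z
    proof -
      have "k x holomorphic_on disc" "k x ` disc \<subseteq> disc" using state_basics(6)[OF st x] by (auto simp: lifts_def)
      moreover have "norm (lam x) \<le> 1/2" using N_beta(4)[OF x] by simp
      moreover have "norm (k x (lam x)) \<le> \<rho>0" using tb[OF st N_beta(1)[OF x]] state_basics(7)[OF st x] by simp
      ultimately have "norm (k x z) \<le> \<rho>1" using r1(2) z by blast
      then show ?thesis by simp
    qed
  qed
qed

end

section \<open>An almost minimal state and the contraction of its lift\<close>

context koebe
begin

text \<open>With \<open>m\<close> the positive infimum of the derivatives at 0 over all states, a
  state is taken with derivative below \<open>m / K\<close>. A marked point in the ball of radius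
  \<rho> would allow a Koebe step that multiplies the derivative by at most \<open>K\<close>, which
  leads below \<open>m\<close>.\<close>

lemma near_optimal_state:
  obtains h t k \<rho> where "state h t k" "0 < \<rho>" "\<rho> < 1" "\<And>x. x \<in> S \<Longrightarrow> norm (t x) < \<rho>"
    "\<And>x z. x \<in> N \<Longrightarrow> norm z \<le> 1/2 \<Longrightarrow> norm (k x z) < \<rho>" "\<And>a. norm a < \<rho> \<Longrightarrow> \<not> marked h a"
proof -
  obtain \<sigma> where \<sigma>: "\<sigma> < 1" "\<And>h t k x. state h t k \<Longrightarrow> x \<in> S \<Longrightarrow> norm (t x) \<le> \<sigma>"
    "\<And>h t k x z. state h t k \<Longrightarrow> x \<in> N \<Longrightarrow> norm z \<le> 1/2 \<Longrightarrow> norm (k x z) \<le> \<sigma>"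
    by (rule state_bound) blast
  obtain h1 t1 k1 where st1: "state h1 t1 k1" using initial_state by blast
  have "0 \<le> \<sigma>" using \<sigma>(2)[OF st1 x0(1)] norm_ge_zero order_trans by blast
  \<comment> \<open>Strictly between the uniform bound \<sigma> and 1: all lifts lie in the open
    ball of radius \<rho>, whose closure is still inside the disc.\<close>
  define \<rho> where "\<rho> = (\<sigma> + 1) / 2"
  have \<rho>: "0 < \<rho>" "\<rho> < 1" "\<sigma> < \<rho>" using \<sigma>(1) \<open>0 \<le> \<sigma>\<close> by (auto simp: \<rho>_def)
  define K where "K = 1 - (1 - sqrt \<rho>)\<^sup>2 / 2"
  have "sqrt \<rho> < 1" "0 < sqrt \<rho>" using \<rho> by auto
  then have "(1 - sqrt \<rho>)\<^sup>2 \<le> 1" "0 < (1 - sqrt \<rho>)\<^sup>2" by (auto simp: power_le_one)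
  then have K: "0 < K" "K < 1" by (auto simp: K_def)
  define D where "D = {norm (deriv h 0) | h t k. state h t k}"
  have Dlow: "r0 \<le> d" if "d \<in> D" for d using that legit_deriv_0 state_basics(1) by (auto simp: D_def)
  have Dne: "D \<noteq> {}" using st1 by (auto simp: D_def)
  have bdd: "bdd_below D" using Dlow by (rule bdd_belowI)
  define m where "m = Inf D"
  have "r0 \<le> m" unfolding m_def by (rule cInf_greatest[OF Dne Dlow])
  then have m: "0 < m" using r0(1) by linarith
  then have "m < m / K" using K by (simp add: divide_simps)
  then obtain d where "d \<in> D" "d < m / K" using cInf_lessD[OF Dne] unfolding m_def by blast
  then obtain h t k where st: "state h t k" and small: "norm (deriv h 0) < m / K" by (auto simp: D_def)
  have "\<not> marked h a" if a: "norm a < \<rho>" for a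
  proof
    assume mk: "marked h a"
    have a1: "norm a < 1" using a \<rho> by simp
    obtain t' k' where st': "state (h \<circ> koebe_map a) t' k'" using koebe_state[OF st _ mk] a1 by auto
    then have "m \<le> norm (deriv (h \<circ> koebe_map a) 0)"
      unfolding m_def by (intro cInf_lower bdd) (auto simp: D_def)
    also have "deriv (h \<circ> koebe_map a) 0 = deriv h 0 * deriv (koebe_map a) 0"
    proof -
      note K' = koebe_map[OF a1]
      have "(h has_field_derivative deriv h 0) (at (koebe_map a 0))"
        unfolding K'(3) by (rule holomorphic_derivI[OF state_basics(9)[OF st] open_ball]) simp
      moreover have "(koebe_map a has_field_derivative deriv (koebe_map a) 0) (at 0)"
        by (rule holomorphic_derivI[OF K'(1) open_ball]) simp
      ultimately show ?thesis using DERIV_chain DERIV_imp_deriv by blast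
    qed
    also have "norm \<dots> = norm (deriv h 0) * norm (deriv (koebe_map a) 0)" by (rule norm_mult)
    also have "\<dots> \<le> norm (deriv h 0) * K"
      unfolding K_def using koebe_map_deriv_bound[of a \<rho>] a \<rho> by (intro mult_left_mono) auto
    also have "\<dots> < m" using small K(1) by (simp add: field_simps)
    finally show False by simp
  qed
  then show ?thesis using that[OF st \<rho>(1,2)] \<sigma>(2,3)[OF st] \<rho>(3) by (meson order_le_less_trans)
qed

text \<open>Being unmarked over a point of \<open>A\<close> means that the point is a branch point
  and the derivative vanishes, so the order is at least 2. The lift \<open>f\<close> of the
  uniformizing disc shows that it is not larger: from
  \<open>of_real (\<eta>\<^sup>2) * z\<^sup>2 = h (f z) - b\<close> the cofactor \<open>m\<close>
  cannot vanish at \<open>a\<close>.\<close>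

lemma double_zeros:
  assumes st: "state h t k" and b: "b \<in> A" and a: "a \<in> disc" "\<not> marked h a" "h a = b" and \<rho>: "\<rho> \<le> 1"
  shows "\<exists>m. m holomorphic_on ball 0 \<rho> \<and> m a \<noteq> 0 \<and> (\<forall>w\<in>ball 0 \<rho>. h w - b = (w - a)\<^sup>2 * m w)"
proof -
  have bB: "b \<in> B" and dh: "deriv h a = 0" using a b by (auto simp: marked_def B_def)
  have hhol: "h holomorphic_on disc" by (rule state_basics(9)[OF st])
  obtain q where q: "q holomorphic_on disc" "\<And>w. w \<in> disc \<Longrightarrow> h w - b = (w - a) * q w" "q a = deriv (\<lambda>w. h w - b) a"
    by (rule holomorphic_factor_linear[of "\<lambda>w. h w - b" disc a]) (use hhol a in \<open>auto intro!: holomorphic_intros\<close>)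
  have "((\<lambda>w. h w - b) has_field_derivative 0) (at a)"
    using holomorphic_derivI[OF hhol open_ball a(1)] dh by (auto intro!: derivative_eq_intros)
  then have "q a = 0" using q(3) by (simp add: DERIV_imp_deriv)
  then obtain m where m: "m holomorphic_on disc" "\<And>w. w \<in> disc \<Longrightarrow> q w = (w - a) * m w"
    using holomorphic_factor_linear[OF q(1) open_ball a(1)] by metis
  have hm: "h w - b = (w - a)\<^sup>2 * m w" if "w \<in> disc" for w
    using q(2)[OF that] m(2)[OF that] by (simp add: power2_eq_square)
  obtain f where f: "lifts h (sq b) f" "f 0 = a"
    by (rule legit_lift[OF state_basics(1)[OF st] test_sq[OF bB], of 0 a]) (use a in \<open>auto simp: sq_def\<close>)
  have fh: "f holomorphic_on disc" and fi: "\<And>z. z \<in> disc \<Longrightarrow> f z \<in> disc" and hf: "\<And>z. z \<in> disc \<Longrightarrow> h (f z) = sq b z"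
    using f(1) unfolding lifts_def by blast+
  obtain n where n: "n holomorphic_on disc" "\<And>w. w \<in> disc \<Longrightarrow> f w - a = (w - 0) * n w"
    by (rule holomorphic_factor_linear[of "\<lambda>w. f w - a" disc 0]) (use fh f(2) in \<open>auto intro!: holomorphic_intros\<close>)
  have ne: "(n z)\<^sup>2 * m (f z) = of_real (\<eta>\<^sup>2)" if z: "z \<in> disc" "z \<noteq> 0" for z
  proof -
    have "of_real (\<eta>\<^sup>2) * z\<^sup>2 = h (f z) - b" using hf[OF z(1)] by (simp add: sq_def)
    also have "\<dots> = z\<^sup>2 * ((n z)\<^sup>2 * m (f z))" using hm[OF fi[OF z(1)]] n(2)[OF z(1)] by (simp add: power_mult_distrib)
    finally show ?thesis using z(2) by (simp add: mult.commute)
  qed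
  have "(m \<circ> f) holomorphic_on disc" by (rule holomorphic_on_compose_gen[OF fh m(1)]) (use fi in auto)
  then have "(\<lambda>z. (n z)\<^sup>2 * m (f z)) holomorphic_on disc" using n(1) by (auto simp: o_def intro!: holomorphic_intros)
  then have "(n 0)\<^sup>2 * m (f 0) = of_real (\<eta>\<^sup>2)"
    by (intro holomorphic_puncture_eq[of 0 1 "\<lambda>z. (n z)\<^sup>2 * m (f z)"] holomorphic_on_imp_continuous_on) (auto simp: ne)
  then have "m a \<noteq> 0" using f(2) eta by auto
  moreover have "ball 0 \<rho> \<subseteq> disc" using \<rho> by (intro subset_ball)
  ultimately show ?thesis using m(1) hm holomorphic_on_subset by blast
qed

text \<open>Without marked points, \<open>h - b\<close> has no zeros for a removed \<open>b\<close>
  and only double zeros for a branch point. They are finite in number because the closed ball of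
  radius \<rho> is a compact part of the disc and \<open>h\<close> is not constant.\<close>

lemma root_on_ball:
  assumes st: "state h t k" and b: "b \<in> A" and \<rho>: "\<rho> < 1" and unmarked: "\<And>a. norm a < \<rho> \<Longrightarrow> \<not> marked h a"
  shows "\<exists>v. v holomorphic_on ball 0 \<rho> \<and> (\<forall>z\<in>ball 0 \<rho>. (v z)\<^sup>2 = h z - b)"
proof -
  have hhol: "h holomorphic_on disc" by (rule state_basics(9)[OF st])
  have sub: "ball 0 \<rho> \<subseteq> disc" "cball 0 \<rho> \<subseteq> disc" using \<rho> by auto
  have nc: "\<not> (\<lambda>z. h z - b) constant_on disc"
  proof
    assume "(\<lambda>z. h z - b) constant_on disc"
    then obtain c where c: "\<And>z. z \<in> disc \<Longrightarrow> h z - b = c" unfolding constant_on_def by blast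
    have "(h has_field_derivative 0) (at 0)"
      by (rule has_field_derivative_transform_within_open[of "\<lambda>_. c + b" _ _ disc]) (use c in \<open>auto simp: algebra_simps\<close>)
    then have "deriv h 0 = 0" by (rule DERIV_imp_deriv)
    then show False using legit_deriv_0[OF state_basics(1)[OF st]] r0(1) by simp
  qed
  have "finite {z \<in> cball 0 \<rho>. h z - b = 0}"
    by (rule holomorphic_compact_finite_zeros[of "\<lambda>z. h z - b" disc]) (use hhol sub nc in \<open>auto intro!: holomorphic_intros\<close>)
  then have fin: "finite {z \<in> ball 0 \<rho>. h z - b = 0}" by (rule rev_finite_subset) auto
  have "\<forall>z\<in>{z \<in> ball 0 \<rho>. h z - b = 0}. \<exists>m. m holomorphic_on ball 0 \<rho> \<and> m z \<noteq> 0 \<and> (\<forall>w\<in>ball 0 \<rho>. h w - b = (w - z)\<^sup>2 * m w)"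
    using double_zeros[OF st b] unmarked sub \<rho> by auto
  moreover have "(\<lambda>z. h z - b) holomorphic_on ball 0 \<rho>" using hhol sub(1) by (auto intro!: holomorphic_intros elim: holomorphic_on_subset)
  ultimately show ?thesis using holomorphic_sqrt_double_zeros[OF fin _ refl] by blast
qed

text \<open>Both \<open>v (t x)\<close> and \<open>u b x\<close> are roots of
  \<open>\<tau> x - b\<close>, and their sign relative to each other should be constant. Where
  \<open>u b x\<close> vanishes the values do not determine it, so near branch points the functions
  \<open>v (k x z)\<close> and \<open>of_real \<eta> * z\<close> on a whole disc are compared
  instead.\<close>

lemma root_sign:
  assumes st: "state h t k" and b: "b \<in> A" and \<rho>: "\<rho> < 1"
    and tb: "\<And>x. x \<in> S \<Longrightarrow> norm (t x) < \<rho>" and kb: "\<And>x z. x \<in> N \<Longrightarrow> norm z \<le> 1/2 \<Longrightarrow> norm (k x z) < \<rho>"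
    and v: "v holomorphic_on ball 0 \<rho>" "\<And>z. z \<in> ball 0 \<rho> \<Longrightarrow> (v z)\<^sup>2 = h z - b"
  obtains s :: real where "s = 1 \<or> s = -1" "\<And>x. x \<in> S \<Longrightarrow> v (t x) = of_real s * u b x"
proof -
  note sb = state_basics[OF st]
  define nb where "nb x \<longleftrightarrow> b \<in> B \<and> norm (u b x) < \<eta> / 2" for x
  \<comment> \<open>Records the sign by the values and, near \<open>b\<close>, by the functions too.
    Exactly one of the two signs satisfies it at each point, and it is locally constant, so
    connectedness of \<open>S\<close> finishes the argument.\<close>
  define Q where "Q s x \<longleftrightarrow> v (t x) = of_real s * u b x \<and>
     (nb x \<longrightarrow> (\<forall>z\<in>ball 0 (1/2). v (k x z) = of_real s * of_real \<eta> * z))" for s :: real and x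
  have v2: "(v (t x))\<^sup>2 = (u b x)\<^sup>2" if "x \<in> S" for x
    using v(2)[of "t x"] tb[OF that] sb(5)[OF that] usq[OF b that] by simp
  have u0: "u b x \<noteq> 0" if "x \<in> S" "\<not> nb x" for x
    using that unz[of b x] b eta by (auto simp: nb_def B_def)
  have nbN: "x \<in> N \<and> \<beta> x = b" if "x \<in> S" "nb x" for x using that NI beta_eq by (auto simp: nb_def)
  have monom: "\<exists>s. (s = 1 \<or> s = -1) \<and> (\<forall>z\<in>ball 0 (1/2). v (k x z) = of_real s * of_real \<eta> * z)"
    if x: "x \<in> S" "nb x" for x
  proof -
    have xN: "x \<in> N" "\<beta> x = b" using nbN[OF x] by auto
    have k: "k x holomorphic_on disc" "\<And>z. z \<in> disc \<Longrightarrow> h (k x z) = sq b z" using sb(6)[OF xN(1)] xN(2) by (auto simp: lifts_def)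
    have kin: "k x z \<in> ball 0 \<rho>" if "z \<in> ball 0 (1/2)" for z using kb[OF xN(1), of z] that by simp
    have "(v \<circ> k x) holomorphic_on ball 0 (1/2)"
      by (rule holomorphic_on_compose_gen[OF holomorphic_on_subset[OF k(1)] v(1)]) (use kin in auto)
    moreover have "((v \<circ> k x) z)\<^sup>2 = (of_real \<eta>)\<^sup>2 * z\<^sup>2" if z: "z \<in> ball 0 (1/2)" for z
      using v(2)[OF kin[OF z]] k(2)[of z] z by (simp add: sq_def)
    ultimately obtain s :: real where "s = 1 \<or> s = -1" "\<And>z. z \<in> ball 0 (1/2) \<Longrightarrow> (v \<circ> k x) z = of_real s * of_real \<eta> * z"
      using holomorphic_square_monomial[of "v \<circ> k x" "1/2" "of_real \<eta>"] eta by auto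
    then show ?thesis by (intro exI[of _ s]) simp
  qed
  have tk: "v (t x) = of_real s * u b x" if x: "x \<in> S" "nb x" and s: "\<forall>z\<in>ball 0 (1/2). v (k x z) = of_real s * of_real \<eta> * z" for x s
  proof -
    have xN: "x \<in> N" "\<beta> x = b" using nbN[OF x] by auto
    have "v (t x) = of_real s * of_real \<eta> * lam x" using sb(7)[OF xN(1)] s N_beta(4)[OF xN(1)] by simp
    then show ?thesis using eta xN(2) by (simp add: lam_def)
  qed
  have ex: "\<exists>s. (s = 1 \<or> s = -1) \<and> Q s x" if x: "x \<in> S" for x
  proof (cases "nb x")
    case True
    then show ?thesis using monom[OF x True] tk[OF x True] unfolding Q_def by blast
  next
    case False
    have "v (t x) = u b x \<or> v (t x) = - u b x" using v2[OF x] by (simp add: power2_eq_iff)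
    then show ?thesis using False unfolding Q_def by (elim disjE) (intro exI[of _ 1], simp, intro exI[of _ "-1"], simp)
  qed
  have uniq: "s = s'" if x: "x \<in> S" and q: "Q s x" "Q s' x" for x s s'
  proof (cases "nb x")
    case True
    have "(1/4 :: complex) \<in> ball 0 (1/2)" by simp
    then have "of_real s * of_real \<eta> * (1/4 :: complex) = of_real s' * of_real \<eta> * (1/4)"
      using q True unfolding Q_def by metis
    then show ?thesis using eta by simp
  next
    case False
    then show ?thesis using q u0[OF x False] by (simp add: Q_def)
  qed
  have loc: "\<exists>d>0. \<forall>y\<in>S. dist a y < d \<longrightarrow> Q s y" if a: "a \<in> S" and s: "s = 1 \<or> s = -1" and q: "Q s a" for a s
  proof (cases "nb a")
    case True
    have aN: "a \<in> N" "\<beta> a = b" using nbN[OF a True] by auto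
    obtain d1 where d1: "d1 > 0" "\<And>y. y \<in> S \<Longrightarrow> dist a y < d1 \<Longrightarrow> y \<in> N \<and> \<beta> y = \<beta> a" by (rule N_nbhd[OF aN(1)]) blast
    obtain d2 where d2: "d2 > 0" "\<forall>y\<in>N. dist a y < d2 \<longrightarrow> k y = k a" using sb(8)[OF aN(1)] by blast
    have "Q s y" if y: "y \<in> S" "dist a y < min d1 d2" for y
    proof -
      have yN: "y \<in> N" "\<beta> y = b" using d1(2)[of y] y aN by auto
      then have "nb y" using N_beta[OF yN(1)] by (auto simp: nb_def)
      moreover have "k y = k a" using d2(2) yN y by auto
      ultimately show ?thesis using q True tk[OF y(1)] unfolding Q_def by simp
    qed
    then show ?thesis using d1(1) d2(1) by (intro exI[of _ "min d1 d2"]) auto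
  next
    case False
    have ua: "u b a \<noteq> 0" by (rule u0[OF a False])
    have "continuous_on S (\<lambda>x. v (t x))"
      by (rule continuous_on_compose2[OF holomorphic_on_imp_continuous_on[OF v(1)] sb(2)]) (use tb in auto)
    then have "continuous_on S (\<lambda>x. v (t x) + of_real s * u b x)" using cont_u[OF b] by (intro continuous_intros)
    moreover have "v (t a) + of_real s * u b a \<noteq> 0" using q ua s unfolding Q_def by auto
    ultimately obtain d where d: "d > 0" "\<forall>y\<in>S. dist y a < d \<longrightarrow> dist (v (t y) + of_real s * u b y) (v (t a) + of_real s * u b a) < norm (v (t a) + of_real s * u b a)"
      using a unfolding continuous_on_iff by (metis zero_less_norm_iff)
    have "Q s y" if y: "y \<in> S" "dist a y < d" for y
    proof -
      have nz: "v (t y) + of_real s * u b y \<noteq> 0"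
      proof
        assume "v (t y) + of_real s * u b y = 0"
        then have "dist (v (t y) + of_real s * u b y) (v (t a) + of_real s * u b a) = norm (v (t a) + of_real s * u b a)"
          by (simp only: dist_0_norm)
        then show False using d(2) y by (auto simp: dist_commute)
      qed
      obtain s' where s': "s' = 1 \<or> s' = -1" "Q s' y" using ex[OF y(1)] by blast
      then have "s' = s" using nz s unfolding Q_def by auto
      then show ?thesis using s'(2) by simp
    qed
    then show ?thesis using d(1) by blast
  qed
  obtain s where s: "s = 1 \<or> s = -1" "Q s x0" using ex[OF x0(1)] by blast
  have "Q s x" if x: "x \<in> S" for x
  proof (rule connected_locally_constant[OF connected_S x0(1) x, where Q = "Q s"])
    fix a assume a: "a \<in> S"
    obtain s' where s': "s' = 1 \<or> s' = -1" "Q s' a" using ex[OF a] by blast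
    obtain d where d: "d > 0" "\<forall>y\<in>S. dist a y < d \<longrightarrow> Q s' y" using loc[OF a s'] by blast
    have "Q s y = Q s a" if "y \<in> S" "dist a y < d" for y
      using d(2) that uniq[OF that(1), of s s'] uniq[OF a, of s s'] s'(2) by blast
    then show "\<exists>d>0. \<forall>y\<in>S. dist a y < d \<longrightarrow> Q s y = Q s a" using d(1) by blast
  qed (rule s(2))
  then show ?thesis using that s(1) unfolding Q_def by blast
qed

text \<open>The lift is shrunk to 0 along radii inside the ball of radius \<rho>; applying
  \<open>h\<close> and its signed roots to it gives the homotopy. The ball contains no marked point,
  so \<open>h\<close> omits \<open>P\<close> there and the roots belonging to \<open>P\<close> never
  vanish.\<close>

lemma nullhomotopy:
  obtains T U c d where "continuous_on ({0..1} \<times> S) T" "\<And>b. b \<in> A \<Longrightarrow> continuous_on ({0..1} \<times> S) (U b)"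
    "\<And>b w. b \<in> A \<Longrightarrow> w \<in> {0..1} \<times> S \<Longrightarrow> (U b w)\<^sup>2 = T w - b"
    "\<And>b w. b \<in> P \<Longrightarrow> w \<in> {0..1} \<times> S \<Longrightarrow> U b w \<noteq> 0"
    "\<And>x. x \<in> S \<Longrightarrow> T (0::real, x) = \<tau> x" "\<And>b x. b \<in> A \<Longrightarrow> x \<in> S \<Longrightarrow> U b (0, x) = u b x"
    "\<And>x. x \<in> S \<Longrightarrow> T (1, x) = c" "\<And>b x. b \<in> A \<Longrightarrow> x \<in> S \<Longrightarrow> U b (1, x) = d b"
proof -
  obtain h t k \<rho> where st: "state h t k" and \<rho>: "0 < \<rho>" "\<rho> < 1" and tb: "\<And>x. x \<in> S \<Longrightarrow> norm (t x) < \<rho>"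
    and kb: "\<And>x z. x \<in> N \<Longrightarrow> norm z \<le> 1/2 \<Longrightarrow> norm (k x z) < \<rho>" and um: "\<And>a. norm a < \<rho> \<Longrightarrow> \<not> marked h a"
    by (rule near_optimal_state) blast
  note sb = state_basics[OF st]
  have "\<exists>v. v holomorphic_on ball 0 \<rho> \<and> (\<forall>z\<in>ball 0 \<rho>. (v z)\<^sup>2 = h z - b)" if "b \<in> A" for b
    using root_on_ball[OF st that \<rho>(2) um] .
  then obtain v where v: "\<And>b. b \<in> A \<Longrightarrow> v b holomorphic_on ball 0 \<rho>" "\<And>b z. b \<in> A \<Longrightarrow> z \<in> ball 0 \<rho> \<Longrightarrow> (v b z)\<^sup>2 = h z - b"
    by metis
  have "\<exists>s::real. (s = 1 \<or> s = -1) \<and> (\<forall>x\<in>S. v b (t x) = of_real s * u b x)" if b: "b \<in> A" for b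
    using root_sign[OF st b \<rho>(2) tb kb v(1)[OF b] v(2)[OF b]] by metis
  then obtain s :: "complex \<Rightarrow> real" where s: "\<And>b. b \<in> A \<Longrightarrow> s b = 1 \<or> s b = -1" "\<And>b x. b \<in> A \<Longrightarrow> x \<in> S \<Longrightarrow> v b (t x) = of_real (s b) * u b x"
    by metis
  define r where "r w = of_real (1 - fst w) * t (snd w)" for w :: "real \<times> 'a"
  have rin: "r w \<in> ball 0 \<rho>" if "w \<in> {0..1} \<times> S" for w
  proof -
    have "norm (r w) = (1 - fst w) * norm (t (snd w))" unfolding r_def norm_mult norm_of_real using that by auto
    also have "\<dots> \<le> 1 * norm (t (snd w))" using that by (intro mult_right_mono) auto
    also have "\<dots> < \<rho>" using tb[of "snd w"] that by auto
    finally show ?thesis by simp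
  qed
  have "continuous_on ({0..1} \<times> S) (\<lambda>w. t (snd w))"
    by (rule continuous_on_compose2[OF sb(2)]) (auto intro!: continuous_on_snd continuous_on_id)
  moreover have "continuous_on ({0..1} \<times> S) (\<lambda>w. complex_of_real (1 - fst w))"
    by (intro continuous_on_of_real continuous_on_diff continuous_on_const continuous_on_fst continuous_on_id)
  ultimately have cr: "continuous_on ({0..1} \<times> S) r" unfolding r_def by (rule continuous_on_mult[rotated])
  have hc: "continuous_on (ball 0 \<rho>) h"
    by (rule holomorphic_on_imp_continuous_on, rule holomorphic_on_subset[OF sb(9)]) (use \<rho> in auto)
  show ?thesis
  proof (rule that[of "\<lambda>w. h (r w)" "\<lambda>b w. of_real (s b) * v b (r w)" "h 0" "\<lambda>b. of_real (s b) * v b 0"])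
    show "continuous_on ({0..1} \<times> S) (\<lambda>w. h (r w))"
      by (rule continuous_on_compose2[OF hc cr]) (use rin in blast)
    show "continuous_on ({0..1} \<times> S) (\<lambda>w. of_real (s b) * v b (r w))" if "b \<in> A" for b
      by (intro continuous_on_mult continuous_on_const continuous_on_compose2[OF holomorphic_on_imp_continuous_on[OF v(1)[OF that]] cr])
         (use rin in blast)
    show sq: "(of_real (s b) * v b (r w))\<^sup>2 = h (r w) - b" if "b \<in> A" "w \<in> {0..1} \<times> S" for b w
      using v(2)[OF that(1) rin[OF that(2)]] s(1)[OF that(1)] by (auto simp: power_mult_distrib)
    show "of_real (s b) * v b (r w) \<noteq> 0" if b: "b \<in> P" and w: "w \<in> {0..1} \<times> S" for b w
    proof
      assume "of_real (s b) * v b (r w) = 0"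
      then have "h (r w) = b" using sq[of b w] b w PA by auto
      then show False using um[of "r w"] rin[OF w] b by (auto simp: marked_def)
    qed
    show "h (r (0, x)) = \<tau> x" if "x \<in> S" for x using sb(5)[OF that] by (simp add: r_def)
    show "of_real (s b) * v b (r (0, x)) = u b x" if "b \<in> A" "x \<in> S" for b x
      using s(1)[OF that(1)] s(2)[OF that] by (auto simp: r_def)
    show "h (r (1, x)) = h 0" for x by (simp add: r_def)
    show "of_real (s b) * v b (r (1, x)) = of_real (s b) * v b 0" for b x by (simp add: r_def)
  qed
qed

end

lemma finite_separated:
  assumes "finite (A :: 'a::metric_space set)"
  obtains e where "e > 0" "\<And>x y. x \<in> A \<Longrightarrow> y \<in> A \<Longrightarrow> x \<noteq> y \<Longrightarrow> e \<le> dist x y"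
proof -
  let ?D = "{dist x y | x y. x \<in> A \<and> y \<in> A \<and> x \<noteq> y}"
  have "?D \<subseteq> (\<lambda>(x, y). dist x y) ` (A \<times> A)" by auto
  then have fin: "finite (insert 1 ?D)" using assms by (meson finite_SigmaI finite_imageI finite_insert finite_subset)
  show ?thesis
  proof (rule that[of "Min (insert 1 ?D)"])
    show "0 < Min (insert 1 ?D)" using fin by (subst Min_gr_iff) auto
    show "Min (insert 1 ?D) \<le> dist x y" if "x \<in> A" "y \<in> A" "x \<noteq> y" for x y
      using fin that by (intro Min_le) auto
  qed
qed

proposition fiber_nullhomotopy:
  fixes S :: "'a::metric_space set" and a :: "'i \<Rightarrow> complex"
  assumes S: "compact S" "connected S" "locally_connected_space (top_of_set S)" "sign_selection S"
    and I: "finite I" "inj_on a I" "J \<subseteq> I"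
    and ct: "continuous_on S \<tau>" and cu: "\<And>i. i \<in> I \<Longrightarrow> continuous_on S (u i)"
    and usq: "\<And>i x. i \<in> I \<Longrightarrow> x \<in> S \<Longrightarrow> (u i x)\<^sup>2 = \<tau> x - a i"
    and unz: "\<And>i x. i \<in> J \<Longrightarrow> x \<in> S \<Longrightarrow> u i x \<noteq> 0"
  obtains T U c d where "continuous_on ({0..1} \<times> S) T" "\<And>i. i \<in> I \<Longrightarrow> continuous_on ({0..1} \<times> S) (U i)"
    "\<And>i w. i \<in> I \<Longrightarrow> w \<in> {0..1} \<times> S \<Longrightarrow> (U i w)\<^sup>2 = T w - a i"
    "\<And>i w. i \<in> J \<Longrightarrow> w \<in> {0..1} \<times> S \<Longrightarrow> U i w \<noteq> 0"
    "\<And>x. x \<in> S \<Longrightarrow> T (0::real, x) = \<tau> x" "\<And>i x. i \<in> I \<Longrightarrow> x \<in> S \<Longrightarrow> U i (0, x) = u i x"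
    "\<And>x. x \<in> S \<Longrightarrow> T (1, x) = c" "\<And>i x. i \<in> I \<Longrightarrow> x \<in> S \<Longrightarrow> U i (1, x) = d i"
proof (cases "\<exists>x\<in>S. \<tau> x \<notin> a ` I")
  case False
  have csnd: "continuous_on ({0..1} \<times> S) (\<lambda>w. f (snd w))" if "continuous_on S f" for f :: "'a \<Rightarrow> complex"
    by (rule continuous_on_compose2[OF that]) (auto intro!: continuous_on_snd continuous_on_id)
  have "\<tau> constant_on S"
    by (rule continuous_finite_range_constant[OF S(2) ct], rule finite_subset[of _ "a ` I"]) (use False I in auto)
  then obtain c where c: "\<And>x. x \<in> S \<Longrightarrow> \<tau> x = c" unfolding constant_on_def by blast
  have "\<exists>d. \<forall>x\<in>S. u i x = d" if i: "i \<in> I" for i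
  proof -
    have "u i ` S \<subseteq> {csqrt (c - a i), - csqrt (c - a i)}"
    proof (rule image_subsetI)
      fix x assume "x \<in> S"
      then have "(u i x)\<^sup>2 = (csqrt (c - a i))\<^sup>2" using usq[OF i] c by simp
      then show "u i x \<in> {csqrt (c - a i), - csqrt (c - a i)}" unfolding power2_eq_iff by simp
    qed
    then have "finite (u i ` S)" by (rule finite_subset) simp
    then have "u i constant_on S" by (rule continuous_finite_range_constant[OF S(2) cu[OF i]])
    then show ?thesis unfolding constant_on_def .
  qed
  then obtain d where d: "\<And>i x. i \<in> I \<Longrightarrow> x \<in> S \<Longrightarrow> u i x = d i" by metis
  show ?thesis
    by (rule that[of "\<lambda>w. \<tau> (snd w)" "\<lambda>i w. u i (snd w)" c d]) (use csnd[OF ct] csnd[OF cu] usq unz in auto, use c d in auto)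
next
  case True
  then obtain x0 where x0: "x0 \<in> S" "\<tau> x0 \<notin> a ` I" by blast
  let ?A = "a ` I" and ?P = "a ` J" and ?u = "\<lambda>b. u (inv_into I a b)"
  have finA: "finite ?A" using I by simp
  obtain e where e: "e > 0" "\<And>x y. x \<in> ?A \<Longrightarrow> y \<in> ?A \<Longrightarrow> x \<noteq> y \<Longrightarrow> e \<le> dist x y"
    by (rule finite_separated[OF finA]) blast
  \<comment> \<open>Chosen such that \<open>2 * \<eta>\<^sup>2\<close> is the minimal distance
    \<open>e\<close> of the given points, which makes discs of radius \<eta>^2 about them
    disjoint.\<close>
  define \<eta> where "\<eta> = sqrt (e / 2)"
  have \<eta>: "\<eta> > 0" "2 * \<eta>\<^sup>2 = e" using e(1) by (auto simp: \<eta>_def)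
  have "bounded (\<tau> ` S \<union> ?A)"
    using compact_continuous_image[OF ct S(1)] finA by (simp add: compact_imp_bounded finite_imp_bounded)
  then obtain R1 where R1: "\<And>y. y \<in> \<tau> ` S \<union> ?A \<Longrightarrow> dist (\<tau> x0) y \<le> R1" unfolding bounded_any_center[of _ "\<tau> x0"] by blast
  define R where "R = \<bar>R1\<bar> + \<eta>\<^sup>2 + 1"
  have R: "R > 0" "R1 + \<eta>\<^sup>2 < R" "R1 < R" unfolding R_def using zero_le_power2[of \<eta>] by linarith+
  have "open (- ?A)" using finA by (simp add: finite_imp_closed open_Compl)
  then obtain r1 where r1: "r1 > 0" "ball (\<tau> x0) r1 \<subseteq> - ?A" using x0(2) by (meson ComplI open_contains_ball)
  define r0 where "r0 = min r1 R"
  have r0: "r0 > 0" "ball (\<tau> x0) r0 \<inter> ?A = {}" "r0 \<le> R" using r1 R(1) by (auto simp: r0_def)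
  have inv: "inv_into I a (a i) = i" if "i \<in> I" for i using inv_into_f_f[OF I(2) that] .
  interpret koebe S ?A ?P \<tau> ?u x0 \<eta> R r0
  proof
    show "dist (\<tau> x0) (\<tau> x) < R" if "x \<in> S" for x using R1[of "\<tau> x"] that R(3) by fastforce
    show "dist (\<tau> x0) b + \<eta>\<^sup>2 < R" if "b \<in> ?A" for b using R1[of b] that R(2) by fastforce
    show "2 * \<eta>\<^sup>2 \<le> dist b b'" if "b \<in> ?A" "b' \<in> ?A" "b \<noteq> b'" for b b' using e(2)[OF that] \<eta> by simp
    show "?u b x \<noteq> 0" if "b \<in> ?P" "x \<in> S" for b x using that unz inv I(3) by auto
    show "continuous_on S (?u b)" if "b \<in> ?A" for b using that cu inv by auto
    show "(?u b x)\<^sup>2 = \<tau> x - b" if "b \<in> ?A" "x \<in> S" for b x using that usq inv by auto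
    show "?P \<subseteq> ?A" using I(3) by blast
  qed (fact S finA ct x0 \<eta> R r0)+
  obtain T U c d where "continuous_on ({0..1} \<times> S) T" "\<And>b. b \<in> ?A \<Longrightarrow> continuous_on ({0..1} \<times> S) (U b)"
    "\<And>b w. b \<in> ?A \<Longrightarrow> w \<in> {0..1} \<times> S \<Longrightarrow> (U b w)\<^sup>2 = T w - b"
    "\<And>b w. b \<in> ?P \<Longrightarrow> w \<in> {0..1} \<times> S \<Longrightarrow> U b w \<noteq> 0"
    "\<And>x. x \<in> S \<Longrightarrow> T (0::real, x) = \<tau> x" "\<And>b x. b \<in> ?A \<Longrightarrow> x \<in> S \<Longrightarrow> U b (0, x) = ?u b x"
    "\<And>x. x \<in> S \<Longrightarrow> T (1, x) = c" "\<And>b x. b \<in> ?A \<Longrightarrow> x \<in> S \<Longrightarrow> U b (1, x) = d b"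
    by (rule nullhomotopy) blast
  then show ?thesis
    by (intro that[of T "\<lambda>i. U (a i)" c "\<lambda>i. d (a i)"]) (auto simp: inv)
qed

section \<open>Lifting homotopies of configurations\<close>

abbreviation homotopic_on :: "'a::topological_space set \<Rightarrow> 'b::topological_space set \<Rightarrow> ('a \<Rightarrow> 'b) \<Rightarrow> ('a \<Rightarrow> 'b) \<Rightarrow> bool" where
  "homotopic_on \<equiv> homotopic_with_canon (\<lambda>_. True)"

lemma homotopic_on_iff:
  "homotopic_on S T f g \<longleftrightarrow> (\<exists>h. continuous_on ({0..1::real} \<times> S) h \<and> h ` ({0..1} \<times> S) \<subseteq> T \<and>
     (\<forall>x\<in>S. h (0, x) = f x \<and> h (1, x) = g x))"
  by (subst homotopic_with) (auto simp: image_subset_iff_funcset ball_conj_distrib)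

lemma homotopic_onE:
  assumes "homotopic_on S T f g"
  obtains h where "continuous_on ({0..1::real} \<times> S) h" "\<And>w. w \<in> {0..1} \<times> S \<Longrightarrow> h w \<in> T"
    "\<And>x. x \<in> S \<Longrightarrow> h (0, x) = f x" "\<And>x. x \<in> S \<Longrightarrow> h (1, x) = g x"
  using assms unfolding homotopic_on_iff by (auto simp: image_subset_iff)

lemma homotopic_onI:
  assumes "continuous_on ({0..1::real} \<times> S) h" "\<And>w. w \<in> {0..1} \<times> S \<Longrightarrow> h w \<in> T"
    "\<And>x. x \<in> S \<Longrightarrow> h (0, x) = f x" "\<And>x. x \<in> S \<Longrightarrow> h (1, x) = g x"
  shows "homotopic_on S T f g"
  unfolding homotopic_on_iff using assms by (intro exI[of _ h]) auto

section \<open>Pushing a point along with a moving configuration\<close>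

definition conf :: "'i set \<Rightarrow> ('i \<Rightarrow> complex) set" where
  "conf I = {z. inj_on z I}"

text \<open>The total space of the family of curves over \<open>conf I\<close>, with
  \<open>p\<close> the point of the plane and \<open>J\<close> the indices whose points
  \<open>p\<close> must avoid. For \<open>J = I\<close> it covers the space of configurations with
  one more point. The roots are 0 off \<open>I\<close>, so that a point is determined by its data on
  \<open>I\<close>.\<close>

definition branched :: "'i set \<Rightarrow> 'i set \<Rightarrow> (('i \<Rightarrow> complex) \<times> complex \<times> ('i \<Rightarrow> complex)) set" where
  "branched I J = {(z, p, u). inj_on z I \<and> (\<forall>i\<in>I. (u i)\<^sup>2 = p - z i) \<and> (\<forall>i\<in>J. u i \<noteq> 0) \<and> (\<forall>i. i \<notin> I \<longrightarrow> u i = 0)}"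

text \<open>
  When the points \<open>z i\<close> move by \<open>D i\<close>, the point \<open>p\<close> is moved to \<open>pushed\<close>. Near \<open>z i\<close> this is the translation
  by \<open>D i\<close>, so that the quotient \<open>ratio\<close> of the new and the old value of \<open>z i - p\<close> extends continuously (by 1) to \<open>p = z i\<close>.
  The function \<open>cutinv\<close> agrees with the inverse away from 0.
\<close>

definition bump :: "real \<Rightarrow> complex \<Rightarrow> real" where
  "bump \<delta> w = max 0 (min 1 (2 - 2 * norm w / \<delta>))"

definition cutinv :: "real \<Rightarrow> complex \<Rightarrow> complex" where
  "cutinv \<delta> w = cnj w / of_real (max ((norm w)\<^sup>2) ((\<delta> / 2)\<^sup>2))"

definition pushed :: "real \<Rightarrow> 'i set \<Rightarrow> ('i \<Rightarrow> complex) \<Rightarrow> ('i \<Rightarrow> complex) \<Rightarrow> complex \<Rightarrow> complex" where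
  "pushed \<delta> I z D p = p + (\<Sum>i\<in>I. D i * of_real (bump \<delta> (p - z i)))"

definition ratio :: "real \<Rightarrow> 'i set \<Rightarrow> ('i \<Rightarrow> complex) \<Rightarrow> ('i \<Rightarrow> complex) \<Rightarrow> complex \<Rightarrow> 'i \<Rightarrow> complex" where
  "ratio \<delta> I z D p i = 1 + (D i - (pushed \<delta> I z D p - p)) * cutinv \<delta> (z i - p)"

text \<open>The supports of the bumps have radius \<delta> about points at least
  \<open>2 * \<delta>\<close> apart, so at most one is active and \<open>p\<close> moves by less
  than \<delta>/4. Within \<delta>/2 of \<open>z i\<close> the bump is 1 and the difference of the
  displacements is 0. Elsewhere this difference is smaller than \<delta>/2, hence smaller than the
  distance of \<open>p\<close> and \<open>z i\<close>. So the ratio lies in the open unit disc about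
  1, where it has a continuous nonzero root.\<close>

lemma pushed_ratio:
  assumes I: "finite I" "i \<in> I" and d: "\<delta> > 0" and sep: "\<And>i j. i \<in> I \<Longrightarrow> j \<in> I \<Longrightarrow> i \<noteq> j \<Longrightarrow> 2 * \<delta> \<le> dist (z i) (z j)"
    and D: "\<And>i. i \<in> I \<Longrightarrow> norm (D i) < \<delta> / 4"
  shows "z i + D i - pushed \<delta> I z D p = (z i - p) * ratio \<delta> I z D p i" "norm (ratio \<delta> I z D p i - 1) < 1"
proof -
  let ?s = "\<Sum>i\<in>I. D i * of_real (bump \<delta> (p - z i))"
  have push: "pushed \<delta> I z D p - p = ?s" by (simp add: pushed_def)
  have b01: "0 \<le> bump \<delta> w" "bump \<delta> w \<le> 1" for w by (auto simp: bump_def)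
  have b0: "bump \<delta> w = 0" if "\<delta> \<le> norm w" for w using that d by (simp add: bump_def divide_simps)
  have b1: "bump \<delta> w = 1" if "norm w \<le> \<delta> / 2" for w using that d by (simp add: bump_def divide_simps)
  have single: "?s = D j * of_real (bump \<delta> (p - z j))" if j: "j \<in> I" "norm (p - z j) < \<delta>" for j
  proof -
    have "D k * of_real (bump \<delta> (p - z k)) = 0" if k: "k \<in> I - {j}" for k
    proof -
      have "2 * \<delta> \<le> dist (z k) (z j)" using sep k j by auto
      also have "\<dots> \<le> norm (p - z k) + norm (p - z j)"
        using dist_triangle3[of "z k" "z j" p] by (simp add: dist_norm)
      finally show ?thesis using b0[of "p - z k"] j(2) by simp
    qed
    then have "(\<Sum>k\<in>I - {j}. D k * of_real (bump \<delta> (p - z k))) = 0" by (intro sum.neutral ballI)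
    then show ?thesis using I(1) j(1) by (simp only: sum.remove[of I j]) simp
  qed
  have small: "norm ?s < \<delta> / 4"
  proof (cases "\<exists>j\<in>I. norm (p - z j) < \<delta>")
    case True
    then obtain j where j: "j \<in> I" "norm (p - z j) < \<delta>" by blast
    have "norm ?s = norm (D j) * bump \<delta> (p - z j)" unfolding single[OF j] by (simp add: norm_mult b01)
    also have "\<dots> \<le> norm (D j)" using b01 by (simp add: mult_left_le)
    finally show ?thesis using D[OF j(1)] by linarith
  next
    case False
    then have "?s = 0" using b0 by (intro sum.neutral) (auto simp: not_less)
    then show ?thesis using d by simp
  qed
  let ?w = "z i - p"
  have "z i + D i - pushed \<delta> I z D p = ?w * ratio \<delta> I z D p i \<and> norm (ratio \<delta> I z D p i - 1) < 1"
  proof (cases "norm ?w < \<delta> / 2")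
    case True
    then have n: "norm (p - z i) < \<delta> / 2" by (simp add: norm_minus_commute)
    then have "?s = D i" using single[OF I(2)] b1 d by simp
    then show ?thesis using push by (simp add: ratio_def algebra_simps)
  next
    case False
    then have w: "\<delta> / 2 \<le> norm ?w" by simp
    then have wn: "norm ?w > 0" using d by linarith
    have "(\<delta> / 2)\<^sup>2 \<le> (norm ?w)\<^sup>2" using w d by (intro power_mono) auto
    then have "cutinv \<delta> ?w = cnj ?w / of_real ((norm ?w)\<^sup>2)" by (simp only: cutinv_def max_absorb1)
    then have c: "cutinv \<delta> ?w = 1 / ?w" using wn unfolding complex_norm_square by simp
    have "z i + D i - pushed \<delta> I z D p = ?w * ratio \<delta> I z D p i"
      unfolding ratio_def c using wn by (simp add: field_simps)
    moreover have "norm (D i - (pushed \<delta> I z D p - p)) < norm ?w"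
      using norm_triangle_ineq4[of "D i" ?s] small D[OF I(2)] w unfolding push by linarith
    then have "norm (ratio \<delta> I z D p i - 1) < 1"
      unfolding ratio_def c using wn by (simp add: norm_mult norm_divide)
    ultimately show ?thesis by blast
  qed
  then show "z i + D i - pushed \<delta> I z D p = ?w * ratio \<delta> I z D p i" "norm (ratio \<delta> I z D p i - 1) < 1" by auto
qed

lemma continuous_on_cutinv:
  assumes "continuous_on A f" "\<delta> > 0"
  shows "continuous_on A (\<lambda>x. cutinv \<delta> (f x))"
proof -
  have "max ((norm (f x))\<^sup>2) ((\<delta> / 2)\<^sup>2) \<noteq> 0" for x
  proof -
    have "0 < (\<delta> / 2)\<^sup>2" using assms(2) by simp
    then have "0 < max ((norm (f x))\<^sup>2) ((\<delta> / 2)\<^sup>2)" by (simp only: less_max_iff_disj simp_thms)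
    then show ?thesis by linarith
  qed
  then show ?thesis
    unfolding cutinv_def using assms(1) by (intro continuous_intros) (auto simp: of_real_eq_0_iff)
qed

lemma continuous_on_bump:
  assumes "continuous_on A f" "\<delta> > 0"
  shows "continuous_on A (\<lambda>x. bump \<delta> (f x))"
  unfolding bump_def using assms by (intro continuous_intros) auto

lemma ratio_0: "(\<And>i. i \<in> I \<Longrightarrow> D i = 0) \<Longrightarrow> i \<in> I \<Longrightarrow> pushed \<delta> I z D p = p \<and> ratio \<delta> I z D p i = 1"
  by (simp add: pushed_def ratio_def)

lemma pushed_0: "(\<And>i. i \<in> I \<Longrightarrow> D i = 0) \<Longrightarrow> pushed \<delta> I z D p = p"
  by (simp add: pushed_def)

lemma continuous_on_const_snd:
  assumes "continuous_on S f" shows "continuous_on ({0..1::real} \<times> S) (\<lambda>w. f (snd w))"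
  by (rule continuous_on_compose2[OF assms]) (auto intro!: continuous_on_snd continuous_on_id)

text \<open>During this time the points move by less than \<delta>/4 from their position at
  \<open>s1\<close>. The point \<open>p\<close> is pushed along, and each root is multiplied by the
  principal root of its ratio, which preserves its being zero or nonzero.\<close>

lemma branched_lift_step:
  fixes H :: "real \<times> 'a::metric_space \<Rightarrow> 'i \<Rightarrow> complex"
  assumes I: "finite I" "J \<subseteq> I" and \<delta>: "\<delta> > 0"
    and cH: "\<And>i. continuous_on ({0..1} \<times> S) (\<lambda>w. H w i)"
    and sep: "\<And>w i j. w \<in> {0..1} \<times> S \<Longrightarrow> i \<in> I \<Longrightarrow> j \<in> I \<Longrightarrow> i \<noteq> j \<Longrightarrow> 2 * \<delta> \<le> dist (H w i) (H w j)"
    and s: "0 \<le> s1" "s1 \<le> s2" "s2 \<le> 1"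
    and small: "\<And>s x i. s \<in> {s1..s2} \<Longrightarrow> x \<in> S \<Longrightarrow> i \<in> I \<Longrightarrow> dist (H (s, x) i) (H (s1, x) i) < \<delta> / 4"
    and cp: "continuous_on S p" and cu: "\<And>i. continuous_on S (\<lambda>x. u x i)"
    and br: "\<And>x. x \<in> S \<Longrightarrow> (H (s1, x), p x, u x) \<in> branched I J"
  obtains p' u' where "homotopic_on S (branched I J) (\<lambda>x. (H (s1, x), p x, u x)) (\<lambda>x. (H (s2, x), p' x, u' x))"
proof -
  define \<sigma> where "\<sigma> w = (s1 + fst w * (s2 - s1), snd w)" for w :: "real \<times> 'a"
  have \<sigma>1: "s1 + q * (s2 - s1) \<in> {s1..s2}" if "q \<in> {0..1}" for q
  proof -
    have "0 \<le> q * (s2 - s1)" "q * (s2 - s1) \<le> 1 * (s2 - s1)" using that s mult_right_mono[of q 1 "s2 - s1"] by auto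
    then show ?thesis by simp
  qed
  have \<sigma>in: "\<sigma> w \<in> {0..1} \<times> S" if "w \<in> {0..1} \<times> S" for w
    using \<sigma>1[of "fst w"] that s by (auto simp: \<sigma>_def)
  have c\<sigma>: "continuous_on ({0..1} \<times> S) \<sigma>"
    unfolding \<sigma>_def by (intro continuous_on_Pair continuous_on_add continuous_on_mult continuous_on_const continuous_on_fst continuous_on_snd continuous_on_id)
  have cs1: "continuous_on S (\<lambda>x. H (s1, x) i)" for i
    by (rule continuous_on_compose2[OF cH[of i]]) (use s in \<open>auto intro!: continuous_on_Pair continuous_on_const continuous_on_id\<close>)
  define z where "z w = H (s1, snd w)" for w :: "real \<times> 'a"
  define D where "D w i = H (\<sigma> w) i - z w i" for w i
  define P where "P w = pushed \<delta> I (z w) (D w) (p (snd w))" for w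
  define V where "V w i = u (snd w) i * csqrt (ratio \<delta> I (z w) (D w) (p (snd w)) i)" for w i
  have cz: "continuous_on ({0..1} \<times> S) (\<lambda>w. z w i)" for i unfolding z_def by (rule continuous_on_const_snd[OF cs1])
  have cH\<sigma>: "continuous_on ({0..1} \<times> S) (\<lambda>w. H (\<sigma> w) i)" for i
    by (rule continuous_on_compose2[OF cH c\<sigma>], rule image_subsetI, rule \<sigma>in)
  have cD: "continuous_on ({0..1} \<times> S) (\<lambda>w. D w i)" for i unfolding D_def by (intro continuous_on_diff cz cH\<sigma>)
  have cps: "continuous_on ({0..1::real} \<times> S) (\<lambda>w. p (snd w))" by (rule continuous_on_const_snd[OF cp])
  have cP: "continuous_on ({0..1} \<times> S) P"
    unfolding P_def pushed_def
    by (intro continuous_on_add continuous_on_sum continuous_on_mult continuous_on_of_real continuous_on_bump continuous_on_diff cps cz cD \<delta>)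
  have cR: "continuous_on ({0..1} \<times> S) (\<lambda>w. ratio \<delta> I (z w) (D w) (p (snd w)) i)" for i
    unfolding ratio_def P_def[symmetric]
    by (intro continuous_on_add continuous_on_const continuous_on_mult continuous_on_cutinv continuous_on_diff cps cz cD cP \<delta>)
  have zsep: "2 * \<delta> \<le> dist (z w i) (z w j)" if "w \<in> {0..1} \<times> S" "i \<in> I" "j \<in> I" "i \<noteq> j" for w i j
    unfolding z_def using sep[of "(s1, snd w)" i j] that s by auto
  have Dsm: "norm (D w i) < \<delta> / 4" if "w \<in> {0..1} \<times> S" "i \<in> I" for w i
    using small[of "fst (\<sigma> w)" "snd w" i] \<sigma>1[of "fst w"] that by (auto simp: D_def z_def \<sigma>_def dist_norm)
  have PR: "z w i + D w i - P w = (z w i - p (snd w)) * ratio \<delta> I (z w) (D w) (p (snd w)) i"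
      "norm (ratio \<delta> I (z w) (D w) (p (snd w)) i - 1) < 1" if w: "w \<in> {0..1} \<times> S" "i \<in> I" for w i
    unfolding P_def
    using pushed_ratio[where z = "z w" and D = "D w" and p = "p (snd w)", OF I(1) w(2) \<delta> zsep[OF w(1)] Dsm[OF w(1)]]
    by simp_all
  have Rpos: "Re (ratio \<delta> I (z w) (D w) (p (snd w)) i) > 0" if w: "w \<in> {0..1} \<times> S" "i \<in> I" for w i
  proof -
    have "\<bar>Re (ratio \<delta> I (z w) (D w) (p (snd w)) i - 1)\<bar> < 1"
      by (rule order_le_less_trans[OF abs_Re_le_cmod PR(2)[OF w]])
    then show ?thesis by simp
  qed
  have ui0: "u x i = 0" if "x \<in> S" "i \<notin> I" for x i using br[OF that(1)] that(2) by (auto simp: branched_def)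
  have cV: "continuous_on ({0..1} \<times> S) (\<lambda>w. V w i)" for i
  proof (cases "i \<in> I")
    case True
    have "continuous_on ({0..1} \<times> S) (\<lambda>w. csqrt (ratio \<delta> I (z w) (D w) (p (snd w)) i))"
      by (rule continuous_on_compose2[OF continuous_on_csqrt cR])
         (use Rpos True in \<open>force simp: complex_nonpos_Reals_iff\<close>)
    then show ?thesis unfolding V_def by (intro continuous_on_mult continuous_on_const_snd[OF cu])
  next
    case False
    have "V w i = 0" if "w \<in> {0..1} \<times> S" for w using ui0[of "snd w" i] that False by (auto simp: V_def)
    then show ?thesis by (intro continuous_on_eq[OF continuous_on_const[of _ 0]]) auto
  qed
  have "homotopic_on S (branched I J) (\<lambda>x. (H (s1, x), p x, u x)) (\<lambda>x. (H (s2, x), P (1, x), V (1, x)))"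
  proof (rule homotopic_onI[where h = "\<lambda>w. (H (\<sigma> w), P w, V w)"])
    show "continuous_on ({0..1} \<times> S) (\<lambda>w. (H (\<sigma> w), P w, V w))"
      by (intro continuous_on_Pair continuous_on_coordinatewise_then_product cH\<sigma> cP cV)
    show "(H (\<sigma> w), P w, V w) \<in> branched I J" if w: "w \<in> {0..1} \<times> S" for w
    proof -
      have x: "snd w \<in> S" using w by auto
      note b = br[OF x, unfolded branched_def, simplified]
      have "inj_on (H (\<sigma> w)) I"
      proof (rule inj_onI, rule ccontr)
        fix i j assume "i \<in> I" "j \<in> I" "H (\<sigma> w) i = H (\<sigma> w) j" "i \<noteq> j"
        then show False using sep[OF \<sigma>in[OF w], of i j] \<delta> by simp
      qed
      moreover have "(V w i)\<^sup>2 = P w - H (\<sigma> w) i" if i: "i \<in> I" for i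
      proof -
        have "(V w i)\<^sup>2 = (u (snd w) i)\<^sup>2 * ratio \<delta> I (z w) (D w) (p (snd w)) i" by (simp add: V_def power_mult_distrib)
        also have "(u (snd w) i)\<^sup>2 = p (snd w) - z w i" using b i by (simp add: z_def)
        also have "\<dots> * ratio \<delta> I (z w) (D w) (p (snd w)) i = - (z w i + D w i - P w)" unfolding PR(1)[OF w i] by (simp add: algebra_simps)
        finally show ?thesis by (simp add: D_def)
      qed
      moreover have "V w i \<noteq> 0" if i: "i \<in> J" for i
      proof -
        have "i \<in> I" using i I(2) by blast
        then have "ratio \<delta> I (z w) (D w) (p (snd w)) i \<noteq> 0" using Rpos[OF w, of i] by auto
        then show ?thesis using b i by (simp add: V_def)
      qed
      moreover have "V w i = 0" if "i \<notin> I" for i using ui0[OF x that] by (simp add: V_def)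
      ultimately show ?thesis by (simp add: branched_def)
    qed
    show "(H (\<sigma> (0, x)), P (0, x), V (0, x)) = (H (s1, x), p x, u x)" if x: "x \<in> S" for x
    proof -
      have D0: "D (0, x) i = 0" for i by (simp add: D_def \<sigma>_def z_def)
      have "P (0, x) = p x" unfolding P_def by (simp add: pushed_0 D0)
      moreover have "V (0, x) i = u x i" for i
        using ui0[OF x, of i] ratio_0[of I "D (0, x)" i] D0 by (cases "i \<in> I") (auto simp: V_def)
      ultimately show ?thesis by (auto simp: \<sigma>_def)
    qed
    show "(H (\<sigma> (1, x)), P (1, x), V (1, x)) = (H (s2, x), P (1, x), V (1, x))" for x by (simp add: \<sigma>_def)
  qed
  then show ?thesis by (rule that[of "\<lambda>x. P (1, x)" "\<lambda>x. V (1, x)"])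
qed

lemma compact_positive_bound:
  fixes f :: "'i \<Rightarrow> 'a::topological_space \<Rightarrow> real"
  assumes "finite K" "compact C" "\<And>k. k \<in> K \<Longrightarrow> continuous_on C (f k)" "\<And>k x. k \<in> K \<Longrightarrow> x \<in> C \<Longrightarrow> f k x > 0"
  obtains e where "e > 0" "\<And>k x. k \<in> K \<Longrightarrow> x \<in> C \<Longrightarrow> e \<le> f k x"
proof -
  have "\<exists>e>0. \<forall>x\<in>C. e \<le> f k x" if k: "k \<in> K" for k
  proof (cases "C = {}")
    case False
    then obtain x where "x \<in> C" "\<forall>y\<in>C. f k x \<le> f k y"
      using continuous_attains_inf[OF assms(2) _ assms(3)[OF k]] by blast
    then show ?thesis using assms(4)[OF k] by blast
  qed (auto intro: exI[of _ 1])
  then obtain e where e: "\<And>k. k \<in> K \<Longrightarrow> e k > 0 \<and> (\<forall>x\<in>C. e k \<le> f k x)" by metis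
  let ?E = "insert 1 (e ` K)"
  have fin: "finite ?E" using assms(1) by simp
  show ?thesis
  proof (rule that[of "Min ?E"])
    show "0 < Min ?E" using fin e by (subst Min_gr_iff) auto
    show "Min ?E \<le> f k x" if "k \<in> K" "x \<in> C" for k x
    proof -
      have "Min ?E \<le> e k" using fin that by (intro Min_le) auto
      then show ?thesis using e that by (meson order_trans)
    qed
  qed
qed

text \<open>Compactness gives a separation of the points valid for all times, and uniform continuity
  a number of time steps in which the points move little. Each step starts anew from the lift
  reached so far, so the end values \<open>p'\<close> and \<open>u'\<close> are not
  prescribed.\<close>

lemma branched_lift:
  fixes H :: "real \<times> 'a::metric_space \<Rightarrow> 'i \<Rightarrow> complex"
  assumes S: "compact S" and I: "finite I" "J \<subseteq> I"
    and cH: "continuous_on ({0..1} \<times> S) H" and Hc: "\<And>w. w \<in> {0..1} \<times> S \<Longrightarrow> H w \<in> conf I"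
    and cp: "continuous_on S p" and cu: "continuous_on S u"
    and br: "\<And>x. x \<in> S \<Longrightarrow> (H (0, x), p x, u x) \<in> branched I J"
  obtains p' u' where "homotopic_on S (branched I J) (\<lambda>x. (H (0, x), p x, u x)) (\<lambda>x. (H (1, x), p' x, u' x))"
proof -
  let ?C = "{0..1::real} \<times> S"
  have C: "compact ?C" using S by (intro compact_Times compact_Icc)
  have cHi: "continuous_on ?C (\<lambda>w. H w i)" for i by (rule continuous_on_product_then_coordinatewise[OF cH])
  let ?K = "{k \<in> I \<times> I. fst k \<noteq> snd k}"
  obtain e where e: "e > 0" "\<And>k w. k \<in> ?K \<Longrightarrow> w \<in> ?C \<Longrightarrow> e \<le> dist (H w (fst k)) (H w (snd k))"
  proof (rule compact_positive_bound[of ?K ?C "\<lambda>k w. dist (H w (fst k)) (H w (snd k))"])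
    show "finite ?K" by (rule finite_subset[OF Collect_restrict finite_cartesian_product[OF I(1) I(1)]])
    show "compact ?C" by (rule C)
    show "continuous_on ?C (\<lambda>w. dist (H w (fst k)) (H w (snd k)))" for k by (intro continuous_on_dist cHi)
    show "0 < dist (H w (fst k)) (H w (snd k))" if k: "k \<in> ?K" and w: "w \<in> ?C" for k w
    proof -
      have "inj_on (H w) I" using Hc[OF w] by (simp add: conf_def)
      moreover have "fst k \<in> I" "snd k \<in> I" "fst k \<noteq> snd k" using k by auto
      ultimately have "H w (fst k) \<noteq> H w (snd k)" by (metis inj_onD)
      then show ?thesis by simp
    qed
  qed blast
  define \<delta> where "\<delta> = e / 2"
  have \<delta>: "\<delta> > 0" using e(1) by (simp add: \<delta>_def)
  have sep: "2 * \<delta> \<le> dist (H w i) (H w j)" if "w \<in> ?C" "i \<in> I" "j \<in> I" "i \<noteq> j" for w i j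
    using e(2)[of "(i, j)" w] that by (simp add: \<delta>_def)
  have "\<exists>d>0. \<forall>w\<in>?C. \<forall>w'\<in>?C. dist w' w < d \<longrightarrow> dist (H w' i) (H w i) < \<delta> / 4" for i
    using compact_uniformly_continuous[OF cHi C, of i, unfolded uniformly_continuous_on_def, THEN spec, of "\<delta> / 4"] \<delta>
    by simp
  then obtain d where d: "\<And>i. d i > 0" "\<And>i w w'. w \<in> ?C \<Longrightarrow> w' \<in> ?C \<Longrightarrow> dist w' w < d i \<Longrightarrow> dist (H w' i) (H w i) < \<delta> / 4"
    by metis
  define d0 where "d0 = Min (insert 1 (d ` I))"
  have d0: "d0 > 0" unfolding d0_def using I(1) d(1) by (subst Min_gr_iff) auto
  have d0le: "d0 \<le> d i" if "i \<in> I" for i unfolding d0_def using I(1) that by (intro Min_le) auto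
  obtain n where n: "n > 0" "1 / real n < d0"
    using reals_Archimedean[OF d0] by (metis inverse_eq_divide zero_less_Suc)
  have "\<exists>p' u'. homotopic_on S (branched I J) (\<lambda>x. (H (0, x), p x, u x)) (\<lambda>x. (H (real m / real n, x), p' x, u' x))" if "m \<le> n" for m
    using that
  proof (induction m)
    case 0
    have "continuous_on S (\<lambda>x. H (0, x))"
      by (rule continuous_on_compose2[OF cH]) (auto intro!: continuous_on_Pair continuous_on_const continuous_on_id)
    then have "homotopic_on S (branched I J) (\<lambda>x. (H (0, x), p x, u x)) (\<lambda>x. (H (0, x), p x, u x))"
      using br cp cu by (auto intro!: continuous_on_Pair)
    then show ?case by (intro exI[of _ p] exI[of _ u]) simp
  next
    case (Suc m)
    let ?a = "real m / real n" and ?b = "real (Suc m) / real n"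
    obtain p1 u1 where h1: "homotopic_on S (branched I J) (\<lambda>x. (H (0, x), p x, u x)) (\<lambda>x. (H (?a, x), p1 x, u1 x))"
      using Suc by auto
    have c1: "continuous_on S (\<lambda>x. (H (?a, x), p1 x, u1 x))" using homotopic_with_imp_continuous[OF h1] by blast
    have b1: "(H (?a, x), p1 x, u1 x) \<in> branched I J" if "x \<in> S" for x
      using homotopic_with_imp_subset2[OF h1] that by blast
    have ab: "0 \<le> ?a" "?a \<le> ?b" "?b \<le> 1" "?b - ?a \<le> 1 / n" using n(1) Suc.prems by (auto simp: divide_simps)
    obtain p2 u2 where "homotopic_on S (branched I J) (\<lambda>x. (H (?a, x), p1 x, u1 x)) (\<lambda>x. (H (?b, x), p2 x, u2 x))"
    proof (rule branched_lift_step[OF I \<delta> cHi sep ab(1-3)])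
      show "dist (H (s, x) i) (H (?a, x) i) < \<delta> / 4" if s: "s \<in> {?a..?b}" "x \<in> S" "i \<in> I" for s x i
      proof (rule d(2))
        show "(?a, x) \<in> ?C" "(s, x) \<in> ?C" using s ab(1,3) order_trans[of 0 ?a s] order_trans[of ?a ?b 1] ab(2) by auto
        have "dist (s, x) (?a, x) = \<bar>s - ?a\<bar>" by (simp add: dist_prod_def dist_real_def)
        also have "\<dots> \<le> 1 / n" using s ab(4) by auto
        also have "\<dots> < d i" using n(2) d0le[OF s(3)] by linarith
        finally show "dist (s, x) (?a, x) < d i" .
      qed
      show "continuous_on S p1" using continuous_on_fst[OF continuous_on_snd[OF c1]] by simp
      show "continuous_on S (\<lambda>x. u1 x i)" for i
        using continuous_on_product_then_coordinatewise[OF continuous_on_snd[OF continuous_on_snd[OF c1]]] by simp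
      show "(H (?a, x), p1 x, u1 x) \<in> branched I J" if "x \<in> S" for x using b1[OF that] .
    qed
    then show ?case using homotopic_with_trans[OF h1] by blast
  qed
  from this[of n] n(1) show ?thesis using that by auto
qed

text \<open>Collects the properties through which spheres of dimension at least 2 enter the
  contraction arguments; absence of double coverings takes the place of simple
  connectedness.\<close>

locale aspherical_test =
  fixes S :: "'a::metric_space set"
  assumes compact_S: "compact S" and connected_S: "connected S"
    and lc_S: "locally_connected_space (top_of_set S)" and sgn_S: "sign_selection S"
begin

text \<open>The long exact sequence of a fibration in the form needed here: the contraction of the
  configuration is lifted, which moves the map into the curve over the fixed configuration
  \<open>c\<close>, and there \<open>fiber_nullhomotopy\<close> contracts it.\<close>

lemma branched_null:
  assumes I: "finite I" "J \<subseteq> I" and cF: "continuous_on S (\<lambda>x. (z x, p x, u x))"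
    and br: "\<And>x. x \<in> S \<Longrightarrow> (z x, p x, u x) \<in> branched I J"
    and null: "homotopic_on S (conf I) z (\<lambda>_. c)"
  obtains k where "homotopic_on S (branched I J) (\<lambda>x. (z x, p x, u x)) (\<lambda>_. k)"
proof (cases "S = {}")
  case True
  show ?thesis by (rule that[of undefined]) (simp only: True homotopic_with_canon_on_empty)
next
  case False
  obtain H where H: "continuous_on ({0..1::real} \<times> S) H" "\<And>w. w \<in> {0..1} \<times> S \<Longrightarrow> H w \<in> conf I"
    "\<And>x. x \<in> S \<Longrightarrow> H (0, x) = z x" "\<And>x. x \<in> S \<Longrightarrow> H (1, x) = c"
    using null by (rule homotopic_onE) blast
  have cp: "continuous_on S p" and cu: "continuous_on S u"
    using continuous_on_fst[OF continuous_on_snd[OF cF]] continuous_on_snd[OF continuous_on_snd[OF cF]] by simp_all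
  obtain p' u' where h1: "homotopic_on S (branched I J) (\<lambda>x. (H (0, x), p x, u x)) (\<lambda>x. (H (1, x), p' x, u' x))"
    by (rule branched_lift[OF compact_S I H(1,2) cp cu]) (use br H(3) in auto)
  have h2: "homotopic_on S (branched I J) (\<lambda>x. (z x, p x, u x)) (\<lambda>x. (c, p' x, u' x))"
    by (rule homotopic_with_eq[OF h1]) (use H in auto)
  have c1: "continuous_on S (\<lambda>x. (c, p' x, u' x))" using homotopic_with_imp_continuous[OF h2] by blast
  have b1: "(c, p' x, u' x) \<in> branched I J" if "x \<in> S" for x
    using homotopic_with_imp_subset2[OF h2] that by blast
  have inj: "inj_on c I" using b1 False by (auto simp: branched_def)
  have cp': "continuous_on S p'" using continuous_on_fst[OF continuous_on_snd[OF c1]] by simp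
  have cu': "continuous_on S (\<lambda>x. u' x i)" for i
    using continuous_on_product_then_coordinatewise[OF continuous_on_snd[OF continuous_on_snd[OF c1]]] by simp
  obtain T U k d where T: "continuous_on ({0..1} \<times> S) T" "\<And>i. i \<in> I \<Longrightarrow> continuous_on ({0..1} \<times> S) (U i)"
    "\<And>i w. i \<in> I \<Longrightarrow> w \<in> {0..1} \<times> S \<Longrightarrow> (U i w)\<^sup>2 = T w - c i"
    "\<And>i w. i \<in> J \<Longrightarrow> w \<in> {0..1} \<times> S \<Longrightarrow> U i w \<noteq> 0"
    "\<And>x. x \<in> S \<Longrightarrow> T (0::real, x) = p' x" "\<And>i x. i \<in> I \<Longrightarrow> x \<in> S \<Longrightarrow> U i (0, x) = u' x i"
    "\<And>x. x \<in> S \<Longrightarrow> T (1, x) = k" "\<And>i x. i \<in> I \<Longrightarrow> x \<in> S \<Longrightarrow> U i (1, x) = d i"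
  proof (rule fiber_nullhomotopy[OF compact_S connected_S lc_S sgn_S I(1) inj I(2) cp', of "\<lambda>i x. u' x i"])
    show "continuous_on S (\<lambda>x. u' x i)" for i by (rule cu')
    show "(u' x i)\<^sup>2 = p' x - c i" if "i \<in> I" "x \<in> S" for i x using b1[OF that(2)] that(1) by (auto simp: branched_def)
    show "u' x i \<noteq> 0" if "i \<in> J" "x \<in> S" for i x using b1[OF that(2)] that(1) by (auto simp: branched_def)
  qed blast
  define V where "V w i = (if i \<in> I then U i w else 0)" for w i
  have "homotopic_on S (branched I J) (\<lambda>x. (c, p' x, u' x)) (\<lambda>_. (c, k, \<lambda>i. if i \<in> I then d i else 0))"
  proof (rule homotopic_onI[where h = "\<lambda>w. (c, T w, V w)"])
    have "continuous_on ({0..1} \<times> S) (\<lambda>w. V w i)" for i using T(2)[of i] by (cases "i \<in> I") (auto simp: V_def)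
    then show "continuous_on ({0..1} \<times> S) (\<lambda>w. (c, T w, V w))"
      by (intro continuous_on_Pair continuous_on_const T(1) continuous_on_coordinatewise_then_product)
    show "(c, T w, V w) \<in> branched I J" if "w \<in> {0..1} \<times> S" for w
      using inj T(3)[OF _ that] T(4)[OF _ that] I(2) by (auto simp: branched_def V_def)
    show "(c, T (0, x), V (0, x)) = (c, p' x, u' x)" if x: "x \<in> S" for x
      using b1[OF x] T(5,6) x by (auto simp: V_def branched_def)
    show "(c, T (1, x), V (1, x)) = (c, k, \<lambda>i. if i \<in> I then d i else 0)" if x: "x \<in> S" for x
      using T(7,8) x by (auto simp: V_def)
  qed
  then show ?thesis using that homotopic_with_trans[OF h2] by blast
qed

text \<open>Without zeros there is no sign to rescue, so the real entry of the selected vectors is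
  constantly 0.\<close>

lemma global_sqrt:
  fixes g :: "'a \<Rightarrow> complex"
  assumes g: "continuous_on S g" and nz: "\<And>x. x \<in> S \<Longrightarrow> g x \<noteq> 0"
  obtains s where "continuous_on S s" "\<And>x. x \<in> S \<Longrightarrow> (s x)\<^sup>2 = g x"
proof -
  define P :: "'a \<Rightarrow> (complex \<times> real) set" where "P x = {(w, v). w\<^sup>2 = g x \<and> v = 0}" for x
  have "\<exists>d>0. \<exists>e. continuous_on (S \<inter> ball x d) e \<and> (\<forall>y\<in>S \<inter> ball x d. P y = {e y, - e y} \<and> e y \<noteq> 0)" if x: "x \<in> S" for x
  proof -
    obtain d s where d: "d > 0" "continuous_on (S \<inter> ball x d) s" "\<And>y. y \<in> S \<inter> ball x d \<Longrightarrow> (s y)\<^sup>2 = g y \<and> g y \<noteq> 0"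
      by (rule continuous_local_sqrt[OF g x nz[OF x]]) blast
    have "continuous_on (S \<inter> ball x d) (\<lambda>y. (s y, 0::real))" using d(2) by (intro continuous_on_Pair continuous_on_const)
    moreover have "P y = {(s y, 0), - (s y, 0)} \<and> (s y, 0::real) \<noteq> 0" if y: "y \<in> S \<inter> ball x d" for y
    proof
      have sy: "(s y)\<^sup>2 = g y" "s y \<noteq> 0" using d(3)[OF y] by auto
      then show "(s y, 0::real) \<noteq> 0" by (simp add: zero_prod_def)
      show "P y = {(s y, 0), - (s y, 0)}" unfolding P_def sy(1)[symmetric] by (auto simp: power2_eq_iff)
    qed
    ultimately show ?thesis using d(1) by (intro exI[of _ d] conjI exI[of _ "\<lambda>y. (s y, 0)"] ballI) blast+
  qed
  then have "\<exists>e. continuous_on S e \<and> (\<forall>x\<in>S. e x \<in> P x)"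
    by (intro sgn_S[unfolded sign_selection_def, THEN spec, THEN mp] ballI)
  then obtain e where e: "continuous_on S e" "\<And>x. x \<in> S \<Longrightarrow> e x \<in> P x" by blast
  show ?thesis
  proof (rule that[of "\<lambda>x. fst (e x)"])
    show "continuous_on S (\<lambda>x. fst (e x))" by (rule continuous_on_fst[OF e(1)])
    show "(fst (e x))\<^sup>2 = g x" if "x \<in> S" for x
      using e(2)[OF that] unfolding P_def by (cases "e x") simp
  qed
qed

text \<open>Induction on the number of points. The new point \<open>z m\<close> plays the role of
  \<open>p\<close> avoiding all others. The curves in \<open>branched I I\<close> also ask for roots
  of \<open>z m - z i\<close>; these exist because \<open>S\<close> has no nontrivial double
  covering.\<close>

lemma conf_null:
  assumes "finite I" "continuous_on S z" "\<And>x. x \<in> S \<Longrightarrow> z x \<in> conf I"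
  obtains k where "homotopic_on S (conf I) z (\<lambda>_. k)"
proof -
  have "\<exists>k. homotopic_on S (conf I) z (\<lambda>_. k)"
    using assms
  proof (induction I arbitrary: z rule: finite_induct)
    case empty
    have "homotopic_on S (conf {}) z (\<lambda>_. \<lambda>_. 0)"
    proof (rule homotopic_onI[where h = "\<lambda>w i. of_real (1 - fst w) * z (snd w) i"])
      show "continuous_on ({0..1} \<times> S) (\<lambda>w i. of_real (1 - fst w) * z (snd w) i)"
      proof (rule continuous_on_coordinatewise_then_product)
        fix i
        have "continuous_on S (\<lambda>x. z x i)" by (rule continuous_on_product_then_coordinatewise[OF empty(1)])
        from continuous_on_const_snd[OF this]
        show "continuous_on ({0..1} \<times> S) (\<lambda>w. of_real (1 - fst w) * z (snd w) i)"
          by (intro continuous_on_mult continuous_on_of_real continuous_on_diff continuous_on_const continuous_on_fst continuous_on_id)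
      qed
    qed (auto simp: conf_def)
    then show ?case by blast
  next
    case (insert m I z)
    have zc: "inj_on (z x) I" "\<And>i. i \<in> I \<Longrightarrow> z x m \<noteq> z x i" if "x \<in> S" for x
      using insert.prems(2)[OF that] insert.hyps(2) by (auto simp: conf_def)
    obtain c where c: "homotopic_on S (conf I) z (\<lambda>_. c)"
      using insert.IH[OF insert.prems(1)] zc(1) by (auto simp: conf_def)
    have cz: "continuous_on S (\<lambda>x. z x i)" for i by (rule continuous_on_product_then_coordinatewise[OF insert.prems(1)])
    have "\<exists>s. continuous_on S s \<and> (\<forall>x\<in>S. (s x)\<^sup>2 = z x m - z x i)" if i: "i \<in> I" for i
    proof -
      obtain s where "continuous_on S s" "\<And>x. x \<in> S \<Longrightarrow> (s x)\<^sup>2 = z x m - z x i"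
        by (rule global_sqrt[of "\<lambda>x. z x m - z x i"]) (use zc(2)[OF _ i] in \<open>auto intro!: continuous_on_diff cz\<close>)
      then show ?thesis by blast
    qed
    then obtain s where s: "\<And>i. i \<in> I \<Longrightarrow> continuous_on S (s i)" "\<And>i x. i \<in> I \<Longrightarrow> x \<in> S \<Longrightarrow> (s i x)\<^sup>2 = z x m - z x i"
      by metis
    define u where "u x i = (if i \<in> I then s i x else 0)" for x i
    have cu: "continuous_on S (\<lambda>x. u x i)" for i using s(1) by (cases "i \<in> I") (auto simp: u_def)
    have cF: "continuous_on S (\<lambda>x. (z x, z x m, u x))"
      by (intro continuous_on_Pair insert.prems(1) cz continuous_on_coordinatewise_then_product cu)
    have br: "(z x, z x m, u x) \<in> branched I I" if x: "x \<in> S" for x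
    proof -
      have "s i x \<noteq> 0" if "i \<in> I" for i using s(2)[OF that x] zc(2)[OF x that] by auto
      then show ?thesis using zc[OF x] s(2) x by (auto simp: branched_def u_def)
    qed
    \<comment> \<open>the fibration that forgets \<open>z m\<close>\<close>
    obtain k where k: "homotopic_on S (branched I I) (\<lambda>x. (z x, z x m, u x)) (\<lambda>_. k)"
      by (rule branched_null[OF insert.hyps(1) subset_refl cF br c])
    \<comment> \<open>Forgets the roots and puts \<open>p\<close> back as the point with index
      \<open>m\<close>, which returns from \<open>branched I I\<close> to configurations.\<close>
    define \<phi> where "\<phi> v = (\<lambda>i. if i = m then fst (snd v) else fst v i)" for v :: "('b \<Rightarrow> complex) \<times> complex \<times> ('b \<Rightarrow> complex)"
    have "continuous_on (branched I I) \<phi>"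
      unfolding \<phi>_def
    proof (intro continuous_on_coordinatewise_then_product)
      fix i
      have "continuous_on (branched I I) (\<lambda>v. fst v i)"
        by (rule continuous_on_product_then_coordinatewise[OF continuous_on_fst[OF continuous_on_id]])
      then show "continuous_on (branched I I) (\<lambda>v. if i = m then fst (snd v) else fst v i)"
        by (cases "i = m") (auto intro!: continuous_on_fst continuous_on_snd continuous_on_id)
    qed
    moreover have "\<phi> v \<in> conf (insert m I)" if "v \<in> branched I I" for v
    proof -
      obtain z p u where v: "v = (z, p, u)" by (cases v)
      have b: "inj_on z I" "\<And>i. i \<in> I \<Longrightarrow> (u i)\<^sup>2 = p - z i \<and> u i \<noteq> 0" using that by (auto simp: v branched_def)
      have "p \<noteq> z i" if "i \<in> I" for i using b(2)[OF that] by auto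
      moreover have "inj_on (\<phi> v) I" using b(1) insert.hyps(2) by (auto simp: inj_on_def \<phi>_def v)
      ultimately show ?thesis using insert.hyps(2) by (auto simp: conf_def \<phi>_def v)
    qed
    ultimately have "homotopic_on S (conf (insert m I)) (\<phi> \<circ> (\<lambda>x. (z x, z x m, u x))) (\<phi> \<circ> (\<lambda>_. k))"
      by (intro homotopic_with_compose_continuous_left[OF k]) auto
    then have "homotopic_on S (conf (insert m I)) z (\<lambda>_. \<phi> k)"
      by (rule homotopic_with_eq) (auto simp: \<phi>_def fun_eq_iff)
    then show ?case by blast
  qed
  then show ?thesis using that by blast
qed

text \<open>The set \<open>Y_Bn\<close> in the Cayley coordinates of its exponentials. The value 0
  is not excluded; it belongs to half-integral coordinates. This is what relates the space to type
  D.\<close>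

definition (in -) Y_alg :: "('i \<Rightarrow> complex) set" where
  "Y_alg = {y. (\<forall>i. y i \<noteq> 1 \<and> y i \<noteq> -1) \<and> (\<forall>i j. i \<noteq> j \<longrightarrow> y i \<noteq> y j \<and> y i \<noteq> - y j)}"

text \<open>The choice \<open>p = -1\<close> and \<open>u i = \<i> * Y i\<close> satisfies
  \<open>(u i)\<^sup>2 = p - z i\<close>. Only the homogenizing coordinate has to stay nonzero,
  hence \<open>J = {None}\<close>; the others may pass through the branch points.\<close>

lemma Y_alg_null:
  fixes y :: "'a \<Rightarrow> 'i::finite \<Rightarrow> complex"
  assumes cy: "continuous_on S y" and y: "\<And>x. x \<in> S \<Longrightarrow> y x \<in> Y_alg"
  obtains k where "homotopic_on S Y_alg y (\<lambda>_. k)"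
proof -
  \<comment> \<open>the index \<open>None\<close> carries the homogenizing coordinate\<close>
  define Y where "Y x i = (case i of None \<Rightarrow> 1 | Some j \<Rightarrow> y x j)" for x i
  have cyi: "continuous_on S (\<lambda>x. y x j)" for j by (rule continuous_on_product_then_coordinatewise[OF cy])
  have cY: "continuous_on S (\<lambda>x. Y x i)" for i using cyi by (cases i) (auto simp: Y_def)
  define z where "z x i = (Y x i)\<^sup>2 - 1" for x i
  define u where "u x i = \<i> * Y x i" for x i
  have cz: "continuous_on S z" unfolding z_def
    by (intro continuous_on_coordinatewise_then_product continuous_on_diff continuous_on_power continuous_on_const cY)
  have ne: "Y x i \<noteq> Y x j" "Y x i \<noteq> - Y x j" if "x \<in> S" "i \<noteq> j" for x i j
  proof -
    have y1: "1 \<noteq> y x a" "1 \<noteq> - y x a" "y x a \<noteq> 1" "y x a \<noteq> - 1" for a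
      using y[OF that(1)] unfolding Y_alg_def by (metis (mono_tags, lifting) mem_Collect_eq minus_minus)+
    have y2: "y x a \<noteq> y x b" "y x a \<noteq> - y x b" if "a \<noteq> b" for a b
      using y[OF \<open>x \<in> S\<close>] that by (auto simp: Y_alg_def)
    show "Y x i \<noteq> Y x j" "Y x i \<noteq> - Y x j"
      using that(2) y1 y2 by (cases i; cases j; simp add: Y_def)+
  qed
  have zinj: "inj (z x)" if "x \<in> S" for x
    using ne[OF that] unfolding z_def by (intro injI) (metis diff_add_cancel power2_eq_iff)
  have cF: "continuous_on S (\<lambda>x. (z x, -1, u x))"
    unfolding u_def by (intro continuous_on_Pair cz continuous_on_const continuous_on_coordinatewise_then_product continuous_on_mult cY)
  obtain c where c: "homotopic_on S (conf UNIV) z (\<lambda>_. c)"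
  proof (rule conf_null[OF finite cz])
    show "z x \<in> conf UNIV" if "x \<in> S" for x using zinj[OF that] by (simp add: conf_def)
  qed
  have br: "(z x, -1, u x) \<in> branched UNIV {None}" if "x \<in> S" for x
    using zinj[OF that] by (auto simp: branched_def z_def u_def power_mult_distrib) (simp add: Y_def)
  obtain k where k: "homotopic_on S (branched UNIV {None}) (\<lambda>x. (z x, -1, u x)) (\<lambda>_. k)"
    by (rule branched_null[OF finite _ cF br c]) auto
  \<comment> \<open>During the homotopy the homogenizing root no longer stays constant, so affine
    coordinates are recovered as quotients by it. Distinct squares of the roots give all
    inequalities of \<open>Y_alg\<close>; those with 1 and -1 come from comparison with
    \<open>None\<close>.\<close>
  define \<phi> where "\<phi> v = (\<lambda>i::'i. snd (snd v) (Some i) / snd (snd v) None)" for v :: "('i option \<Rightarrow> complex) \<times> complex \<times> ('i option \<Rightarrow> complex)"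
  have "continuous_on (branched UNIV {None}) \<phi>"
    unfolding \<phi>_def
  proof (rule continuous_on_coordinatewise_then_product)
    fix i :: 'i
    have c: "continuous_on (branched UNIV {None}) (\<lambda>v. snd (snd v) l)" for l :: "'i option"
      by (rule continuous_on_product_then_coordinatewise[OF continuous_on_snd[OF continuous_on_snd[OF continuous_on_id]]])
    show "continuous_on (branched UNIV {None}) (\<lambda>v. snd (snd v) (Some i) / snd (snd v) None)"
      using continuous_on_divide[of "branched UNIV {None}" "\<lambda>v. snd (snd v) (Some i)" "\<lambda>v. snd (snd v) None", OF c[of "Some i"] c[of None]]
      by (auto simp: branched_def)
  qed
  moreover have "\<phi> v \<in> Y_alg" if "v \<in> branched UNIV {None}" for v
  proof -
    obtain z p u where v: "v = (z, p, u)" by (cases v)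
    have b: "inj z" "\<And>i. (u i)\<^sup>2 = p - z i" "u None \<noteq> 0" using that by (auto simp: v branched_def)
    have ne: "u i \<noteq> u j" "u i \<noteq> - u j" if "i \<noteq> j" for i j
    proof -
      have "(u i)\<^sup>2 \<noteq> (u j)\<^sup>2" using b(1,2) that by (auto simp: inj_def)
      then show "u i \<noteq> u j" "u i \<noteq> - u j" by auto
    qed
    show ?thesis
      unfolding Y_alg_def \<phi>_def v using b(3) ne
      by (auto simp: divide_simps)
  qed
  ultimately have "homotopic_on S Y_alg (\<phi> \<circ> (\<lambda>x. (z x, -1, u x))) (\<phi> \<circ> (\<lambda>_. k))"
    by (intro homotopic_with_compose_continuous_left[OF k]) auto
  then have "homotopic_on S Y_alg y (\<lambda>_. \<phi> k)"
    by (rule homotopic_with_eq) (auto simp: \<phi>_def u_def Y_def)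
  then show ?thesis by (rule that)
qed

end

section \<open>The arrangement complement and its quotient\<close>

lemma covering_space_imp_covering_map_top:
  assumes "covering_space C p S"
  shows "covering_map_top (top_of_set C) (top_of_set S) p"
  unfolding covering_map_top_def
proof (intro conjI ballI)
  show "continuous_map (top_of_set C) (top_of_set S) p"
    using assms by (auto simp: covering_space_def)
  fix q assume "q \<in> topspace (top_of_set S)"
  then obtain T v where T: "q \<in> T" "openin (top_of_set S) T" "\<Union>v = C \<inter> p -` T" "\<forall>u\<in>v. openin (top_of_set C) u"
     "pairwise disjnt v" "\<forall>u\<in>v. \<exists>q. homeomorphism u T p q"
    using assms unfolding covering_space_def by (metis topspace_euclidean_subtopology)
  have "\<exists>s. homeomorphic_maps (subtopology (top_of_set C) u) (subtopology (top_of_set S) T) p s" if u: "u \<in> v" for u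
  proof -
    have "u \<subseteq> C" "T \<subseteq> S" using T(2,4) u openin_imp_subset by blast+
    then have "subtopology (top_of_set C) u = top_of_set u" "subtopology (top_of_set S) T = top_of_set T"
      by (auto simp: subtopology_subtopology Int_absorb1)
    moreover obtain r where "homeomorphism u T p r" using T(6) u by blast
    then have "homeomorphic_maps (top_of_set u) (top_of_set T) p r"
      by (auto simp: homeomorphism_def homeomorphic_maps_def)
    ultimately show ?thesis by auto
  qed
  then have "evenly_covered (top_of_set C) (top_of_set S) p T"
    unfolding evenly_covered_def using T by (intro conjI exI[of _ v]) auto
  then show "\<exists>U. q \<in> U \<and> evenly_covered (top_of_set C) (top_of_set S) p U" using T(1) by blast
qed

section \<open>Exponential and Cayley coordinates on the complement\<close>

definition circ :: "complex \<Rightarrow> complex" where "circ x = exp (2 * of_real pi * \<i> * x)"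

lemma circ_add: "circ (x + y) = circ x * circ y"
  by (simp add: circ_def ring_distribs exp_add)

lemma circ_nonzero [simp]: "circ x \<noteq> 0"
  by (simp add: circ_def)

lemma circ_eq_1_iff: "circ x = 1 \<longleftrightarrow> x \<in> \<int>"
proof -
  have "circ x = 1 \<longleftrightarrow> (\<exists>n::int. 2 * of_real pi * \<i> * x = 0 + of_int (2 * n) * of_real pi * \<i>)"
    unfolding circ_def using exp_eq[of "2 * of_real pi * \<i> * x" 0] by simp
  also have "\<dots> \<longleftrightarrow> (\<exists>n::int. x = of_int n)" by (auto simp: mult.commute mult.left_commute)
  finally show ?thesis by (auto simp: Ints_def)
qed

lemma circ_eq_iff: "circ x = circ y \<longleftrightarrow> x - y \<in> \<int>"
proof -
  have "circ x = circ (x - y) * circ y" using circ_add[of "x - y" y] by simp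
  then show ?thesis using circ_eq_1_iff[of "x - y"] by auto
qed

lemma Y_Bn_iff:
  "x \<in> Y_Bn \<longleftrightarrow> (\<forall>k. circ (x$k) \<noteq> 1) \<and> (\<forall>i j. i \<noteq> j \<longrightarrow> circ (x$i) \<noteq> circ (x$j) \<and> circ (x$i) * circ (x$j) \<noteq> 1)"
  by (auto simp: Y_Bn_def circ_eq_1_iff circ_eq_iff simp flip: circ_add)

text \<open>Turns the inversion of \<open>z\<close> into \<open>y -> -y\<close>, so that
  \<open>z * w = 1\<close> becomes a linear condition. The point 1 goes to infinity, and 0 and
  infinity go to 1 and -1.\<close>

definition cayley :: "complex \<Rightarrow> complex" where "cayley z = (1 + z) / (1 - z)"

definition icayley :: "complex \<Rightarrow> complex" where "icayley y = (y - 1) / (y + 1)"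

lemma icayley_cayley: "z \<noteq> 1 \<Longrightarrow> icayley (cayley z) = z"
  by (simp add: cayley_def icayley_def divide_simps)

lemma cayley_pm1: "z \<noteq> 1 \<Longrightarrow> z \<noteq> 0 \<Longrightarrow> cayley z \<noteq> 1 \<and> cayley z \<noteq> -1"
  by (auto simp: cayley_def divide_simps)

lemma cayley_eq: "z \<noteq> 1 \<Longrightarrow> w \<noteq> 1 \<Longrightarrow> cayley z = cayley w \<longleftrightarrow> z = w"
  by (metis icayley_cayley)

lemma cayley_minus: "z \<noteq> 1 \<Longrightarrow> w \<noteq> 1 \<Longrightarrow> cayley z = - cayley w \<longleftrightarrow> z * w = 1"
proof -
  assume nz: "z \<noteq> 1" "w \<noteq> 1"
  have "cayley z = - cayley w \<longleftrightarrow> (1 + z) * (1 - w) = - ((1 + w) * (1 - z))"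
    using nz by (simp add: cayley_def frac_eq_eq minus_divide_left del: minus_divide_left[symmetric])
      (simp add: algebra_simps)
  also have "\<dots> \<longleftrightarrow> 2 * (z * w) = 2 * 1" by (auto simp: algebra_simps)
  also have "\<dots> \<longleftrightarrow> z * w = 1" by simp
  finally show ?thesis .
qed

lemma icayley_eq: "y \<noteq> -1 \<Longrightarrow> y' \<noteq> -1 \<Longrightarrow> icayley y = icayley y' \<longleftrightarrow> y = y'"
proof -
  assume nz: "y \<noteq> -1" "y' \<noteq> -1"
  then have "y + 1 \<noteq> 0" "y' + 1 \<noteq> 0" by (auto simp: add_eq_0_iff2)
  then have "icayley y = icayley y' \<longleftrightarrow> (y - 1) * (y' + 1) = (y' - 1) * (y + 1)"
    by (simp add: icayley_def frac_eq_eq)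
  also have "\<dots> \<longleftrightarrow> 2 * y = 2 * y'" by (auto simp: algebra_simps)
  finally show ?thesis by simp
qed

lemma icayley_mult: "y \<noteq> -1 \<Longrightarrow> y' \<noteq> -1 \<Longrightarrow> icayley y * icayley y' = 1 \<longleftrightarrow> y = - y'"
proof -
  assume nz: "y \<noteq> -1" "y' \<noteq> -1"
  then have "y + 1 \<noteq> 0" "y' + 1 \<noteq> 0" by (auto simp: add_eq_0_iff2)
  then have "icayley y * icayley y' = 1 \<longleftrightarrow> (y - 1) * (y' - 1) = (y + 1) * (y' + 1)"
    by (simp add: icayley_def)
  also have "\<dots> \<longleftrightarrow> 2 * (y + y') = 0" by (auto simp: algebra_simps)
  finally show ?thesis by (simp add: add_eq_0_iff2)
qed

lemma icayley_neq: "y \<noteq> 1 \<Longrightarrow> y \<noteq> -1 \<Longrightarrow> icayley y \<noteq> 0 \<and> icayley y \<noteq> 1"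
  by (auto simp: icayley_def divide_simps add_eq_0_iff2)

lemma continuous_on_vec: 
  fixes f :: "'a::topological_space \<Rightarrow> complex ^ 'n"
  assumes "continuous_on A f" shows "continuous_on A (\<lambda>x. f x $ i)"
  using assms unfolding continuous_on_def by (blast intro: tendsto_vec_nth)

text \<open>The contraction in \<open>Y_alg\<close> is carried back to exponentials by
  \<open>icayley\<close> and then lifted through \<open>exp\<close>, one coordinate at a time,
  beginning with the given map. Each coordinate avoids 0 because \<open>y = 1\<close> is
  excluded.\<close>

lemma (in aspherical_test) Y_Bn_null:
  fixes f :: "'a \<Rightarrow> complex ^ 'n"
  assumes cf: "continuous_on S f" and f: "\<And>x. x \<in> S \<Longrightarrow> f x \<in> Y_Bn" and Sne: "S \<noteq> {}"
  obtains c where "c \<in> Y_Bn" "homotopic_on S Y_Bn f (\<lambda>_. c)"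
proof -
  have fne: "circ (f x $ k) \<noteq> 1" if "x \<in> S" for x k using f[OF that] unfolding Y_Bn_iff by blast
  have fne2: "circ (f x $ i) \<noteq> circ (f x $ j)" "circ (f x $ i) * circ (f x $ j) \<noteq> 1" if "x \<in> S" "i \<noteq> j" for x i j
    using f[OF that(1)] that(2) unfolding Y_Bn_iff by blast+
  define y where "y x i = cayley (circ (f x $ i))" for x i
  have "continuous_on S (\<lambda>x. y x i)" for i
    unfolding y_def cayley_def
  proof (rule continuous_on_divide)
    have "continuous_on S (\<lambda>x. circ (f x $ i))" unfolding circ_def
      by (intro continuous_on_exp continuous_on_mult continuous_on_const continuous_on_vec cf)
    then show "continuous_on S (\<lambda>x. 1 + circ (f x $ i))" "continuous_on S (\<lambda>x. 1 - circ (f x $ i))"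
      by (intro continuous_on_add continuous_on_diff continuous_on_const; assumption)+
    show "\<forall>x\<in>S. 1 - circ (f x $ i) \<noteq> 0" using fne by auto
  qed
  then have cy: "continuous_on S y" by (rule continuous_on_coordinatewise_then_product)
  have yY: "y x \<in> Y_alg" if "x \<in> S" for x
    unfolding Y_alg_def y_def using fne[OF that] fne2[OF that] cayley_pm1 cayley_eq cayley_minus by simp
  obtain k where k: "homotopic_on S Y_alg y (\<lambda>_. k)" by (rule Y_alg_null[OF cy yY])
  obtain H where H: "continuous_on ({0..1::real} \<times> S) H" "\<And>w. w \<in> {0..1} \<times> S \<Longrightarrow> H w \<in> Y_alg"
    "\<And>x. x \<in> S \<Longrightarrow> H (0, x) = y x" "\<And>x. x \<in> S \<Longrightarrow> H (1, x) = k"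
    using k by (rule homotopic_onE) blast
  have Hn: "H w i \<noteq> 1" "H w i \<noteq> -1" if "w \<in> {0..1} \<times> S" for w i using H(2)[OF that] by (auto simp: Y_alg_def)
  have Hn2: "H w i \<noteq> H w j" "H w i \<noteq> - H w j" if "w \<in> {0..1} \<times> S" "i \<noteq> j" for w i j
    using H(2)[OF that(1)] that(2) by (auto simp: Y_alg_def)
  define Z where "Z i w = icayley (H w i)" for i w
  note cov = covering_space_imp_covering_map_top[OF covering_space_exp_punctured_plane]
  have "\<exists>G. continuous_on ({0..1} \<times> S) G \<and> (\<forall>x\<in>S. G (0, x) = 2 * of_real pi * \<i> * (f x $ i)) \<and>
      (\<forall>w\<in>{0..1} \<times> S. exp (G w) = Z i w) \<and> (\<exists>d. \<forall>x\<in>S. G (1, x) = d)" for i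
  proof -
    have "continuous_on ({0..1} \<times> S) (Z i)"
      unfolding Z_def icayley_def
    proof (rule continuous_on_divide)
      have "continuous_on ({0..1} \<times> S) (\<lambda>w. H w i)" by (rule continuous_on_product_then_coordinatewise[OF H(1)])
      then show "continuous_on ({0..1} \<times> S) (\<lambda>w. H w i - 1)" "continuous_on ({0..1} \<times> S) (\<lambda>w. H w i + 1)"
        by (intro continuous_on_add continuous_on_diff continuous_on_const; assumption)+
      show "\<forall>w\<in>{0..1} \<times> S. H w i + 1 \<noteq> 0" using Hn(2) by (auto simp: add_eq_0_iff2)
    qed
    moreover have "Z i w \<noteq> 0" if "w \<in> {0..1} \<times> S" for w using icayley_neq Hn[OF that] by (simp add: Z_def)
    ultimately have cZ: "continuous_map (top_of_set ({0..1} \<times> S)) (top_of_set (- {0})) (Z i)" by auto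
    have cf2: "continuous_map (top_of_set S) (top_of_set UNIV) (\<lambda>x. 2 * of_real pi * \<i> * (f x $ i))"
      by (auto intro!: continuous_on_mult continuous_on_const continuous_on_vec cf)
    have st: "exp (2 * of_real pi * \<i> * (f x $ i)) = Z i (0, x)" if "x \<in> S" for x
      using H(3)[OF that] icayley_cayley[OF fne[OF that, of i]] by (simp add: Z_def y_def circ_def)
    obtain G where G: "continuous_map (top_of_set ({0..1} \<times> S)) (top_of_set UNIV) G"
      "\<And>x. x \<in> S \<Longrightarrow> G (0, x) = 2 * of_real pi * \<i> * (f x $ i)"
      "\<And>w. w \<in> {0..1} \<times> S \<Longrightarrow> exp (G w) = Z i w"
      by (rule covering_map_top_lift_homotopy[OF cov compact_S cZ cf2 st]) blast+
    have cG: "continuous_on ({0..1} \<times> S) G" using G(1) by simp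
    obtain x1 where x1: "x1 \<in> S" using Sne by blast
    \<comment> \<open>The homotopy ends at a constant, and a lift of a constant map on the connected
      \<open>S\<close> is constant; otherwise only a map into a discrete fiber would be
      reached.\<close>
    have "G (1, x) = G (1, x1)" if x: "x \<in> S" for x
    proof (rule covering_map_top_lift_unique[OF cov, where C = "top_of_set S" and a = x1 and g = "\<lambda>x. G (1, x)" and h = "\<lambda>_. G (1, x1)"])
      show "connected_space (top_of_set S)" using connected_S by (simp add: connected_space_subtopology)
      show "continuous_map (top_of_set S) (top_of_set UNIV) (\<lambda>x. G (1, x))"
      proof -
        have "continuous_on S (\<lambda>x. G (1, x))"
          by (rule continuous_on_compose2[OF cG]) (auto intro!: continuous_on_Pair continuous_on_const continuous_on_id)
        then show ?thesis by simp
      qed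
      show "exp (G (1, x)) = exp (G (1, x1))" if "x \<in> topspace (top_of_set S)" for x
        using G(3) that x1 H(4) by (simp add: Z_def)
    qed (use x x1 in auto)
    then show ?thesis using cG G(2,3) by blast
  qed
  then obtain G d where G: "\<And>i. continuous_on ({0..1} \<times> S) (G i)" "\<And>i x. x \<in> S \<Longrightarrow> G i (0, x) = 2 * of_real pi * \<i> * (f x $ i)"
    "\<And>i w. w \<in> {0..1} \<times> S \<Longrightarrow> exp (G i w) = Z i w" "\<And>i x. x \<in> S \<Longrightarrow> G i (1, x) = d i" by metis
  define X :: "real \<times> 'a \<Rightarrow> complex ^ 'n" where "X w = (\<chi> i. G i w / (2 * of_real pi * \<i>))" for w
  have cX: "continuous_on ({0..1} \<times> S) X"
    unfolding X_def by (intro continuous_on_vec_lambda continuous_on_divide G(1) continuous_on_const) simp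
  have XY: "X w \<in> Y_Bn" if w: "w \<in> {0..1} \<times> S" for w
  proof -
    have "circ (X w $ i) = Z i w" for i using G(3)[OF w, of i] by (simp add: circ_def X_def)
    then show ?thesis
      unfolding Y_Bn_iff Z_def using Hn[OF w] Hn2[OF w] icayley_neq icayley_eq icayley_mult by simp
  qed
  have X1: "X (1, x) = (\<chi> i. d i / (2 * of_real pi * \<i>))" if "x \<in> S" for x using G(4)[OF that] by (simp add: X_def)
  obtain x1 where x1: "x1 \<in> S" using Sne by blast
  show ?thesis
  proof (rule that)
    show "(\<chi> i. d i / (2 * of_real pi * \<i>)) \<in> Y_Bn" using XY[of "(1, x1)"] X1[OF x1] x1 by simp
    show "homotopic_on S Y_Bn f (\<lambda>_. \<chi> i. d i / (2 * of_real pi * \<i>))"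
      by (rule homotopic_onI[OF cX XY]) (use X1 G(2) in \<open>auto simp: X_def vec_eq_iff\<close>)
  qed
qed

lemma aspherical_test_sph: "k \<ge> 2 \<Longrightarrow> aspherical_test (sph k)"
  using compact_sph connected_sph[of "k - 1"] locally_connected_sph sign_selection_sph by unfold_locales auto

lemma countable_affine_Ints:
  assumes "\<alpha> \<notin> \<int>" shows "countable {t::complex. \<alpha> + t * \<beta> \<in> \<int>}"
proof (cases "\<beta> = 0")
  case True
  then show ?thesis using assms by simp
next
  case False
  have "{t. \<alpha> + t * \<beta> \<in> \<int>} \<subseteq> range (\<lambda>n::int. (of_int n - \<alpha>) / \<beta>)"
  proof
    fix t assume "t \<in> {t. \<alpha> + t * \<beta> \<in> \<int>}"
    then obtain n where "\<alpha> + t * \<beta> = of_int n" by (auto simp: Ints_def)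
    then have "t = (of_int n - \<alpha>) / \<beta>" using False by (simp add: field_simps)
    then show "t \<in> range (\<lambda>n::int. (of_int n - \<alpha>) / \<beta>)" by blast
  qed
  then show ?thesis by (rule countable_subset) simp
qed

text \<open>On the complex line through \<open>a\<close> and \<open>b\<close>, each of the finitely
  many affine functions concerned is integral at countably many parameters only, since it is not
  integral at \<open>a\<close>. The plane without a countable set is path connected.\<close>

lemma path_connected_Y_Bn: "path_connected (Y_Bn :: (complex ^ 'n) set)"
  unfolding path_connected_component
proof (intro ballI)
  fix a b :: "complex ^ 'n" assume a: "a \<in> Y_Bn" and b: "b \<in> Y_Bn"
  define g where "g t = (\<chi> i. a$i + t * (b$i - a$i))" for t
  have bad: "countable {t. g t \<notin> Y_Bn}"
  proof -
    have "{t. g t \<notin> Y_Bn} \<subseteq> (\<Union>k. {t. a$k + t * (b$k - a$k) \<in> \<int>}) \<union>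
       (\<Union>i. \<Union>j\<in>- {i}. {t. (a$i + a$j) + t * ((b$i - a$i) + (b$j - a$j)) \<in> \<int>} \<union> {t. (a$i - a$j) + t * ((b$i - a$i) - (b$j - a$j)) \<in> \<int>})"
      by (auto simp: Y_Bn_def g_def algebra_simps)
    moreover have "countable \<dots>"
      using a by (intro countable_Un countable_UN countable_affine_Ints) (auto simp: Y_Bn_def)
    ultimately show ?thesis by (rule countable_subset)
  qed
  have "path_connected (- {t. g t \<notin> Y_Bn})" by (rule path_connected_complement_countable[OF _ bad]) simp
  moreover have "continuous_on (- {t. g t \<notin> Y_Bn}) g"
    unfolding g_def by (intro continuous_on_vec_lambda continuous_intros)
  ultimately have "path_connected (g ` (- {t. g t \<notin> Y_Bn}))" by (rule path_connected_continuous_image[rotated])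
  moreover have "g 0 = a" "g 1 = b" by (simp_all add: g_def vec_eq_iff)
  then have "a \<in> g ` (- {t. g t \<notin> Y_Bn})" "b \<in> g ` (- {t. g t \<notin> Y_Bn})" using a b by (force simp: image_iff)+
  ultimately have "path_component (g ` (- {t. g t \<notin> Y_Bn})) a b" unfolding path_connected_component by blast
  then show "path_component Y_Bn a b" by (rule path_component_of_subset[rotated]) auto
qed

section \<open>The affine Weyl group and its action\<close>

lemma W_BnE:
  assumes "w \<in> W_Bn"
  obtains p e t where "p permutes UNIV" "\<And>i. e i = 1 \<or> e i = -1" "even (\<Sum>i\<in>UNIV. t i)"
    "w = (\<lambda>x. \<chi> i. of_int (e i) * x $ (p i) + of_int (t i))"
  using assms unfolding W_Bn_def by blast

lemma W_BnI:
  assumes "p permutes UNIV" "\<And>i. e i = 1 \<or> e i = -1" "even (\<Sum>i\<in>UNIV. t i)"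
    "\<And>x i. w x $ i = of_int (e i) * x $ (p i) + of_int (t i)"
  shows "w \<in> (W_Bn :: (complex ^ 'n \<Rightarrow> complex ^ 'n) set)"
proof -
  have "w = (\<lambda>x. \<chi> i. of_int (e i) * x $ (p i) + of_int (t i))" using assms(4) by (simp add: fun_eq_iff vec_eq_iff)
  then show ?thesis unfolding W_Bn_def using assms(1-3) by blast
qed

lemma even_signed_sum:
  fixes e t :: "'i \<Rightarrow> int"
  assumes "\<And>i. e i = 1 \<or> e i = -1"
  shows "even (\<Sum>i\<in>A. e i * t i) \<longleftrightarrow> even (\<Sum>i\<in>A. t i)"
proof -
  have "even (e i * t i - t i)" for i using assms[of i] by auto
  then have "even (\<Sum>i\<in>A. e i * t i - t i)" by (intro dvd_sum) auto
  then have "even ((\<Sum>i\<in>A. e i * t i) - (\<Sum>i\<in>A. t i))" by (simp add: sum_subtractf)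
  then show ?thesis by simp
qed

lemma W_Bn_id: "(\<lambda>x. x) \<in> W_Bn"
  by (rule W_BnI[where p = id and e = "\<lambda>_. 1" and t = "\<lambda>_. 0"]) (auto simp: permutes_id)

lemma W_Bn_comp:
  assumes "v \<in> W_Bn" "w \<in> W_Bn" shows "(\<lambda>x. v (w x)) \<in> (W_Bn :: (complex ^ 'n \<Rightarrow> complex ^ 'n) set)"
proof -
  obtain p e t where v: "p permutes UNIV" "\<And>i. e i = 1 \<or> e i = -1" "even (\<Sum>i\<in>UNIV. t i)"
    "v = (\<lambda>x. \<chi> i. of_int (e i) * x $ (p i) + of_int (t i))" using assms(1) by (rule W_BnE) blast
  obtain q d s where w: "q permutes UNIV" "\<And>i. d i = 1 \<or> d i = -1" "even (\<Sum>i\<in>UNIV. s i)"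
    "w = (\<lambda>x. \<chi> i. of_int (d i) * x $ (q i) + of_int (s i))" using assms(2) by (rule W_BnE) blast
  show ?thesis
  proof (rule W_BnI[where p = "q \<circ> p" and e = "\<lambda>i. e i * d (p i)" and t = "\<lambda>i. e i * s (p i) + t i"])
    show "q \<circ> p permutes UNIV" by (rule permutes_compose[OF v(1) w(1)])
    show "e i * d (p i) = 1 \<or> e i * d (p i) = -1" for i using v(2)[of i] w(2)[of "p i"] by auto
    have "(\<Sum>i\<in>UNIV. s (p i)) = (\<Sum>i\<in>UNIV. s i)" using sum.permute[OF v(1), of s] by (simp add: o_def)
    then have "even (\<Sum>i\<in>UNIV. e i * s (p i))" using even_signed_sum[where e = e and A = UNIV and t = "\<lambda>i. s (p i)", OF v(2)] w(3) by simp
    then show "even (\<Sum>i\<in>UNIV. e i * s (p i) + t i)" using v(3) by (simp add: sum.distrib)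
    show "v (w x) $ i = of_int (e i * d (p i)) * x $ ((q \<circ> p) i) + of_int (e i * s (p i) + t i)" for x i
      by (simp add: v(4) w(4) algebra_simps)
  qed
qed

lemma W_Bn_inverse:
  assumes "w \<in> W_Bn"
  obtains w' where "w' \<in> (W_Bn :: (complex ^ 'n \<Rightarrow> complex ^ 'n) set)" "\<And>x. w' (w x) = x" "\<And>x. w (w' x) = x"
proof -
  obtain p e t where w: "p permutes UNIV" "\<And>i. e i = 1 \<or> e i = -1" "even (\<Sum>i\<in>UNIV. t i)"
    "w = (\<lambda>x. \<chi> i. of_int (e i) * x $ (p i) + of_int (t i))" using assms by (rule W_BnE) blast
  let ?q = "inv p"
  have q: "?q permutes UNIV" by (rule permutes_inv[OF w(1)])
  have pq: "p (?q i) = i" "?q (p i) = i" for i using permutes_inverses[OF w(1)] by auto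
  have e2: "of_int (e i) * (of_int (e i) * z) = (z::complex)" for i z using w(2)[of i] by auto
  define w' :: "complex ^ 'n \<Rightarrow> complex ^ 'n" where "w' x = (\<chi> i. of_int (e (?q i)) * x $ (?q i) + of_int (e (?q i) * - t (?q i)))" for x
  show ?thesis
  proof (rule that)
    show "w' \<in> W_Bn"
    proof (rule W_BnI[where p = ?q and e = "\<lambda>i. e (?q i)" and t = "\<lambda>i. e (?q i) * - t (?q i)"])
      have "(\<Sum>i\<in>UNIV. t (?q i)) = (\<Sum>i\<in>UNIV. t i)" using sum.permute[OF q, of t] by (simp add: o_def)
      then have "even (\<Sum>i\<in>UNIV. - t (?q i))" using w(3) by (simp add: sum_negf)
      then show "even (\<Sum>i\<in>UNIV. e (?q i) * - t (?q i))" using even_signed_sum[where e = "\<lambda>i. e (?q i)" and A = UNIV and t = "\<lambda>i. - t (?q i)"] w(2) by simp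
    qed (use q w(2) in \<open>auto simp: w'_def\<close>)
    show "w' (w x) = x" for x
      by (simp add: w'_def w(4) vec_eq_iff pq ring_distribs e2)
    show "w (w' x) = x" for x
      by (simp add: w'_def w(4) vec_eq_iff pq ring_distribs e2)
  qed
qed

lemma W_orbit_eq_iff: "W_orbit x = W_orbit y \<longleftrightarrow> (\<exists>w\<in>W_Bn. y = w x)"
proof
  assume "W_orbit x = W_orbit y"
  moreover have "y \<in> W_orbit y" unfolding W_orbit_def using W_Bn_id by (metis (no_types, lifting) image_eqI)
  ultimately show "\<exists>w\<in>W_Bn. y = w x" by (auto simp: W_orbit_def)
next
  assume "\<exists>w\<in>W_Bn. y = w x"
  then obtain w where w: "w \<in> W_Bn" "y = w x" by blast
  obtain w' where w': "w' \<in> W_Bn" "\<And>x. w' (w x) = x" by (rule W_Bn_inverse[OF w(1)]) blast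
  have "v x \<in> W_orbit y" if "v \<in> W_Bn" for v
    unfolding W_orbit_def by (rule image_eqI[OF _ W_Bn_comp[OF that w'(1)]]) (simp add: w(2) w'(2))
  moreover have "v y \<in> W_orbit x" if "v \<in> W_Bn" for v
    unfolding W_orbit_def by (rule image_eqI[OF _ W_Bn_comp[OF that w(1)]]) (simp add: w(2))
  ultimately show "W_orbit x = W_orbit y" by (auto simp: W_orbit_def)
qed

lemma continuous_on_W_Bn: "w \<in> W_Bn \<Longrightarrow> continuous_on A w"
  by (erule W_BnE) (auto intro!: continuous_on_vec_lambda continuous_intros)

text \<open>In exponential coordinates translations disappear and sign changes become inversions,
  under which the conditions in \<open>Y_Bn_iff\<close> are symmetric.\<close>

lemma W_Bn_Y_Bn:
  assumes "w \<in> W_Bn" "x \<in> Y_Bn" shows "w x \<in> Y_Bn"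
proof -
  obtain p e t where w: "p permutes UNIV" "\<And>i. e i = 1 \<or> e i = -1"
    "w = (\<lambda>x. \<chi> i. of_int (e i) * x $ (p i) + of_int (t i))" using assms(1) by (rule W_BnE) blast
  have c: "circ (w x $ i) = (if e i = 1 then circ (x $ p i) else inverse (circ (x $ p i)))" for i
  proof -
    have "circ (w x $ i) = circ (of_int (e i) * x $ p i)" unfolding circ_eq_iff w(3) by simp
    moreover have "circ (- z) = inverse (circ z)" for z by (simp add: circ_def exp_minus)
    ultimately show ?thesis using w(2)[of i] by auto
  qed
  have pe: "p i = p j \<longleftrightarrow> i = j" for i j using permutes_inj[OF w(1)] by (auto simp: inj_def)
  have n1: "circ (x $ i) \<noteq> 1" for i using assms(2) unfolding Y_Bn_iff by blast
  have n2: "circ (x $ p i) \<noteq> circ (x $ p j)" "circ (x $ p i) * circ (x $ p j) \<noteq> 1" if "i \<noteq> j" for i j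
    using assms(2) that unfolding Y_Bn_iff pe[symmetric, of i j] by blast+
  show ?thesis
    unfolding Y_Bn_iff c using n1 n2 by (auto simp: field_simps)
qed

text \<open>Discreteness and freeness together. If \<open>w\<close> moves \<open>x\<close> very
  little, then \<open>of_int (e i) * x $ (p i) - x $ i\<close> is an integer for every
  \<open>i\<close>. For \<open>x\<close> in the complement this forces \<open>p i = i\<close>, and a
  sign -1 only at a half-integral coordinate, with \<open>t i\<close> odd. It is the parity
  condition on the translations that excludes this last case.\<close>

lemma W_Bn_discrete:
  fixes x :: "complex ^ 'n"
  assumes x: "x \<in> Y_Bn"
  obtains \<delta> where "\<delta> > 0" "\<And>w. w \<in> W_Bn \<Longrightarrow> (\<And>i. norm (w x $ i - x $ i) < \<delta>) \<Longrightarrow> w = (\<lambda>y. y)"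
proof -
  let ?C = "range (\<lambda>(i, j). x $ i - x $ j) \<union> range (\<lambda>(i, j). - x $ i - x $ j)"
  have "\<exists>r>0. c \<notin> \<int> \<longrightarrow> (\<forall>n::int. r \<le> norm (c - of_int n))" for c :: complex
  proof (cases "c \<in> \<int>")
    case False
    moreover have "open (- (\<int> :: complex set))" by (simp add: open_Compl)
    ultimately obtain r where "r > 0" "ball c r \<subseteq> - \<int>" by (meson ComplI open_contains_ball)
    moreover have "r \<le> norm (c - of_int n)" for n
    proof (rule ccontr)
      assume "\<not> r \<le> norm (c - of_int n)"
      then have "of_int n \<in> ball c r" by (simp add: dist_norm)
      then show False using \<open>ball c r \<subseteq> - \<int>\<close> by auto
    qed
    ultimately show ?thesis by blast
  qed (auto intro: exI[of _ 1])
  then obtain r where r: "\<And>c. r c > 0" "\<And>c n. c \<notin> \<int> \<Longrightarrow> r c \<le> norm (c - of_int n :: complex)" by metis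
  define \<delta> where "\<delta> = Min (insert 1 (r ` ?C))"
  have fin: "finite (insert 1 (r ` ?C))" by simp
  \<comment> \<open>The bound 1 serves later: an integer of norm less than \<delta> is 0.\<close>
  have \<delta>: "\<delta> > 0" "\<delta> \<le> 1" unfolding \<delta>_def using fin r(1) by (subst Min_gr_iff; force) (intro Min_le; simp)
  have \<delta>r: "\<delta> \<le> r c" if "c \<in> ?C" for c unfolding \<delta>_def using fin that by (intro Min_le) auto
  show ?thesis
  proof (rule that[OF \<delta>(1)])
    fix w assume w: "w \<in> W_Bn" and close: "\<And>i. norm (w x $ i - x $ i) < \<delta>"
    obtain p e t where w: "p permutes UNIV" "\<And>i. e i = 1 \<or> e i = -1" "even (\<Sum>i\<in>UNIV. t i)"
      "w = (\<lambda>x. \<chi> i. of_int (e i) * x $ (p i) + of_int (t i))" using w by (rule W_BnE) blast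
    have key: "of_int (e i) * x $ (p i) - x $ i \<in> \<int>" for i
    proof (rule ccontr)
      let ?c = "of_int (e i) * x $ (p i) - x $ i"
      assume "?c \<notin> \<int>"
      then have "r ?c \<le> norm (?c - of_int (- t i))" by (rule r(2))
      moreover have "?c \<in> ?C"
      proof (cases "e i = 1")
        case True
        then show ?thesis using rangeI[of "\<lambda>(i, j). x $ i - x $ j" "(p i, i)"] by simp
      next
        case False
        then have "e i = -1" using w(2)[of i] by blast
        then show ?thesis using rangeI[of "\<lambda>(i, j). - x $ i - x $ j" "(p i, i)"] by simp
      qed
      ultimately have "\<delta> \<le> norm (?c - of_int (- t i))" using \<delta>r by (meson order_trans)
      moreover have "?c - of_int (- t i) = w x $ i - x $ i" by (simp add: w(4))
      ultimately have "\<delta> \<le> norm (w x $ i - x $ i)" by (simp only:)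
      then show False using close[of i] by linarith
    qed
    have xn: "x $ i \<notin> \<int>" for i using x by (auto simp: Y_Bn_def)
    have xd: "x $ i + x $ j \<notin> \<int>" "x $ i - x $ j \<notin> \<int>" if "i \<noteq> j" for i j using x that by (auto simp: Y_Bn_def)
    have p: "p i = i" for i
    proof (rule ccontr)
      assume ne: "p i \<noteq> i"
      have "- (x $ p i) - x $ i \<in> \<int> \<Longrightarrow> x $ p i + x $ i \<in> \<int>"
        using Ints_minus[of "- (x $ p i) - x $ i"] by (simp add: add.commute)
      then show False using key[of i] xd[OF ne] w(2)[of i] by auto
    qed
    have int0: "of_int (e i) * x $ i - x $ i + of_int (t i) = 0" for i
    proof -
      obtain n where n: "of_int (e i) * x $ i - x $ i = of_int n" using key[of i] p by (auto simp: Ints_def)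
      have "norm (of_int (n + t i) :: complex) < 1" using close[of i] \<delta>(2) n by (simp add: w(4) p algebra_simps)
      then have "n + t i = 0" by (simp only: norm_of_int)
      then show ?thesis unfolding n by (metis of_int_0 of_int_add)
    qed
    have pos: "t i = 0" if "e i = 1" for i using int0[of i] that by simp
    have neg: "of_int (t i) = 2 * x $ i" if "e i = -1" for i using int0[of i] that by (simp add: algebra_simps)
    have odd: "odd (t i)" if ei: "e i = -1" for i
    proof
      assume "even (t i)"
      then obtain m where "t i = 2 * m" by (elim evenE)
      then have "x $ i = of_int m" using neg[OF ei] by simp
      then show False using xn[of i] by simp
    qed
    \<comment> \<open>A second sign change at \<open>j\<close> would make \<open>x $ j - x $ i\<close> an integer; a single one makes the sum of the \<open>t i\<close> odd.\<close>
    have "e i = 1" for i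
    proof (rule ccontr)
      assume "e i \<noteq> 1"
      then have ei: "e i = -1" using w(2)[of i] by blast
      have "t j = 0" if ji: "j \<noteq> i" for j
      proof (rule ccontr)
        assume "t j \<noteq> 0"
        then have ej: "e j = -1" using pos[of j] w(2)[of j] by blast
        have "even (t j - t i)" using odd[OF ei] odd[OF ej] by simp
        then obtain m where "t j - t i = 2 * m" by (elim evenE)
        then have "of_int (t j) - of_int (t i) = (2 * of_int m :: complex)" by (metis of_int_diff of_int_mult of_int_numeral)
        then have "2 * (x $ j - x $ i) = 2 * of_int m" unfolding neg[OF ei] neg[OF ej] by (simp only: right_diff_distrib)
        then have "x $ j - x $ i = of_int m" by (simp only: mult_cancel_left) simp
        then show False using xd(2)[OF ji] by simp
      qed
      then have "(\<Sum>j\<in>UNIV. t j) = t i" by (subst sum.remove[of UNIV i]) auto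
      then show False using w(3) odd[OF ei] by simp
    qed
    then show "w = (\<lambda>y. y)" using pos p by (simp add: w(4) fun_eq_iff vec_eq_iff)
  qed
qed

text \<open>Up to signs \<open>w\<close> permutes the coordinates of differences, so it moves
  \<open>x\<close> nearly to where it moves \<open>v\<close>; half of the radius from
  \<open>W_Bn_discrete\<close> absorbs both errors.\<close>

lemma W_Bn_wandering:
  fixes x :: "complex ^ 'n"
  assumes x: "x \<in> Y_Bn"
  obtains \<epsilon> where "\<epsilon> > 0" "\<And>w v. w \<in> W_Bn \<Longrightarrow> v \<in> ball x \<epsilon> \<Longrightarrow> w v \<in> ball x \<epsilon> \<Longrightarrow> w = (\<lambda>y. y)"
proof -
  obtain \<delta> where \<delta>: "\<delta> > 0" "\<And>w. w \<in> W_Bn \<Longrightarrow> (\<And>i. norm (w x $ i - x $ i) < \<delta>) \<Longrightarrow> w = (\<lambda>y. y)"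
    by (rule W_Bn_discrete[OF x]) blast
  show ?thesis
  proof (rule that[of "\<delta> / 2"])
    show "0 < \<delta> / 2" using \<delta> by simp
    fix w v assume w: "w \<in> W_Bn" and v: "v \<in> ball x (\<delta> / 2)" "w v \<in> ball x (\<delta> / 2)"
    show "w = (\<lambda>y. y)"
    proof (rule \<delta>(2)[OF w])
      fix i
      obtain p e t where wd: "\<And>i. e i = 1 \<or> e i = -1" "w = (\<lambda>x. \<chi> i. of_int (e i) * x $ (p i) + of_int (t i))" using w by (rule W_BnE) blast
      have "w x $ i - w v $ i = of_int (e i) * ((x - v) $ p i)" by (simp add: wd(2) right_diff_distrib)
      then have "norm (w x $ i - w v $ i) = norm ((x - v) $ p i)" using wd(1)[of i] by (auto simp: norm_mult)
      also have "\<dots> \<le> norm (x - v)" by (rule Finite_Cartesian_Product.norm_nth_le)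
      also have "\<dots> < \<delta> / 2" using v(1) by (simp add: dist_norm)
      finally have 1: "norm (w x $ i - w v $ i) < \<delta> / 2" .
      have "norm (w v $ i - x $ i) \<le> norm (w v - x)" using Finite_Cartesian_Product.norm_nth_le[of "w v - x" i] by simp
      also have "\<dots> < \<delta> / 2" using v(2) by (simp add: dist_norm norm_minus_commute)
      finally have 2: "norm (w v $ i - x $ i) < \<delta> / 2" .
      show "norm (w x $ i - x $ i) < \<delta>"
        using norm_triangle_ineq[of "w x $ i - w v $ i" "w v $ i - x $ i"] 1 2 by simp
    qed
  qed
qed

section \<open>The quotient topology and the covering by the complement\<close>

lemma openin_X_Bn:
  "openin (X_Bn :: (complex ^ 'n) set topology) U \<longleftrightarrow> U \<subseteq> W_orbit ` Y_Bn \<and> openin (top_of_set Y_Bn) {x \<in> Y_Bn. W_orbit x \<in> U}"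
proof -
  have "istopology (\<lambda>U :: (complex ^ 'n) set set. U \<subseteq> W_orbit ` Y_Bn \<and> openin (top_of_set Y_Bn) {x \<in> Y_Bn. W_orbit x \<in> U})"
    unfolding istopology_def
  proof (intro conjI allI impI)
    fix U V :: "(complex ^ 'n) set set"
    assume U: "U \<subseteq> W_orbit ` Y_Bn \<and> openin (top_of_set Y_Bn) {x \<in> Y_Bn. W_orbit x \<in> U}"
      and V: "V \<subseteq> W_orbit ` Y_Bn \<and> openin (top_of_set Y_Bn) {x \<in> Y_Bn. W_orbit x \<in> V}"
    show "U \<inter> V \<subseteq> W_orbit ` Y_Bn" using U by blast
    have "{x \<in> Y_Bn. W_orbit x \<in> U \<inter> V} = {x \<in> Y_Bn. W_orbit x \<in> U} \<inter> {x \<in> Y_Bn. W_orbit x \<in> V}" by blast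
    then show "openin (top_of_set Y_Bn) {x \<in> Y_Bn. W_orbit x \<in> U \<inter> V}" using U V by (simp add: openin_Int)
  next
    fix \<K> :: "(complex ^ 'n) set set set"
    assume K: "\<forall>K\<in>\<K>. K \<subseteq> W_orbit ` Y_Bn \<and> openin (top_of_set Y_Bn) {x \<in> Y_Bn. W_orbit x \<in> K}"
    then show "\<Union>\<K> \<subseteq> W_orbit ` Y_Bn" by blast
    have "{x \<in> Y_Bn. W_orbit x \<in> \<Union>\<K>} = (\<Union>K\<in>\<K>. {x \<in> Y_Bn. W_orbit x \<in> K})" by blast
    then show "openin (top_of_set Y_Bn) {x \<in> Y_Bn. W_orbit x \<in> \<Union>\<K>}" using K by auto
  qed
  then show ?thesis unfolding X_Bn_def by (simp add: topology_inverse')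
qed

lemma topspace_X_Bn: "topspace (X_Bn :: (complex ^ 'n) set topology) = W_orbit ` Y_Bn"
proof
  show "topspace (X_Bn :: (complex ^ 'n) set topology) \<subseteq> W_orbit ` Y_Bn" using openin_X_Bn openin_topspace by blast
  have "{x \<in> Y_Bn. W_orbit x \<in> W_orbit ` Y_Bn} = (Y_Bn :: (complex ^ 'n) set)" by blast
  then have "openin (X_Bn :: (complex ^ 'n) set topology) (W_orbit ` Y_Bn)" by (simp add: openin_X_Bn)
  then show "W_orbit ` Y_Bn \<subseteq> topspace (X_Bn :: (complex ^ 'n) set topology)" by (rule openin_subset)
qed

lemma continuous_map_W_orbit: "continuous_map (top_of_set Y_Bn) (X_Bn :: (complex ^ 'n) set topology) W_orbit"
  unfolding continuous_map_def topspace_X_Bn using openin_X_Bn by auto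

lemma openin_W_Bn_image:
  fixes T :: "(complex ^ 'n) set"
  assumes T: "openin (top_of_set Y_Bn) T" and w: "w \<in> W_Bn" shows "openin (top_of_set Y_Bn) (w ` T)"
proof -
  obtain w' where w': "w' \<in> W_Bn" "\<And>x. w' (w x) = x" "\<And>x. w (w' x) = x" by (rule W_Bn_inverse[OF w]) blast
  have TY: "T \<subseteq> Y_Bn" using T openin_imp_subset by blast
  have "w ` T = Y_Bn \<inter> w' -` T"
  proof (intro equalityI subsetI)
    fix y assume "y \<in> w ` T"
    then show "y \<in> Y_Bn \<inter> w' -` T" using W_Bn_Y_Bn[OF w] TY w'(2) by auto
  next
    fix y assume "y \<in> Y_Bn \<inter> w' -` T"
    then show "y \<in> w ` T" using w'(3)[of y] by (metis IntD2 image_eqI vimageD)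
  qed
  moreover have "openin (top_of_set Y_Bn) (Y_Bn \<inter> w' -` T)"
    by (rule continuous_openin_preimage[OF continuous_on_W_Bn[OF w'(1)] _ T]) (use W_Bn_Y_Bn[OF w'(1)] in auto)
  ultimately show ?thesis by simp
qed

lemma W_orbit_preimage:
  assumes "T \<subseteq> Y_Bn"
  shows "{y \<in> Y_Bn. W_orbit y \<in> W_orbit ` T} = (\<Union>w\<in>W_Bn. w ` T)"
proof (intro equalityI subsetI)
  fix y assume "y \<in> {y \<in> Y_Bn. W_orbit y \<in> W_orbit ` T}"
  then obtain z where "z \<in> T" "W_orbit z = W_orbit y" by auto
  then show "y \<in> (\<Union>w\<in>W_Bn. w ` T)" unfolding W_orbit_eq_iff by blast
next
  fix y assume "y \<in> (\<Union>w\<in>W_Bn. w ` T)"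
  then obtain w z where w: "w \<in> W_Bn" "z \<in> T" "y = w z" by blast
  then have "W_orbit z = W_orbit y" unfolding W_orbit_eq_iff by blast
  then show "y \<in> {y \<in> Y_Bn. W_orbit y \<in> W_orbit ` T}" using w W_Bn_Y_Bn[OF w(1)] assms by (auto intro: image_eqI[of _ _ z])
qed

text \<open>The orbit map is open because the saturation of an open set is the union of its
  translates.\<close>

lemma openin_W_orbit_image:
  fixes T :: "(complex ^ 'n) set"
  assumes "openin (top_of_set Y_Bn) T" shows "openin X_Bn (W_orbit ` T)"
proof -
  have TY: "T \<subseteq> Y_Bn" using assms openin_imp_subset by blast
  have "openin (top_of_set Y_Bn) (\<Union>w\<in>W_Bn. w ` T)" using openin_W_Bn_image[OF assms] by blast
  then show ?thesis unfolding openin_X_Bn W_orbit_preimage[OF TY] using TY by blast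
qed

text \<open>Over the image of a small neighborhood \<open>U0\<close> of \<open>x\<close> the sheets
  are the translates of \<open>U0\<close>, one for each group element.\<close>

lemma covering_W_orbit: "covering_map_top (top_of_set Y_Bn) (X_Bn :: (complex ^ 'n) set topology) W_orbit"
  unfolding covering_map_top_def
proof (intro conjI ballI continuous_map_W_orbit)
  fix q :: "(complex ^ 'n) set" assume "q \<in> topspace X_Bn"
  then obtain x where x: "x \<in> Y_Bn" "q = W_orbit x" by (auto simp: topspace_X_Bn)
  obtain \<epsilon> where \<epsilon>: "\<epsilon> > 0" "\<And>w v. w \<in> W_Bn \<Longrightarrow> v \<in> ball x \<epsilon> \<Longrightarrow> w v \<in> ball x \<epsilon> \<Longrightarrow> w = (\<lambda>y. y)"
    by (rule W_Bn_wandering[OF x(1)]) blast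
  define U0 where "U0 = Y_Bn \<inter> ball x \<epsilon>"
  have U0: "openin (top_of_set Y_Bn) U0" "U0 \<subseteq> Y_Bn" "x \<in> U0" using x(1) \<epsilon>(1) by (auto simp: U0_def)
  let ?U = "W_orbit ` U0"
  have oU: "openin X_Bn ?U" by (rule openin_W_orbit_image[OF U0(1)])
  \<comment> \<open>Translates of \<open>U0\<close> by different elements are disjoint. This yields
    both the disjointness of the sheets and the injectivity of the orbit map on each of
    them.\<close>
  have same: "w = v" if wv: "w \<in> W_Bn" "v \<in> W_Bn" "a \<in> U0" "b \<in> U0" "w a = v b" for w v a b
  proof -
    obtain v' where v': "v' \<in> W_Bn" "\<And>x. v' (v x) = x" "\<And>x. v (v' x) = x" by (rule W_Bn_inverse[OF wv(2)]) blast
    have "v' (w a) = b" using wv(5) v'(2) by simp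
    then have "(\<lambda>y. v' (w y)) = (\<lambda>y. y)" using \<epsilon>(2)[OF W_Bn_comp[OF v'(1) wv(1)], of a] wv(3,4) by (auto simp: U0_def)
    then show ?thesis using v'(3) by (metis ext)
  qed
  have "evenly_covered (top_of_set Y_Bn) X_Bn W_orbit ?U"
    unfolding evenly_covered_def
  proof (intro conjI exI[of _ "(\<lambda>w. w ` U0) ` W_Bn"] ballI)
    show "openin X_Bn ?U" by (rule oU)
    show "\<Union>((\<lambda>w. w ` U0) ` W_Bn) = {y \<in> topspace (top_of_set Y_Bn). W_orbit y \<in> ?U}"
      using W_orbit_preimage[OF U0(2)] by simp
    show "pairwise disjnt ((\<lambda>w. w ` U0) ` W_Bn)"
      unfolding pairwise_def disjnt_def using same by blast
    fix V assume "V \<in> (\<lambda>w. w ` U0) ` W_Bn"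
    then obtain w where w: "w \<in> W_Bn" "V = w ` U0" by blast
    show oV: "openin (top_of_set Y_Bn) V" unfolding w(2) by (rule openin_W_Bn_image[OF U0(1) w(1)])
    have VY: "V \<subseteq> Y_Bn" using oV openin_imp_subset by blast
    have "homeomorphic_map (subtopology (top_of_set Y_Bn) V) (subtopology X_Bn ?U) W_orbit"
    proof (rule bijective_open_imp_homeomorphic_map)
      have im: "W_orbit ` V = ?U"
      proof -
        have "W_orbit (w u) = W_orbit u" for u using W_orbit_eq_iff[of u "w u"] w(1) by blast
        then show ?thesis unfolding w(2) image_image by simp
      qed
      have UX: "?U \<subseteq> topspace X_Bn" using U0(2) by (auto simp: topspace_X_Bn)
      show "continuous_map (subtopology (top_of_set Y_Bn) V) (subtopology X_Bn ?U) W_orbit"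
        using continuous_map_from_subtopology[OF continuous_map_W_orbit] im VY
        by (auto simp: continuous_map_in_subtopology Int_absorb1 simp del: continuous_map_subtopology_eu)
      show "open_map (subtopology (top_of_set Y_Bn) V) (subtopology X_Bn ?U) W_orbit"
        unfolding open_map_def
      proof (intro allI impI)
        fix T assume "openin (subtopology (top_of_set Y_Bn) V) T"
        then have T: "openin (top_of_set Y_Bn) T" "T \<subseteq> V" using openin_open_subtopology[OF oV] by blast+
        then have "openin X_Bn (W_orbit ` T)" "W_orbit ` T \<subseteq> ?U" using openin_W_orbit_image im by blast+
        then show "openin (subtopology X_Bn ?U) (W_orbit ` T)" using openin_open_subtopology[OF oU] by blast
      qed
      show "W_orbit ` topspace (subtopology (top_of_set Y_Bn) V) = topspace (subtopology X_Bn ?U)"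
        using im VY UX by (auto simp: Int_absorb1)
      show "inj_on W_orbit (topspace (subtopology (top_of_set Y_Bn) V))"
      proof (rule inj_onI)
        fix a b assume "a \<in> topspace (subtopology (top_of_set Y_Bn) V)" "b \<in> topspace (subtopology (top_of_set Y_Bn) V)" "W_orbit a = W_orbit b"
        then obtain c d v where "c \<in> U0" "d \<in> U0" "a = w c" "b = w d" and v: "v \<in> W_Bn" "b = v a"
          unfolding W_orbit_eq_iff w(2) by auto
        moreover have "(\<lambda>y. v (w y)) \<in> W_Bn" by (rule W_Bn_comp[OF v(1) w(1)])
        ultimately have "(\<lambda>y. v (w y)) = w" using same[of "\<lambda>y. v (w y)" w c d] w(1) by simp
        then show "a = b" using v(2) \<open>a = w c\<close> by metis
      qed
    qed
    then show "\<exists>s. homeomorphic_maps (subtopology (top_of_set Y_Bn) V) (subtopology X_Bn ?U) W_orbit s"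
      by (simp add: homeomorphic_map_maps)
  qed
  then show "\<exists>U. q \<in> U \<and> evenly_covered (top_of_set Y_Bn) X_Bn W_orbit U" using x(2) U0(3) by blast
qed

section \<open>Asphericity of the complement and of its quotient\<close>

lemma K_pi_1_Y_Bn: "K_pi_1 (top_of_set (Y_Bn :: (complex ^ 'n) set))"
  unfolding K_pi_1_def nsphere_eq_sph
proof (intro conjI allI impI)
  show "path_connected_space (top_of_set (Y_Bn :: (complex ^ 'n) set))"
    using path_connected_Y_Bn[folded path_connectedin_euclidean] unfolding path_connectedin_def by simp
  fix k :: nat and f :: "(nat \<Rightarrow> real) \<Rightarrow> complex ^ 'n" assume k: "2 \<le> k" and f: "continuous_map (top_of_set (sph k)) (top_of_set Y_Bn) f"
  interpret aspherical_test "sph k" by (rule aspherical_test_sph[OF k])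
  obtain c where "c \<in> Y_Bn" "homotopic_on (sph k) Y_Bn f (\<lambda>_. c)"
    by (rule Y_Bn_null[of f]) (use f north_in_sph in auto)
  then show "\<exists>c\<in>topspace (top_of_set Y_Bn). homotopic_on (sph k) Y_Bn f (\<lambda>_. c)" by auto
qed

text \<open>A map from a sphere of dimension at least 2 lifts to the covering, is contracted there,
  and the contraction is projected. Surjectivity supplies a point over the image of the pole to
  start the lift, and it carries over path connectedness.\<close>

lemma K_pi_1_covered:
  assumes cov: "covering_map_top Y Q p" and onto: "p ` topspace Y = topspace Q" and Y: "K_pi_1 Y"
  shows "K_pi_1 Q"
  unfolding K_pi_1_def
proof (intro conjI allI impI)
  have cp: "continuous_map Y Q p" using cov by (simp add: covering_map_top_def)
  have "path_connectedin Y (topspace Y)" using Y by (simp add: K_pi_1_def path_connectedin_topspace)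
  then have "path_connectedin Q (p ` topspace Y)" by (rule path_connectedin_continuous_map_image[OF cp])
  then show "path_connected_space Q" by (simp add: onto path_connectedin_topspace)
  fix k f assume k: "2 \<le> k" and f: "continuous_map (nsphere k) Q f"
  then have f': "continuous_map (top_of_set (sph k)) Q f" by (simp add: nsphere_eq_sph)
  have "f (north k) \<in> topspace Q" using f' north_in_sph by (auto simp: continuous_map_def)
  then obtain y0 where y0: "y0 \<in> topspace Y" "p y0 = f (north k)" unfolding onto[symmetric] by auto
  obtain g where g: "continuous_map (top_of_set (sph k)) Y g" "\<And>x. x \<in> sph k \<Longrightarrow> p (g x) = f x"
    by (rule covering_lift_sphere[OF cov k f' y0]) blast
  obtain c where c: "c \<in> topspace Y" "homotopic_with (\<lambda>_. True) (nsphere k) Y g (\<lambda>_. c)"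
    using Y k g(1) unfolding K_pi_1_def nsphere_eq_sph by blast
  have "homotopic_with (\<lambda>_. True) (nsphere k) Q (p \<circ> g) (p \<circ> (\<lambda>_. c))"
    by (rule homotopic_with_compose_continuous_map_left[OF c(2) cp]) simp
  then have "homotopic_with (\<lambda>_. True) (nsphere k) Q f (\<lambda>_. p c)"
    by (rule homotopic_with_eq) (use g(2) in \<open>auto simp: nsphere_eq_sph\<close>)
  moreover have "p c \<in> topspace Q" using c(1) onto by blast
  ultimately show "\<exists>c\<in>topspace Q. homotopic_with (\<lambda>_. True) (nsphere k) Q f (\<lambda>_. c)" by blast
qed

theorem theorem1p2:
  assumes "CARD('n) \<ge> 2"
  shows "K_pi_1 (top_of_set (Y_Bn :: (complex ^ 'n) set)) \<and> K_pi_1 (X_Bn :: (complex ^ 'n) set topology)"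
proof
  show Y: "K_pi_1 (top_of_set (Y_Bn :: (complex ^ 'n) set))" by (rule K_pi_1_Y_Bn)
  show "K_pi_1 (X_Bn :: (complex ^ 'n) set topology)"
    by (rule K_pi_1_covered[OF covering_W_orbit _ Y]) (simp add: topspace_X_Bn)
qed

end
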